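(* Let $q$ be a power of an odd prime, $k\ge1$ an integer and $0<\epsilon<1$. For nonnegative integers $n,n_1,n_2$ define $$M_k(q;n,n_1,n_2):=\frac{1}{|\widehat{\mathcal{F}}_{[n,n_1,n_2]}|}\sum_{(f,f_1,f_2)\in\widehat{\mathcal{F}}_{[n,n_1,n_2]}}\left(\frac{\mathrm{Tr}(\mathrm{Frob}_{C_{(f,f_1,f_2)}})}{\sqrt{1+q}}\right)^k,$$ where $C_{(f,f_1,f_2)}$ is the biquadratic curve with affine model $y_1^2=ff_1(t)$, $y_2^2=ff_2(t)$, so that $\mathrm{Tr}(\mathrm{Frob}_{C_{(f,f_1,f_2)}})=-\widehat{S}(f,f_1,f_2)$. Then $$M_k(q;n,n_1,n_2)=\mathbb{E}\left(\left(-\frac{1}{\sqrt{1+q}}\sum_{i=1}^{q+1}X_i\right)^k\right)+O\big(q^{-\frac{1-\epsilon}{2}\min(n,n_1,n_2)+k}\big),$$ where $X_1,\dots,X_{q+1}$ are i.i.d. random variables taking the value $-1$ with probability $\frac{3(q+2)}{4(q+3)}$, the value $1$ with probability $\frac{6}{4(q+3)}$, and the value $3$ with probability $\frac{q}{4(q+3)}$.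
   Context: $\mathcal{F}_d$ (resp. $\widehat{\mathcal{F}}_d$) is the set of monic (resp. arbitrary) square-free polynomials of degree $d$ in $\mathbb{F}_q[t]$. $\widehat{\mathcal{F}}_{(n,n_1,n_2)}=\{(f,f_1,f_2)\in\mathcal{F}_n\times\widehat{\mathcal{F}}_{n_1}\times\widehat{\mathcal{F}}_{n_2}: f,f_1,f_2\text{ pairwise coprime}\}$ and $\widehat{\mathcal{F}}_{[n,n_1,n_2]}=\widehat{\mathcal{F}}_{(n,n_1,n_2)}\cup\widehat{\mathcal{F}}_{(n-1,n_1,n_2)}\cup\widehat{\mathcal{F}}_{(n,n_1-1,n_2)}\cup\widehat{\mathcal{F}}_{(n,n_1,n_2-1)}$. With $\chi$ the quadratic character of $\mathbb{F}_q^*$, $\chi(0)=0$, and $\chi(F(\infty))$ equal to $0$ if $\deg F$ is odd and to $\pm1$ according as the leading coefficient of $F$ is a square or not if $\deg F$ is even, $\widehat{S}(f,f_1,f_2)=\sum_{x\in\mathbb{P}^1(\mathbb{F}_q)}(\chi(ff_1(x))+\chi(ff_2(x))+\chi(f_1f_2(x)))$, and $\#C_{(f,f_1,f_2)}(\mathbb{F}_q)=q+1+\widehat S(f,f_1,f_2)$. (The paper defines $M_k$ as the average, over the moduli space of biquadratic curves whose three hyperelliptic quotients have given genera, counted with weights $1/|\mathrm{Aut}(C)|$; by the paper this equals the uniform average over $\widehat{\mathcal{F}}_{[n,n_1,n_2]}$ used here.)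
   Formalization: The formal theorem assumes n, n_1, n_2 all have the same parity (as the genera of the three quotients force); for mixed parity the claim fails already for k=2, because of the point at infinity. The O-constant depends only on k and ε. *)

theory Defs
  imports "HOL-Probability.Probability" "HOL-Probability.Product_PMF"
    "HOL-Algebra.Polynomial_Divisibility"
begin

text \<open>
  The finite field \<open>\<bbbF>\<^sub>q\<close> is a structure \<open>R\<close> with a finite carrier rather than a type, so that a
  constant can be chosen uniformly in \<open>q\<close>. Elements of \<open>\<bbbF>\<^sub>q[t]\<close> are elements of
  \<^term>\<open>carrier (poly_ring R)\<close>: coefficient lists, leading coefficient first, with \<open>[]\<close> for zero.
\<close>

definition squarefree_in :: "('a, 'b) ring_scheme \<Rightarrow> 'a \<Rightarrow> bool" where
  "squarefree_in P a \<longleftrightarrow> (\<forall>g\<in>carrier P. (g [^]\<^bsub>P\<^esub> (2::nat)) divides\<^bsub>P\<^esub> a \<longrightarrow> g \<in> Units P)"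

definition coprime_in :: "('a, 'b) ring_scheme \<Rightarrow> 'a \<Rightarrow> 'a \<Rightarrow> bool" where
  "coprime_in P a b \<longleftrightarrow>
     (\<forall>g\<in>carrier P. g divides\<^bsub>P\<^esub> a \<longrightarrow> g divides\<^bsub>P\<^esub> b \<longrightarrow> g \<in> Units P)"

text \<open>
  Degrees are integers in the next four definitions, so that a family with prescribed degree
  \<open>-1\<close> is empty.
\<close>

definition sqfree_polys :: "('a, 'b) ring_scheme \<Rightarrow> int \<Rightarrow> 'a list set" where
  "sqfree_polys R d =
     {f \<in> carrier (poly_ring R) - {\<zero>\<^bsub>poly_ring R\<^esub>}.
        int (Polynomials.degree f) = d \<and> squarefree_in (poly_ring R) f}"

definition monic_sqfree_polys :: "('a, 'b) ring_scheme \<Rightarrow> int \<Rightarrow> 'a list set" where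
  "monic_sqfree_polys R d = {f \<in> sqfree_polys R d. Polynomials.lead_coeff f = \<one>\<^bsub>R\<^esub>}"

definition coprime_triples ::
    "('a, 'b) ring_scheme \<Rightarrow> int \<Rightarrow> int \<Rightarrow> int \<Rightarrow> ('a list \<times> 'a list \<times> 'a list) set" where
  "coprime_triples R n n1 n2 =
     {(f, f1, f2). f \<in> monic_sqfree_polys R n \<and> f1 \<in> sqfree_polys R n1 \<and> f2 \<in> sqfree_polys R n2
        \<and> coprime_in (poly_ring R) f f1 \<and> coprime_in (poly_ring R) f f2
        \<and> coprime_in (poly_ring R) f1 f2}"

definition biquadratic_family ::
    "('a, 'b) ring_scheme \<Rightarrow> int \<Rightarrow> int \<Rightarrow> int \<Rightarrow> ('a list \<times> 'a list \<times> 'a list) set" where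
  "biquadratic_family R n n1 n2 =
     coprime_triples R n n1 n2 \<union> coprime_triples R (n - 1) n1 n2
     \<union> coprime_triples R n (n1 - 1) n2 \<union> coprime_triples R n n1 (n2 - 1)"

definition quadratic_char :: "('a, 'b) ring_scheme \<Rightarrow> 'a \<Rightarrow> int" where
  "quadratic_char R a =
     (if a = \<zero>\<^bsub>R\<^esub> then 0 else if \<exists>b\<in>carrier R. a = b \<otimes>\<^bsub>R\<^esub> b then 1 else - 1)"

text \<open>The points of \<open>\<bbbP>\<^sup>1(\<bbbF>\<^sub>q)\<close>; \<^term>\<open>None\<close> is the point at infinity.\<close>

definition proj_line :: "('a, 'b) ring_scheme \<Rightarrow> 'a option set" where
  "proj_line R = insert None (Some ` carrier R)"

definition quadratic_char_at :: "('a, 'b) ring_scheme \<Rightarrow> 'a list \<Rightarrow> 'a option \<Rightarrow> int" where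
  "quadratic_char_at R F x =
     (case x of
        Some a \<Rightarrow> quadratic_char R (ring.eval R F a)
      | None \<Rightarrow> if odd (Polynomials.degree F) then 0
                else quadratic_char R (Polynomials.lead_coeff F))"

definition S_hat :: "('a, 'b) ring_scheme \<Rightarrow> 'a list \<Rightarrow> 'a list \<Rightarrow> 'a list \<Rightarrow> int" where
  "S_hat R f f1 f2 =
     (\<Sum>x\<in>proj_line R.
        quadratic_char_at R (f \<otimes>\<^bsub>poly_ring R\<^esub> f1) x
        + quadratic_char_at R (f \<otimes>\<^bsub>poly_ring R\<^esub> f2) x
        + quadratic_char_at R (f1 \<otimes>\<^bsub>poly_ring R\<^esub> f2) x)"

text \<open>
  The number of \<open>\<bbbF>\<^sub>q\<close>-points of the smooth projective model \<open>C\<close> of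
  \<open>y\<^sub>1\<^sup>2 = f f\<^sub>1(t), y\<^sub>2\<^sup>2 = f f\<^sub>2(t)\<close>, given by its character-sum formula, and the trace of Frobenius on
  the first cohomology, \<open>q + 1 - #C(\<bbbF>\<^sub>q)\<close>.
\<close>

definition curve_points :: "('a, 'b) ring_scheme \<Rightarrow> 'a list \<Rightarrow> 'a list \<Rightarrow> 'a list \<Rightarrow> int" where
  "curve_points R f f1 f2 = int (card (carrier R)) + 1 + S_hat R f f1 f2"

definition frob_trace :: "('a, 'b) ring_scheme \<Rightarrow> 'a list \<Rightarrow> 'a list \<Rightarrow> 'a list \<Rightarrow> int" where
  "frob_trace R f f1 f2 = int (card (carrier R)) + 1 - curve_points R f f1 f2"

lemma frob_trace_eq: "frob_trace R f f1 f2 = - S_hat R f f1 f2"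
  by (simp add: frob_trace_def curve_points_def)

definition trace_moment :: "nat \<Rightarrow> ('a, 'b) ring_scheme \<Rightarrow> nat \<Rightarrow> nat \<Rightarrow> nat \<Rightarrow> real" where
  "trace_moment k R n n1 n2 =
     (1 / real (card (biquadratic_family R (int n) (int n1) (int n2)))) *
     (\<Sum>(f, f1, f2)\<in>biquadratic_family R (int n) (int n1) (int n2).
        (real_of_int (frob_trace R f f1 f2) / sqrt (1 + real (card (carrier R)))) ^ k)"

definition point_pmf :: "nat \<Rightarrow> real pmf" where
  "point_pmf q = pmf_of_list
     [(- 1, 3 * (real q + 2) / (4 * (real q + 3))),
      (1, 6 / (4 * (real q + 3))),
      (3, real q / (4 * (real q + 3)))]"

lemma pmf_point_pmf:
  "pmf (point_pmf q) (- 1) = 3 * (real q + 2) / (4 * (real q + 3))"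
  "pmf (point_pmf q) 1 = 6 / (4 * (real q + 3))"
  "pmf (point_pmf q) 3 = real q / (4 * (real q + 3))"
proof -
  have "pmf_of_list_wf
     [(- 1 :: real, 3 * (real q + 2) / (4 * (real q + 3))),
      (1, 6 / (4 * (real q + 3))),
      (3, real q / (4 * (real q + 3)))]"
  proof (rule pmf_of_list_wfI)
    have "4 * (real q + 3) \<noteq> 0"
      by (simp add: add_eq_0_iff)
    moreover have "3 * (real q + 2) + (6 + real q) = 4 * (real q + 3)"
      by simp
    ultimately show "sum_list (map snd
     [(- 1 :: real, 3 * (real q + 2) / (4 * (real q + 3))),
      (1, 6 / (4 * (real q + 3))),
      (3, real q / (4 * (real q + 3)))]) = 1"
      by (simp only: list.map snd_conv sum_list.Cons sum_list.Nil add_0_right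
            add_divide_distrib[symmetric] divide_self not_False_eq_True)
  qed auto
  note * = pmf_pmf_of_list[OF this]
  show "pmf (point_pmf q) (- 1) = 3 * (real q + 2) / (4 * (real q + 3))"
    "pmf (point_pmf q) 1 = 6 / (4 * (real q + 3))"
    "pmf (point_pmf q) 3 = real q / (4 * (real q + 3))"
    unfolding point_pmf_def * by simp_all
qed

lemma finite_biquadratic_family:
  assumes "finite (carrier R)"
  shows "finite (biquadratic_family R n n1 n2)"
proof -
  have fin: "finite (sqfree_polys R d)" for d
  proof (rule finite_subset)
    show "sqfree_polys R d \<subseteq> {xs. set xs \<subseteq> carrier R \<and> length xs \<le> nat d + 1}"
      by (auto simp: sqfree_polys_def univ_poly_carrier[symmetric] univ_poly_zero polynomial_def)
    show "finite {xs. set xs \<subseteq> carrier R \<and> length xs \<le> nat d + 1}"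
      using assms by (rule finite_lists_length_le)
  qed
  have "coprime_triples R d d1 d2 \<subseteq> sqfree_polys R d \<times> sqfree_polys R d1 \<times> sqfree_polys R d2"
    for d d1 d2
    by (auto simp: coprime_triples_def monic_sqfree_polys_def)
  then have "finite (coprime_triples R d d1 d2)" for d d1 d2
    by (rule finite_subset) (intro finite_cartesian_product fin)
  then show ?thesis
    by (simp add: biquadratic_family_def)
qed

end

theory Submission
  imports Defs "HOL-Algebra.Multiplicative_Group" "HOL-Real_Asymp.Real_Asymp"
begin

text \<open>
  The trace of Frobenius is minus a sum of character values over \<open>\<bbbP>\<^sup>1(\<bbbF>\<^sub>q)\<close>, so its \<open>k\<close>-th power is a
  sum over \<open>k\<close>-tuples of points, and it suffices that the contributions of at most \<open>k\<close> fixed points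
  behave like independent variables of law \<^term>\<open>point_pmf\<close>. Up to leading coefficients, a curve is a
  triple of monic polynomials with squarefree product. Squarefreeness is detected by summing the
  Moebius function over the squares \<open>E\<^sup>2\<close> dividing the product. For small \<open>E\<close>, residues modulo \<open>E\<^sup>2\<close> and
  nonzero quadratic characters at the chosen points are jointly equidistributed; for large \<open>E\<close> there
  are few triples. Triples with a zero at a chosen point \<open>x\<close> are obtained from triples of lower degree
  by multiplying one member by \<open>t - x\<close>, so the points are freed of the condition one by one. In the
  same way the three subfamilies with one lowered degree account for a zero at infinity. The
  density of the family occurs with and without the weights and cancels in the average.
\<close>

section \<open>Graded factorial monoids\<close>

locale graded_factorial_monoid = primeness_condition_monoid G
  for G :: "('m, 'g) monoid_scheme" (structure) +
  fixes q :: nat and deg :: "'m \<Rightarrow> nat"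
  assumes q_ge_2: "q \<ge> 2"
    and deg_mult: "\<lbrakk>a \<in> carrier G; b \<in> carrier G\<rbrakk> \<Longrightarrow> deg (a \<otimes> b) = deg a + deg b"
    and deg_eq_0D: "\<lbrakk>a \<in> carrier G; deg a = 0\<rbrakk> \<Longrightarrow> a = \<one>"
    and card_deg: "card {a \<in> carrier G. deg a = n} = q ^ n"
begin

lemma deg_one: "deg \<one> = 0"
  using deg_mult[of \<one> \<one>] by simp

lemma deg_eq_0_iff: "a \<in> carrier G \<Longrightarrow> deg a = 0 \<longleftrightarrow> a = \<one>"
  using deg_eq_0D deg_one by blast

lemma deg_pos_iff: "a \<in> carrier G \<Longrightarrow> 0 < deg a \<longleftrightarrow> a \<noteq> \<one>"
  using deg_eq_0_iff[of a] by auto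

lemma deg_divides_le: "\<lbrakk>a divides b; a \<in> carrier G\<rbrakk> \<Longrightarrow> deg a \<le> deg b"
  by (elim dividesE) (simp add: deg_mult)

lemma divides_one_iff: "a \<in> carrier G \<Longrightarrow> a divides \<one> \<longleftrightarrow> a = \<one>"
  using deg_divides_le[of a \<one>] by (auto simp: deg_one deg_eq_0_iff)

lemma Units_eq_one: "Units G = {\<one>}"
  using Unit_eq_dividesone divides_one_iff Units_closed by auto

lemma finite_deg: "finite {a \<in> carrier G. deg a = n}"
  using card_deg[of n] q_ge_2 by (intro card_ge_0_finite) simp

lemma finite_deg_le: "finite {a \<in> carrier G. deg a \<le> n}"
proof -
  have "{a \<in> carrier G. deg a \<le> n} = (\<Union>i\<le>n. {a \<in> carrier G. deg a = i})" by auto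
  then show ?thesis using finite_deg by simp
qed

lemma exists_prime_divisor:
  assumes "a \<in> carrier G" "a \<noteq> \<one>"
  shows "\<exists>p\<in>carrier G. prime G p \<and> p divides a"
  using assms
proof (induction "deg a" arbitrary: a rule: less_induct)
  case less
  show ?case
  proof (cases "irreducible G a")
    case True
    then show ?thesis using less.prems irreducible_prime by blast
  next
    case False
    then obtain b where b: "b \<in> carrier G" "properfactor G b a" "b \<noteq> \<one>"
      using less.prems by (auto simp: irreducible_def Units_eq_one)
    then obtain c where c: "c \<in> carrier G" "a = b \<otimes> c" by (auto simp: properfactor_def)
    have "c \<noteq> \<one>" using b c by (auto simp: properfactor_def)
    then have "deg b < deg a" using b c by (simp add: deg_mult deg_pos_iff)
    from less.hyps[OF this] b obtain p where "p \<in> carrier G" "prime G p" "p divides b" by blast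
    then show ?thesis using c by (auto intro: divides_prod_r)
  qed
qed

lemma prime_ne_one: "prime G p \<Longrightarrow> p \<noteq> \<one>"
  by (auto simp: prime_def)

lemma prime_divides_mult_iff:
  "\<lbrakk>prime G p; p \<in> carrier G; a \<in> carrier G; b \<in> carrier G\<rbrakk>
    \<Longrightarrow> p divides a \<otimes> b \<longleftrightarrow> p divides a \<or> p divides b"
  by (meson prime_divides divides_prod_l divides_prod_r)

lemma prime_divides_primeD:
  assumes "prime G p" "prime G r" "p \<in> carrier G" "r \<in> carrier G" "p divides r"
  shows "p = r"
proof -
  have "p \<sim> r"
    using divides_irreducible_condition[OF prime_irreducible] assms prime_ne_one Units_eq_one by blast
  then obtain u where "u \<in> Units G" "p = r \<otimes> u" using associatedD2 assms by blast
  then show ?thesis using assms by (simp add: Units_eq_one)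
qed

lemma prime_square_divides_mult_iff:
  assumes "prime G p" "p \<in> carrier G" "a \<in> carrier G" "b \<in> carrier G" "\<not> p divides a"
  shows "p \<otimes> p divides a \<otimes> b \<longleftrightarrow> p \<otimes> p divides b"
  using prime_pow_divides_iff[of p a b 2] assms by (simp add: numeral_2_eq_2)

definition sqfree :: "'m \<Rightarrow> bool" where
  "sqfree F \<longleftrightarrow> (\<forall>g\<in>carrier G. g \<otimes> g divides F \<longrightarrow> g = \<one>)"

lemma sqfree_iff_prime:
  assumes "F \<in> carrier G"
  shows "sqfree F \<longleftrightarrow> (\<forall>p\<in>carrier G. prime G p \<longrightarrow> \<not> p \<otimes> p divides F)"
proof
  assume "sqfree F"
  then show "\<forall>p\<in>carrier G. prime G p \<longrightarrow> \<not> p \<otimes> p divides F"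
    using prime_ne_one by (auto simp: sqfree_def)
next
  assume no_prime: "\<forall>p\<in>carrier G. prime G p \<longrightarrow> \<not> p \<otimes> p divides F"
  show "sqfree F" unfolding sqfree_def
  proof (intro ballI impI, rule ccontr)
    fix g assume g: "g \<in> carrier G" "g \<otimes> g divides F" "g \<noteq> \<one>"
    obtain p where p: "p \<in> carrier G" "prime G p" "p divides g" using exists_prime_divisor g by blast
    have "p \<otimes> p divides p \<otimes> g" "p \<otimes> g divides g \<otimes> g" using p g by simp_all
    then have "p \<otimes> p divides F" using p g by (meson divides_trans m_closed)
    then show False using no_prime p by blast
  qed
qed

lemma sqfree_divides: "\<lbrakk>sqfree F; a divides F\<rbrakk> \<Longrightarrow> sqfree a"
  unfolding sqfree_def using divides_trans m_closed by blast

lemma sqfree_one: "sqfree \<one>"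
  unfolding sqfree_def using divides_one_iff deg_eq_0_iff deg_mult by (metis add_is_0 m_closed)

lemma sqfree_prime_mult_iff:
  assumes p: "prime G p" "p \<in> carrier G" and E: "E \<in> carrier G"
  shows "sqfree (p \<otimes> E) \<longleftrightarrow> sqfree E \<and> \<not> p divides E"
proof
  assume sq: "sqfree (p \<otimes> E)"
  then have "\<not> p divides E" using p E prime_ne_one[OF p(1)] by (auto simp: sqfree_def)
  then show "sqfree E \<and> \<not> p divides E"
    using sqfree_divides[OF sq] p E by (simp add: divides_prod_l)
next
  assume sq: "sqfree E \<and> \<not> p divides E"
  show "sqfree (p \<otimes> E)"
    unfolding sqfree_iff_prime[OF m_closed[OF p(2) E]]
  proof (intro ballI impI notI)
    fix r assume r: "r \<in> carrier G" "prime G r" "r \<otimes> r divides p \<otimes> E"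
    show False
    proof (cases "r = p")
      case True
      then show False using r sq p E by simp
    next
      case False
      then have "\<not> r divides p" using prime_divides_primeD p r by blast
      then have "r \<otimes> r divides E" using r p E prime_square_divides_mult_iff by blast
      then show False using sq r E by (auto simp: sqfree_iff_prime)
    qed
  qed
qed

lemma exists_sqfree_part:
  assumes "F \<in> carrier G"
  shows "\<exists>E\<in>carrier G. \<exists>c\<in>carrier G. F = E \<otimes> E \<otimes> c \<and> sqfree c"
  using assms
proof (induction "deg F" arbitrary: F rule: less_induct)
  case less
  show ?case
  proof (cases "sqfree F")
    case True
    then show ?thesis using less.prems by (intro bexI[of _ \<one>] bexI[of _ F]) auto
  next
    case False
    then obtain g d where g: "g \<in> carrier G" "g \<noteq> \<one>" "d \<in> carrier G" "F = g \<otimes> g \<otimes> d"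
      by (auto simp: sqfree_def)
    then have "deg d < deg F" by (simp add: deg_mult deg_pos_iff)
    from less.hyps[OF this g(3)] obtain E c
      where E: "E \<in> carrier G" "c \<in> carrier G" "d = E \<otimes> E \<otimes> c" "sqfree c" by blast
    then have "F = (g \<otimes> E) \<otimes> (g \<otimes> E) \<otimes> c" using g by (simp add: m_ac)
    then show ?thesis using E g by blast
  qed
qed

definition moebius_mu :: "'m \<Rightarrow> real" where
  "moebius_mu E = (if sqfree E then (-1) ^ card {p \<in> carrier G. prime G p \<and> p divides E} else 0)"

lemma abs_moebius_mu_le: "\<bar>moebius_mu E\<bar> \<le> 1"
  by (simp add: moebius_mu_def power_abs)

lemma moebius_mu_one: "moebius_mu \<one> = 1"
proof -
  have "{p \<in> carrier G. prime G p \<and> p divides \<one>} = {}"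
    using divides_one_iff prime_ne_one by blast
  then show ?thesis by (simp only: moebius_mu_def sqfree_one if_True card.empty power_0)
qed

lemma moebius_mu_prime_mult:
  assumes p: "prime G p" "p \<in> carrier G" and E: "E \<in> carrier G" "\<not> p divides E"
  shows "moebius_mu (p \<otimes> E) = - moebius_mu E"
proof -
  let ?D = "\<lambda>E. {r \<in> carrier G. prime G r \<and> r divides E}"
  have "?D (p \<otimes> E) = insert p (?D E)"
    using p E prime_divides_primeD[OF _ p(1)] by (auto simp: prime_divides_mult_iff)
  moreover have "finite (?D E)"
    by (rule finite_subset[OF _ finite_deg_le[of "deg E"]]) (use deg_divides_le in auto)
  ultimately have "card (?D (p \<otimes> E)) = Suc (card (?D E))" using E by simp
  then show ?thesis using assms by (simp add: moebius_mu_def sqfree_prime_mult_iff)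
qed

lemma finite_square_divisors:
  assumes "F \<in> carrier G"
  shows "finite {E \<in> carrier G. E \<otimes> E divides F}"
  by (rule finite_subset[OF _ finite_deg_le[of "deg F"]])
    (use deg_divides_le[of "_ \<otimes> _" F] deg_mult in fastforce)

lemma prime_mult_square_divides:
  assumes p: "prime G p" "p \<in> carrier G" "p \<otimes> p divides F"
    and E: "E \<in> carrier G" "E \<otimes> E divides F" "\<not> p divides E"
  shows "(p \<otimes> E) \<otimes> (p \<otimes> E) divides F"
proof -
  obtain c where c: "c \<in> carrier G" "F = E \<otimes> E \<otimes> c" using E by blast
  have "\<not> p divides E \<otimes> E" using p E by (simp add: prime_divides_mult_iff)
  then have "p \<otimes> p divides c" using p E c prime_square_divides_mult_iff by simp
  then have "(E \<otimes> E) \<otimes> (p \<otimes> p) divides F" using c p E by simp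
  then show ?thesis using p E by (simp add: m_ac)
qed

lemma sum_moebius_square_divisors:
  assumes F: "F \<in> carrier G"
  shows "(\<Sum>E | E \<in> carrier G \<and> E \<otimes> E divides F. moebius_mu E) = of_bool (sqfree F)"
proof (cases "sqfree F")
  case True
  then have "{E \<in> carrier G. E \<otimes> E divides F} = {\<one>}"
    using F by (auto simp: sqfree_def unit_divides)
  then show ?thesis using True by (simp add: moebius_mu_one)
next
  case False
  \<comment> \<open>multiplication by \<open>p\<close> pairs off the square divisors with opposite signs\<close>
  then obtain p where p: "prime G p" "p \<in> carrier G" "p \<otimes> p divides F"
    using F sqfree_iff_prime by blast
  define A where "A = {E \<in> carrier G. E \<otimes> E divides F}"
  define N where "N = {E \<in> A. \<not> p divides E}"
  have fin: "finite A" unfolding A_def by (rule finite_square_divisors[OF F])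
  have NA: "N \<subseteq> A" "N \<subseteq> carrier G" by (auto simp: N_def A_def)
  have pN: "(\<otimes>) p ` N \<subseteq> A - N"
    using prime_mult_square_divides[OF p] p by (auto simp: N_def A_def)
  have "moebius_mu E = 0" if E: "E \<in> (A - N) - (\<otimes>) p ` N" for E
  proof -
    obtain c where c: "c \<in> carrier G" "E = p \<otimes> c" using E by (auto simp: N_def)
    have "c \<otimes> c divides E \<otimes> E" unfolding c(2) using c p by (auto simp: m_ac intro: dividesI[of "p \<otimes> p"])
    then have "c \<in> A" using E c p by (auto simp: A_def intro: divides_trans)
    then have "p divides c" using E c by (auto simp: N_def)
    then show ?thesis using c p by (simp add: moebius_mu_def sqfree_prime_mult_iff)
  qed
  then have "sum moebius_mu (A - N) = sum moebius_mu ((\<otimes>) p ` N)"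
    using pN fin by (intro sum.mono_neutral_right) auto
  also have "\<dots> = (\<Sum>E\<in>N. moebius_mu (p \<otimes> E))"
    using NA p by (subst sum.reindex) (auto simp: inj_on_def l_cancel subset_iff)
  also have "\<dots> = - sum moebius_mu N"
    using NA p by (simp add: N_def moebius_mu_prime_mult subset_iff flip: sum_negf)
  finally have "sum moebius_mu A = 0" using sum.subset_diff[OF NA(1) fin, of moebius_mu] by simp
  then show ?thesis using False by (simp add: A_def)
qed

end

section \<open>Families of elements\<close>

context graded_factorial_monoid
begin

abbreviation family_prod :: "('i::finite \<Rightarrow> 'm) \<Rightarrow> 'm" where
  "family_prod f \<equiv> finprod G f UNIV"

definition scale_at :: "'i \<Rightarrow> 'm \<Rightarrow> ('i \<Rightarrow> 'm) \<Rightarrow> 'i \<Rightarrow> 'm" where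
  "scale_at i p f = f(i := p \<otimes> f i)"

lemma scale_at_closed:
  "\<lbrakk>p \<in> carrier G; f \<in> UNIV \<rightarrow> carrier G\<rbrakk> \<Longrightarrow> scale_at i p f \<in> UNIV \<rightarrow> carrier G"
  by (auto simp: scale_at_def Pi_iff)

lemma finprod_indicator:
  fixes i :: "'i::finite"
  shows "p \<in> carrier G \<Longrightarrow> (\<Otimes>l\<in>UNIV. if l = i then p else \<one>) = p"
  using finprod_singleton_swap[of i UNIV "\<lambda>_. p"] by simp

lemma scale_at_eq_mult:
  "f \<in> UNIV \<rightarrow> carrier G \<Longrightarrow> scale_at i p f l = (if l = i then p else \<one>) \<otimes> f l"
  by (auto simp: scale_at_def Pi_iff)

lemma family_prod_scale_at:
  assumes "p \<in> carrier G" "f \<in> UNIV \<rightarrow> carrier G"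
  shows "family_prod (scale_at i p f) = p \<otimes> family_prod f"
proof -
  have "family_prod (scale_at i p f) = (\<Otimes>l\<in>UNIV. (if l = i then p else \<one>) \<otimes> f l)"
    using assms by (intro finprod_cong') (auto simp: scale_at_eq_mult)
  then show ?thesis using assms by (simp add: finprod_multf finprod_indicator)
qed

lemma deg_finprod:
  "\<lbrakk>finite A; f \<in> A \<rightarrow> carrier G\<rbrakk> \<Longrightarrow> deg (finprod G f A) = (\<Sum>i\<in>A. deg (f i))"
  by (induction A rule: finite_induct) (auto simp: deg_one deg_mult)

lemma prime_divides_finprodD:
  "\<lbrakk>finite A; f \<in> A \<rightarrow> carrier G; prime G p; p \<in> carrier G; p divides finprod G f A\<rbrakk>
    \<Longrightarrow> \<exists>i\<in>A. p divides f i"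
proof (induction A rule: finite_induct)
  case empty
  then show ?case using prime_ne_one by (simp add: divides_one_iff)
next
  case (insert i A)
  then have "p divides f i \<or> p divides finprod G f A"
    by (simp add: prime_divides_mult_iff Pi_iff)
  then show ?case using insert by auto
qed

lemma member_divides_family_prod:
  fixes f :: "'i::finite \<Rightarrow> 'm"
  assumes f: "f \<in> UNIV \<rightarrow> carrier G"
  shows "f i divides family_prod f"
proof -
  have rest: "f(i := \<one>) \<in> UNIV \<rightarrow> carrier G" using f by auto
  have "f = scale_at i (f i) (f(i := \<one>))" using f by (auto simp: scale_at_def Pi_iff)
  then have "family_prod f = f i \<otimes> family_prod (f(i := \<one>))"
    using family_prod_scale_at[OF _ rest, of "f i" i] f by auto
  then show ?thesis using finprod_closed[OF rest] by blast
qed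

lemma prime_divides_family_prod_iff:
  fixes f :: "'i::finite \<Rightarrow> 'm"
  assumes "prime G p" "p \<in> carrier G" "f \<in> UNIV \<rightarrow> carrier G"
  shows "p divides family_prod f \<longleftrightarrow> (\<exists>i. p divides f i)"
proof
  assume "p divides family_prod f"
  then show "\<exists>i. p divides f i" using prime_divides_finprodD[OF _ assms(3,1,2)] by auto
next
  assume "\<exists>i. p divides f i"
  then show "p divides family_prod f"
    using member_divides_family_prod assms(2,3) divides_trans by blast
qed

lemma prime_divides_family_prodE:
  fixes f :: "'i::finite \<Rightarrow> 'm"
  assumes "prime G p" "p \<in> carrier G" "f \<in> UNIV \<rightarrow> carrier G" "p divides family_prod f"
  obtains i g where "g \<in> UNIV \<rightarrow> carrier G" "f = scale_at i p g"
proof -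
  obtain i c where c: "c \<in> carrier G" "f i = p \<otimes> c"
    using assms by (auto simp: prime_divides_family_prod_iff)
  then have "f(i := c) \<in> UNIV \<rightarrow> carrier G" "f = scale_at i p (f(i := c))"
    using assms by (auto simp: scale_at_def Pi_iff)
  then show thesis by (rule that)
qed

lemma prime_square_divides_family_prodE:
  fixes f :: "'i::finite \<Rightarrow> 'm"
  assumes p: "prime G p" "p \<in> carrier G" and f: "f \<in> UNIV \<rightarrow> carrier G" "p \<otimes> p divides family_prod f"
  obtains i j g where "g \<in> UNIV \<rightarrow> carrier G" "f = scale_at i p (scale_at j p g)"
proof -
  have "p divides family_prod f" using p f by (meson divides_prod_r divides_refl divides_trans)
  then obtain i h where h: "h \<in> UNIV \<rightarrow> carrier G" "f = scale_at i p h"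
    using prime_divides_family_prodE p f by metis
  then have "p divides family_prod h" using p f by (simp add: family_prod_scale_at)
  then obtain j g where "g \<in> UNIV \<rightarrow> carrier G" "h = scale_at j p g"
    using prime_divides_family_prodE p h by metis
  then show thesis using h that by blast
qed

definition coprime_elts :: "'m \<Rightarrow> 'm \<Rightarrow> bool" where
  "coprime_elts a b \<longleftrightarrow> (\<forall>u\<in>carrier G. u divides a \<longrightarrow> u divides b \<longrightarrow> u = \<one>)"

lemma sqfree_family_prodD:
  fixes f :: "'i::finite \<Rightarrow> 'm"
  assumes f: "f \<in> UNIV \<rightarrow> carrier G" and sq: "sqfree (family_prod f)"
  shows "sqfree (f i)" "i \<noteq> j \<Longrightarrow> coprime_elts (f i) (f j)"
proof -
  show "sqfree (f i)" by (rule sqfree_divides[OF sq]) (use f member_divides_family_prod in auto)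
  show "coprime_elts (f i) (f j)" if "i \<noteq> j" unfolding coprime_elts_def
  proof (intro ballI impI)
    fix u assume u: "u \<in> carrier G" "u divides f i" "u divides f j"
    then obtain a b where ab: "a \<in> carrier G" "b \<in> carrier G" "f i = u \<otimes> a" "f j = u \<otimes> b" by blast
    define g where "g = f(i := a, j := b)"
    have g: "g \<in> UNIV \<rightarrow> carrier G" "scale_at j u g \<in> UNIV \<rightarrow> carrier G"
      using f ab u by (auto simp: g_def scale_at_def)
    have "f = scale_at i u (scale_at j u g)" using ab that by (auto simp: scale_at_def g_def)
    then have "family_prod f = u \<otimes> (u \<otimes> family_prod g)" using u g by (simp add: family_prod_scale_at)
    then have "u \<otimes> u divides family_prod f" using u g by (auto simp: m_assoc[symmetric])
    then show "u = \<one>" using sq u by (auto simp: sqfree_def)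
  qed
qed

lemma sqfree_family_prod_iff:
  fixes f :: "'i::finite \<Rightarrow> 'm"
  assumes f: "f \<in> UNIV \<rightarrow> carrier G"
  shows "sqfree (family_prod f) \<longleftrightarrow>
    (\<forall>i. sqfree (f i)) \<and> (\<forall>i j. i \<noteq> j \<longrightarrow> coprime_elts (f i) (f j))"
proof
  assume parts: "(\<forall>i. sqfree (f i)) \<and> (\<forall>i j. i \<noteq> j \<longrightarrow> coprime_elts (f i) (f j))"
  show "sqfree (family_prod f)" unfolding sqfree_iff_prime[OF finprod_closed[OF f]]
  proof (intro ballI impI notI)
    fix p assume p: "p \<in> carrier G" "prime G p" "p \<otimes> p divides family_prod f"
    obtain i j g where g: "g \<in> UNIV \<rightarrow> carrier G" "f = scale_at i p (scale_at j p g)"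
      using prime_square_divides_family_prodE p f by metis
    show False
    proof (cases "i = j")
      case True
      then have "f i = p \<otimes> p \<otimes> g i" using g p by (simp add: scale_at_def m_assoc Pi_iff)
      then have "p \<otimes> p divides f i" using g by auto
      then have "p = \<one>" using parts p by (auto simp: sqfree_def)
      then show False using prime_ne_one p by blast
    next
      case False
      then have "p divides f i" "p divides f j" using g by (auto simp: scale_at_def)
      then have "p = \<one>" using parts False p by (auto simp: coprime_elts_def)
      then show False using prime_ne_one p by blast
    qed
  qed
qed (use sqfree_family_prodD[OF f] in blast)

text \<open>
  If \<open>E\<^sup>2\<close> divides \<open>\<Prod>\<^sub>i f\<^sub>i\<close>, then every prime factor of \<open>E\<close> divides \<open>f\<^sub>i f\<^sub>j\<close> for some pair \<open>(i, j)\<close>;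
  sorting the prime factors by such pairs removes \<open>E\<^sup>2\<close> from the product.
\<close>

definition pair_scale :: "('i::finite \<times> 'i \<Rightarrow> 'm) \<Rightarrow> ('i \<Rightarrow> 'm) \<Rightarrow> 'i \<Rightarrow> 'm" where
  "pair_scale A f i = (\<Otimes>j\<in>UNIV. A (i, j) \<otimes> A (j, i)) \<otimes> f i"

lemma pair_scale_one: "f \<in> UNIV \<rightarrow> carrier G \<Longrightarrow> pair_scale (\<lambda>_. \<one>) f = f"
  by (auto simp: pair_scale_def Pi_iff)

lemma pair_scale_scale_at:
  fixes A :: "'i::finite \<times> 'i \<Rightarrow> 'm"
  assumes p: "p \<in> carrier G" and A: "A \<in> UNIV \<rightarrow> carrier G" and f: "f \<in> UNIV \<rightarrow> carrier G"
  shows "pair_scale (scale_at (i, j) p A) f = scale_at i p (scale_at j p (pair_scale A f))"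
proof
  fix l
  let ?s = "\<lambda>b. if b then p else \<one>"
  have s: "?s b \<in> carrier G" for b using p by simp
  have c: "A x \<in> carrier G" "f l \<in> carrier G" for x using A f by auto
  have pick: "(\<Otimes>m\<in>UNIV. ?s (l = i \<and> m = j)) = ?s (l = i)"
    "(\<Otimes>m\<in>UNIV. ?s (m = i \<and> l = j)) = ?s (l = j)"
    using finprod_indicator[OF p, of j] finprod_indicator[OF p, of i] by simp_all
  have "(\<Otimes>m\<in>UNIV. scale_at (i, j) p A (l, m) \<otimes> scale_at (i, j) p A (m, l))
    = (\<Otimes>m\<in>UNIV. (?s (l = i \<and> m = j) \<otimes> ?s (m = i \<and> l = j)) \<otimes> (A (l, m) \<otimes> A (m, l)))"
    using s c by (intro finprod_cong') (auto simp: scale_at_eq_mult[OF A] m_ac)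
  also have "\<dots> = (\<Otimes>m\<in>UNIV. ?s (l = i \<and> m = j)) \<otimes> (\<Otimes>m\<in>UNIV. ?s (m = i \<and> l = j))
      \<otimes> (\<Otimes>m\<in>UNIV. A (l, m) \<otimes> A (m, l))"
    using s c by (subst finprod_multf | simp)+
  finally show "pair_scale (scale_at (i, j) p A) f l = scale_at i p (scale_at j p (pair_scale A f)) l"
    unfolding pick using p c by (auto simp: pair_scale_def scale_at_def m_ac)
qed

lemma exists_pair_scale:
  fixes f :: "'i::finite \<Rightarrow> 'm"
  assumes "E \<in> carrier G" "f \<in> UNIV \<rightarrow> carrier G" "E \<otimes> E divides family_prod f"
  shows "\<exists>A g. A \<in> UNIV \<rightarrow> carrier G \<and> g \<in> UNIV \<rightarrow> carrier G \<and> family_prod A = E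
    \<and> f = pair_scale A g \<and> family_prod f = E \<otimes> E \<otimes> family_prod g"
  using assms
proof (induction "deg E" arbitrary: E f rule: less_induct)
  case less
  show ?case
  proof (cases "E = \<one>")
    case True
    then show ?thesis using less.prems
      by (intro exI[of _ "\<lambda>_. \<one>"] exI[of _ f]) (auto simp: pair_scale_one)
  next
    case False
    then obtain p E' where p: "prime G p" "p \<in> carrier G" and E': "E' \<in> carrier G" "E = p \<otimes> E'"
      using exists_prime_divisor less.prems(1) by (metis dividesE)
    have square: "E \<otimes> E = p \<otimes> (p \<otimes> (E' \<otimes> E'))" using p E' by (simp add: m_ac)
    have "p \<otimes> p divides E \<otimes> E" unfolding square
      using p E' by (intro dividesI[of "E' \<otimes> E'"]) (auto simp: m_assoc)
    then have "p \<otimes> p divides family_prod f" using less.prems p by (meson divides_trans m_closed)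
    then obtain i j h where h: "h \<in> UNIV \<rightarrow> carrier G" "f = scale_at i p (scale_at j p h)"
      using prime_square_divides_family_prodE p less.prems(2) by metis
    have prod_f: "family_prod f = p \<otimes> (p \<otimes> family_prod h)"
      using p h by (simp add: family_prod_scale_at scale_at_closed)
    have "E' \<otimes> E' divides family_prod h"
      using less.prems(3) unfolding square prod_f using p h E'(1) by simp
    moreover have "deg E' < deg E"
      using p E' prime_ne_one by (simp add: deg_mult deg_pos_iff)
    ultimately obtain A g where IH: "A \<in> UNIV \<rightarrow> carrier G" "g \<in> UNIV \<rightarrow> carrier G"
      "family_prod A = E'" "h = pair_scale A g" "family_prod h = E' \<otimes> E' \<otimes> family_prod g"
      using less.hyps[of E' h] E' h by blast
    have "f = pair_scale (scale_at (i, j) p A) g"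
      using p h IH by (simp add: pair_scale_scale_at)
    moreover have "family_prod (scale_at (i, j) p A) = E"
      using p IH E' by (simp add: family_prod_scale_at)
    moreover have "family_prod f = E \<otimes> E \<otimes> family_prod g"
      using IH p E' by (simp add: prod_f square m_ac)
    ultimately show ?thesis using scale_at_closed[OF p(2) IH(1)] IH(2) by blast
  qed
qed

definition families :: "('i::finite \<Rightarrow> int) \<Rightarrow> ('i \<Rightarrow> 'm) set" where
  "families n = {f. \<forall>i. f i \<in> carrier G \<and> int (deg (f i)) = n i}"

definition sqfree_families :: "('i::finite \<Rightarrow> int) \<Rightarrow> ('i \<Rightarrow> 'm) set" where
  "sqfree_families n = {f \<in> families n. sqfree (family_prod f)}"

definition families_of_total_degree :: "nat \<Rightarrow> ('k::finite \<Rightarrow> 'm) set" where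
  "families_of_total_degree j = {A. (\<forall>k. A k \<in> carrier G) \<and> (\<Sum>k\<in>UNIV. deg (A k)) = j}"

lemma families_closed: "f \<in> families n \<Longrightarrow> f \<in> UNIV \<rightarrow> carrier G"
  by (auto simp: families_def)

lemma families_eq_PiE: "families n = (\<Pi>\<^sub>E i\<in>UNIV. {a \<in> carrier G. int (deg a) = n i})"
  by (auto simp: families_def PiE_def)

lemma finite_families: "finite (families n)"
proof -
  have "finite {a \<in> carrier G. int (deg a) = n i}" for i
    by (rule finite_subset[OF _ finite_deg_le[of "nat (n i)"]]) auto
  then show ?thesis unfolding families_eq_PiE by (intro finite_PiE) auto
qed

lemma finite_sqfree_families: "finite (sqfree_families n)"
  by (simp add: sqfree_families_def finite_families)

lemma card_families_nat: "card (families (\<lambda>i. int (d i))) = q ^ sum d UNIV"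
  by (simp add: families_eq_PiE card_PiE card_deg power_sum)

lemma card_families:
  assumes "\<And>i. 0 \<le> n i"
  shows "real (card (families n)) = real q powi sum n UNIV"
proof -
  have n: "n = (\<lambda>i. int (nat (n i)))" using assms by auto
  have "real (card (families n)) = real q ^ (\<Sum>i\<in>UNIV. nat (n i))"
    by (subst n, subst card_families_nat) simp
  also have "\<dots> = real q powi int (\<Sum>i\<in>UNIV. nat (n i))" by (simp only: power_int_of_nat)
  also have "int (\<Sum>i\<in>UNIV. nat (n i)) = sum n UNIV" using assms by simp
  finally show ?thesis .
qed

lemma card_families_le: "real (card (families n)) \<le> real q powi sum n UNIV"
proof (cases "\<forall>i. 0 \<le> n i")
  case False
  then obtain i where "n i < 0" by (auto simp: not_le)
  then have "families n = {}" by (auto simp: families_def intro!: exI[of _ i])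
  then show ?thesis by simp
qed (simp add: card_families)

lemma deg_family_prod: "f \<in> families n \<Longrightarrow> int (deg (family_prod f)) = sum n UNIV"
  using deg_finprod[of UNIV f] families_closed[of f n] by (simp add: families_def)

lemma families_of_total_degree_subset:
  "families_of_total_degree j \<subseteq> (\<Union>d\<in>{d \<in> UNIV \<rightarrow>\<^sub>E {..j}. sum d UNIV = j}. families (\<lambda>k. int (d k)))"
proof
  fix A assume A: "A \<in> families_of_total_degree j"
  then have "deg (A k) \<le> j" for k
    using member_le_sum[of k UNIV "\<lambda>k. deg (A k)"] by (auto simp: families_of_total_degree_def)
  then show "A \<in> (\<Union>d\<in>{d \<in> UNIV \<rightarrow>\<^sub>E {..j}. sum d UNIV = j}. families (\<lambda>k. int (d k)))"
    using A by (intro UN_I[of "\<lambda>k. deg (A k)"]) (auto simp: families_of_total_degree_def families_def)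
qed

lemma finite_families_of_total_degree: "finite (families_of_total_degree j)"
  by (rule finite_subset[OF families_of_total_degree_subset]) (auto simp: finite_families finite_PiE)

lemma card_families_of_total_degree_le:
  "real (card (families_of_total_degree j :: ('k::finite \<Rightarrow> 'm) set)) \<le> real (j + 1) ^ CARD('k) * real q ^ j"
proof -
  let ?D = "{d \<in> (UNIV :: 'k set) \<rightarrow>\<^sub>E {..j}. sum d UNIV = j}"
  have fin: "finite ?D" by (simp add: finite_PiE)
  have "card (families_of_total_degree j :: ('k \<Rightarrow> 'm) set) \<le> card (\<Union>d\<in>?D. families (\<lambda>k. int (d k)))"
    by (rule card_mono[OF _ families_of_total_degree_subset]) (use fin finite_families in blast)
  also have "\<dots> \<le> (\<Sum>d\<in>?D. card (families (\<lambda>k. int (d k))))" by (rule card_UN_le[OF fin])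
  also have "\<dots> = card ?D * q ^ j" by (simp add: card_families_nat)
  also have "card ?D \<le> card ((UNIV :: 'k set) \<rightarrow>\<^sub>E {..j})" by (rule card_mono) (auto simp: finite_PiE)
  also have "\<dots> = (j + 1) ^ CARD('k)" by (simp add: card_PiE)
  finally have "card (families_of_total_degree j :: ('k \<Rightarrow> 'm) set) \<le> (j + 1) ^ CARD('k) * q ^ j" by simp
  from of_nat_mono[OF this, where ?'a = real] show ?thesis by simp
qed

definition pair_degree :: "('i::finite \<times> 'i \<Rightarrow> 'm) \<Rightarrow> 'i \<Rightarrow> int" where
  "pair_degree A i = (\<Sum>j\<in>UNIV. int (deg (A (i, j))) + int (deg (A (j, i))))"

lemma sum_pair_degree:
  fixes A :: "'i::finite \<times> 'i \<Rightarrow> 'm"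
  shows "sum (pair_degree A) UNIV = 2 * int (\<Sum>k\<in>UNIV. deg (A k))"
proof -
  have "(\<Sum>i\<in>UNIV. \<Sum>j\<in>UNIV. int (deg (A (i, j)))) = int (\<Sum>k\<in>UNIV. deg (A k))"
    by (simp add: sum.cartesian_product)
  moreover have "(\<Sum>i\<in>UNIV. \<Sum>j\<in>UNIV. int (deg (A (j, i)))) = (\<Sum>i\<in>UNIV. \<Sum>j\<in>UNIV. int (deg (A (i, j))))"
    by (rule sum.swap)
  ultimately show ?thesis by (simp add: pair_degree_def sum.distrib)
qed

lemma pair_degree_le: "pair_degree A i \<le> 2 * int (\<Sum>k\<in>UNIV. deg (A k))"
proof -
  have "pair_degree A i \<le> sum (pair_degree A) UNIV"
    by (rule member_le_sum) (auto simp: pair_degree_def intro: sum_nonneg)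
  then show ?thesis by (simp only: sum_pair_degree)
qed

lemma deg_pair_scale:
  assumes "A \<in> UNIV \<rightarrow> carrier G" "f \<in> UNIV \<rightarrow> carrier G"
  shows "int (deg (pair_scale A f i)) = pair_degree A i + int (deg (f i))"
proof -
  have A: "A x \<in> carrier G" for x using assms by auto
  have "deg (\<Otimes>j\<in>UNIV. A (i, j) \<otimes> A (j, i)) = (\<Sum>j\<in>UNIV. deg (A (i, j)) + deg (A (j, i)))"
    using A by (subst deg_finprod) (auto simp: deg_mult)
  then show ?thesis
    using A assms by (subst pair_scale_def, subst deg_mult) (auto simp: pair_degree_def simp del: finprod_multf)
qed

lemma square_divisor_pair_scaleE:
  fixes f :: "'i::finite \<Rightarrow> 'm"
  assumes f: "f \<in> families n" and E: "E \<in> carrier G" "E \<otimes> E divides family_prod f"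
  obtains A g where "A \<in> families_of_total_degree (deg E)" "family_prod A = E"
    "g \<in> families (\<lambda>i. n i - pair_degree A i)" "f = pair_scale A g" "family_prod f = E \<otimes> E \<otimes> family_prod g"
proof -
  obtain A g where A: "A \<in> UNIV \<rightarrow> carrier G" "family_prod A = E" and g: "g \<in> UNIV \<rightarrow> carrier G"
    and fg: "f = pair_scale A g" "family_prod f = E \<otimes> E \<otimes> family_prod g"
    using exists_pair_scale[OF E(1) families_closed[OF f] E(2)] by blast
  have "A \<in> families_of_total_degree (deg E)"
    using A deg_finprod[of UNIV A] by (auto simp: families_of_total_degree_def)
  moreover have "n i = pair_degree A i + int (deg (g i))" for i
    using f deg_pair_scale[OF A(1) g, of i] by (simp add: families_def fg)
  then have "g \<in> families (\<lambda>i. n i - pair_degree A i)" using g by (auto simp: families_def)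
  ultimately show thesis using that A fg by blast
qed

lemma sum_card_square_divides_le:
  fixes n :: "'i::finite \<Rightarrow> int"
  shows "(\<Sum>E | E \<in> carrier G \<and> deg E = j. real (card {f \<in> families n. E \<otimes> E divides family_prod f}))
    \<le> real (j + 1) ^ CARD('i \<times> 'i) / real q ^ j * real q powi sum n UNIV"
proof -
  let ?E = "{E \<in> carrier G. deg E = j}"
  let ?S = "SIGMA E:?E. {f \<in> families n. E \<otimes> E divides family_prod f}"
  let ?A = "families_of_total_degree j :: ('i \<times> 'i \<Rightarrow> 'm) set"
  let ?Z = "SIGMA A:?A. families (\<lambda>i. n i - pair_degree A i)"
  have q: "real q \<noteq> 0" using q_ge_2 by simp
  have "?S \<subseteq> (\<lambda>(A, g). (family_prod A, pair_scale A g)) ` ?Z"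
  proof
    fix x assume "x \<in> ?S"
    then obtain E f where x: "x = (E, f)" "E \<in> carrier G" "deg E = j" "f \<in> families n"
      "E \<otimes> E divides family_prod f" by auto
    obtain A g where A: "A \<in> families_of_total_degree (deg E)" "family_prod A = E"
      "g \<in> families (\<lambda>i. n i - pair_degree A i)" "f = pair_scale A g"
      using square_divisor_pair_scaleE[OF x(4,2,5)] by blast
    then show "x \<in> (\<lambda>(A, g). (family_prod A, pair_scale A g)) ` ?Z"
      using x by (intro image_eqI[of _ _ "(A, g)"]) auto
  qed
  then have "card ?S \<le> card ?Z"
    by (rule surj_card_le[rotated]) (auto simp: finite_families finite_families_of_total_degree)
  then have "(\<Sum>E\<in>?E. card {f \<in> families n. E \<otimes> E divides family_prod f})
      \<le> (\<Sum>A\<in>?A. card (families (\<lambda>i. n i - pair_degree A i)))"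
    by (simp add: finite_deg finite_families finite_families_of_total_degree)
  then have "(\<Sum>E\<in>?E. real (card {f \<in> families n. E \<otimes> E divides family_prod f}))
      \<le> (\<Sum>A\<in>?A. real (card (families (\<lambda>i. n i - pair_degree A i))))"
    by (simp flip: of_nat_sum)
  also have "\<dots> \<le> (\<Sum>A\<in>?A. real q powi (sum n UNIV - 2 * int j))"
  proof (rule sum_mono)
    fix A assume "A \<in> ?A"
    then have "(\<Sum>i\<in>UNIV. n i - pair_degree A i) = sum n UNIV - 2 * int j"
      by (simp add: sum_subtractf sum_pair_degree families_of_total_degree_def)
    then show "real (card (families (\<lambda>i. n i - pair_degree A i))) \<le> real q powi (sum n UNIV - 2 * int j)"
      using card_families_le by metis
  qed
  also have "\<dots> \<le> (real (j + 1) ^ CARD('i \<times> 'i) * real q ^ j) * real q powi (sum n UNIV - 2 * int j)"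
    using card_families_of_total_degree_le[of j, where ?'k = "'i \<times> 'i"] by (simp add: mult_right_mono)
  also have "\<dots> = real (j + 1) ^ CARD('i \<times> 'i) / real q ^ j * real q powi sum n UNIV"
    using q by (simp add: power_int_diff power_int_mult mult.commute power2_eq_square)
  finally show ?thesis .
qed

lemma card_families_le_sum_sqfree_families:
  fixes n :: "'i::finite \<Rightarrow> int"
  shows "card (families n) \<le> (\<Sum>j\<le>nat (sum n UNIV). \<Sum>A\<in>families_of_total_degree j.
    card (sqfree_families (\<lambda>i. n i - pair_degree A i)))"
proof -
  let ?A = "\<Union>j\<le>nat (sum n UNIV). families_of_total_degree j :: ('i \<times> 'i \<Rightarrow> 'm) set"
  let ?Z = "SIGMA A:?A. sqfree_families (\<lambda>i. n i - pair_degree A i)"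
  have "families n \<subseteq> (\<lambda>(A, g). pair_scale A g) ` ?Z"
  proof
    fix f assume f: "f \<in> families n"
    then obtain E c where E: "E \<in> carrier G" "c \<in> carrier G" "family_prod f = E \<otimes> E \<otimes> c" "sqfree c"
      using exists_sqfree_part[OF finprod_closed[OF families_closed[OF f]]] by blast
    then have "E \<otimes> E divides family_prod f" by auto
    then obtain A g where A: "A \<in> families_of_total_degree (deg E)"
      and g: "g \<in> families (\<lambda>i. n i - pair_degree A i)" "f = pair_scale A g"
      and prod: "family_prod f = E \<otimes> E \<otimes> family_prod g"
      using square_divisor_pair_scaleE[OF f E(1)] by blast
    have "family_prod g = c"
      using prod E families_closed[OF g(1)] l_cancel[of "E \<otimes> E" "family_prod g" c] by simp
    then have "g \<in> sqfree_families (\<lambda>i. n i - pair_degree A i)"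
      using g E by (simp add: sqfree_families_def)
    moreover have "deg E \<le> nat (sum n UNIV)"
      using deg_family_prod[OF f] E by (simp add: deg_mult)
    ultimately show "f \<in> (\<lambda>(A, g). pair_scale A g) ` ?Z"
      using A g by (intro image_eqI[of _ _ "(A, g)"]) auto
  qed
  then have "card (families n) \<le> card ?Z"
    by (rule surj_card_le[rotated]) (auto simp: finite_sqfree_families finite_families_of_total_degree)
  also have "\<dots> = (\<Sum>A\<in>?A. card (sqfree_families (\<lambda>i. n i - pair_degree A i)))"
    by (rule card_SigmaI) (auto simp: finite_sqfree_families finite_families_of_total_degree)
  also have "\<dots> = (\<Sum>j\<le>nat (sum n UNIV). \<Sum>A\<in>families_of_total_degree j.
      card (sqfree_families (\<lambda>i. n i - pair_degree A i)))"
    by (rule sum.UNION_disjoint)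
      (auto simp: finite_families_of_total_degree, auto simp: families_of_total_degree_def)
  finally show ?thesis .
qed

end

lemma prod_power_int:
  fixes x :: "'a::field"
  assumes "x \<noteq> 0"
  shows "(\<Prod>i\<in>A. x powi n i) = x powi sum n A"
  by (induction A rule: infinite_finite_induct) (use assms in \<open>simp_all add: power_int_add\<close>)

section \<open>Averages over sign vectors\<close>

definition sign_vectors :: "('i \<Rightarrow> real) set" where
  "sign_vectors = {a. \<forall>i. a i \<in> {1, -1}}"

definition sign_mean :: "(('i::finite \<Rightarrow> real) \<Rightarrow> real) \<Rightarrow> real" where
  "sign_mean \<phi> = (\<Sum>a\<in>sign_vectors. \<phi> a) / 2 ^ CARD('i)"

text \<open>
  The mean over the values \<open>(\<chi>(f\<^sub>i(x)))\<^sub>i\<close> at a point \<open>x\<close> of a family with squarefree product: at most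
  one \<open>f\<^sub>i\<close> vanishes at \<open>x\<close>, and each of these events is \<open>q\<close> times less likely than that none vanishes.
\<close>

definition local_mean :: "nat \<Rightarrow> (('i::finite \<Rightarrow> real) \<Rightarrow> real) \<Rightarrow> real" where
  "local_mean q \<phi> = (sign_mean \<phi> + (\<Sum>i\<in>UNIV. sign_mean (\<lambda>a. \<phi> (a(i := 0)))) / real q)
    / (1 + real CARD('i) / real q)"

definition bounded_weight :: "(('i \<Rightarrow> real) \<Rightarrow> real) \<Rightarrow> bool" where
  "bounded_weight \<phi> \<longleftrightarrow> (\<forall>a. (\<forall>i. a i \<in> {-1, 0, 1}) \<longrightarrow> \<bar>\<phi> a\<bar> \<le> 1)"

lemma bounded_weightD: "\<lbrakk>bounded_weight \<phi>; \<And>i. a i \<in> {-1, 0, 1}\<rbrakk> \<Longrightarrow> \<bar>\<phi> a\<bar> \<le> 1"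
  by (simp add: bounded_weight_def)

lemma sign_vectorsD: "a \<in> sign_vectors \<Longrightarrow> a i \<in> {1, -1}"
  by (simp add: sign_vectors_def)

lemma sign_vectors_eq_PiE: "sign_vectors = (UNIV \<rightarrow>\<^sub>E {1, -1})"
  by (auto simp: sign_vectors_def PiE_def)

lemma finite_sign_vectors: "finite (sign_vectors :: ('i::finite \<Rightarrow> real) set)"
  by (simp add: sign_vectors_eq_PiE finite_PiE)

lemma card_sign_vectors: "card (sign_vectors :: ('i::finite \<Rightarrow> real) set) = 2 ^ CARD('i)"
  by (simp add: sign_vectors_eq_PiE card_PiE numeral_2_eq_2)

lemma sign_mean_const: "sign_mean (\<lambda>_. c) = c"
  by (simp add: sign_mean_def card_sign_vectors)

lemma sign_mean_add: "sign_mean (\<lambda>a. \<phi> a + \<psi> a) = sign_mean \<phi> + sign_mean \<psi>"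
  by (simp add: sign_mean_def sum.distrib add_divide_distrib)

lemma sign_mean_sum: "sign_mean (\<lambda>a. \<Sum>i\<in>I. \<phi> i a) = (\<Sum>i\<in>I. sign_mean (\<phi> i))"
  unfolding sign_mean_def sum_divide_distrib[symmetric] by (subst sum.swap) (rule refl)

lemma sign_mean_mult_left: "sign_mean (\<lambda>a. c * \<phi> a) = c * sign_mean \<phi>"
  by (simp add: sign_mean_def sum_distrib_left)

lemma sign_mean_divide: "sign_mean (\<lambda>a. \<phi> a / c) = sign_mean \<phi> / c"
  using sign_mean_mult_left[of "1 / c" \<phi>] by simp

lemma sign_mean_diff: "sign_mean (\<lambda>a. \<phi> a - \<psi> a) = sign_mean \<phi> - sign_mean \<psi>"
  by (simp add: sign_mean_def sum_subtractf diff_divide_distrib)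

lemma abs_sign_mean_le:
  fixes \<phi> :: "('i::finite \<Rightarrow> real) \<Rightarrow> real"
  assumes "\<And>a. a \<in> sign_vectors \<Longrightarrow> \<bar>\<phi> a\<bar> \<le> B"
  shows "\<bar>sign_mean \<phi>\<bar> \<le> B"
proof -
  have "\<bar>\<Sum>a\<in>sign_vectors. \<phi> a\<bar> \<le> (\<Sum>a\<in>(sign_vectors :: ('i \<Rightarrow> real) set). B)"
    by (rule order_trans[OF sum_abs]) (rule sum_mono, rule assms)
  then show ?thesis by (simp add: sign_mean_def card_sign_vectors abs_divide divide_le_eq mult.commute)
qed

lemma sign_mean_twist:
  assumes "\<sigma> \<in> sign_vectors"
  shows "sign_mean (\<lambda>a. \<phi> (\<lambda>i. \<sigma> i * a i)) = sign_mean \<phi>"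
proof -
  note \<sigma> = sign_vectorsD[OF assms]
  have "\<sigma> i * b \<in> {1, -1}" if "b \<in> {1, -1}" for i b using \<sigma>[of i] that by auto
  then have "(\<lambda>i. \<sigma> i * a i) \<in> sign_vectors" if "a \<in> sign_vectors" for a
    using that by (simp add: sign_vectors_def)
  moreover have "\<sigma> i * (\<sigma> i * b) = b" for i b using \<sigma>[of i] by auto
  ultimately have "bij_betw (\<lambda>a i. \<sigma> i * a i) sign_vectors sign_vectors"
    by (intro bij_betwI[where g = "\<lambda>a i. \<sigma> i * a i"]) auto
  from sum.reindex_bij_betw[OF this] show ?thesis by (simp add: sign_mean_def)
qed

lemma local_mean_twist:
  assumes "\<sigma> \<in> sign_vectors"
  shows "local_mean q (\<lambda>a. \<phi> (\<lambda>i. \<sigma> i * a i)) = local_mean q \<phi>"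
proof -
  have "(\<lambda>i. \<sigma> i * (a(l := 0)) i) = (\<lambda>i. \<sigma> i * a i)(l := 0)" for a l by auto
  then have "sign_mean (\<lambda>a. \<phi> (\<lambda>i. \<sigma> i * (a(l := 0)) i)) = sign_mean (\<lambda>a. \<phi> (a(l := 0)))" for l
    using sign_mean_twist[OF assms, of "\<lambda>a. \<phi> (a(l := 0))"] by (simp only:)
  then show ?thesis by (simp only: local_mean_def sign_mean_twist[OF assms])
qed

lemma local_mean_mult_norm:
  fixes \<phi> :: "('i::finite \<Rightarrow> real) \<Rightarrow> real"
  shows "(1 + real CARD('i) / real q) * local_mean q \<phi>
    = sign_mean \<phi> + (\<Sum>i\<in>UNIV. sign_mean (\<lambda>a. \<phi> (a(i := 0)))) / real q"
proof -
  have "1 + real CARD('i) / real q > 0" by (simp add: add_pos_nonneg)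
  then show ?thesis by (simp add: local_mean_def)
qed

lemma local_mean_one: "local_mean q (\<lambda>_ :: 'i::finite \<Rightarrow> real. 1) = 1"
proof -
  have "1 + real CARD('i) / real q > 0" by (simp add: add_pos_nonneg)
  then show ?thesis by (simp add: local_mean_def sign_mean_const)
qed

lemma abs_sign_mean_le_one:
  fixes \<phi> :: "('i::finite \<Rightarrow> real) \<Rightarrow> real"
  assumes "bounded_weight \<phi>"
  shows "\<bar>sign_mean \<phi>\<bar> \<le> 1"
proof (rule abs_sign_mean_le)
  fix a :: "'i \<Rightarrow> real" assume "a \<in> sign_vectors"
  then have "a i \<in> {-1, 0, 1}" for i using sign_vectorsD[of a i] by auto
  then show "\<bar>\<phi> a\<bar> \<le> 1" by (rule bounded_weightD[OF assms])
qed

lemma abs_local_mean_le_one: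
  fixes \<phi> :: "('i::finite \<Rightarrow> real) \<Rightarrow> real"
  assumes "bounded_weight \<phi>"
  shows "\<bar>local_mean q \<phi>\<bar> \<le> 1"
proof -
  have "\<bar>sign_mean (\<lambda>a. \<phi> (a(i := 0)))\<bar> \<le> 1" for i
  proof (rule abs_sign_mean_le)
    fix a :: "'i \<Rightarrow> real" assume "a \<in> sign_vectors"
    then have "(a(i := 0)) l \<in> {-1, 0, 1}" for l using sign_vectorsD[of a l] by auto
    then show "\<bar>\<phi> (a(i := 0))\<bar> \<le> 1" by (rule bounded_weightD[OF assms])
  qed
  then have "\<bar>\<Sum>i\<in>UNIV. sign_mean (\<lambda>a. \<phi> (a(i := 0)))\<bar> \<le> real CARD('i)"
    using sum_mono[of UNIV "\<lambda>i. \<bar>sign_mean (\<lambda>a. \<phi> (a(i := 0)))\<bar>" "\<lambda>_. 1"]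
    by (intro order_trans[OF sum_abs]) simp
  then have "\<bar>(\<Sum>i\<in>UNIV. sign_mean (\<lambda>a. \<phi> (a(i := 0)))) / real q\<bar> \<le> real CARD('i) / real q"
    by (simp add: abs_divide divide_right_mono)
  then have "\<bar>sign_mean \<phi> + (\<Sum>i\<in>UNIV. sign_mean (\<lambda>a. \<phi> (a(i := 0)))) / real q\<bar>
      \<le> 1 + real CARD('i) / real q"
    using abs_sign_mean_le_one[OF assms] by linarith
  then show ?thesis
    by (simp add: local_mean_def abs_divide divide_le_eq add_pos_nonneg)
qed

section \<open>Equidistribution in residue classes\<close>

text \<open>
  In the intended model \<open>G\<close> consists of the monic polynomials over \<open>\<bbbF>\<^sub>q\<close>, \<open>points\<close> is \<open>\<bbbF>\<^sub>q\<close>, \<open>lin x\<close> is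
  \<open>t - x\<close> and \<open>chi f x\<close> is the quadratic character of \<open>f x\<close>. Residue classes modulo \<open>Q\<close> are
  represented by monic polynomials of the same degree as \<open>Q\<close>, so that they are elements of \<open>G\<close>.
\<close>

locale equidistributed_monoid = graded_factorial_monoid G q deg
  for G :: "('m, 'g) monoid_scheme" (structure) and q deg +
  fixes points :: "'x set" and lin :: "'x \<Rightarrow> 'm" and chi :: "'m \<Rightarrow> 'x \<Rightarrow> real"
    and residue :: "'m \<Rightarrow> 'm \<Rightarrow> 'm"
  assumes finite_points: "finite points"
    and lin_closed: "x \<in> points \<Longrightarrow> lin x \<in> carrier G"
    and deg_lin: "x \<in> points \<Longrightarrow> deg (lin x) = 1"
    and chi_mult: "\<lbrakk>a \<in> carrier G; b \<in> carrier G; x \<in> points\<rbrakk> \<Longrightarrow> chi (a \<otimes> b) x = chi a x * chi b x"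
    and chi_values: "\<lbrakk>a \<in> carrier G; x \<in> points\<rbrakk> \<Longrightarrow> chi a x \<in> {-1, 0, 1}"
    and chi_eq_0_iff: "\<lbrakk>a \<in> carrier G; x \<in> points\<rbrakk> \<Longrightarrow> chi a x = 0 \<longleftrightarrow> lin x divides a"
    and chi_lin: "\<lbrakk>x \<in> points; y \<in> points; x \<noteq> y\<rbrakk> \<Longrightarrow> chi (lin x) y \<noteq> 0"
    and residue_closed: "\<lbrakk>Q \<in> carrier G; a \<in> carrier G\<rbrakk> \<Longrightarrow> residue Q a \<in> carrier G"
    and deg_residue: "\<lbrakk>Q \<in> carrier G; a \<in> carrier G\<rbrakk> \<Longrightarrow> deg (residue Q a) = deg Q"
    and divides_residue_mult_iff: "\<lbrakk>Q \<in> carrier G; a \<in> carrier G; b \<in> carrier G\<rbrakk>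
      \<Longrightarrow> Q divides residue Q a \<otimes> b \<longleftrightarrow> Q divides a \<otimes> b"
    and card_residue_class: "\<lbrakk>Q \<in> carrier G; r \<in> carrier G; deg r = deg Q; U \<subseteq> points;
      \<And>x. x \<in> U \<Longrightarrow> chi Q x \<noteq> 0; \<And>x. x \<in> U \<Longrightarrow> s x \<in> {1, -1}; deg Q + card U \<le> n\<rbrakk> \<Longrightarrow>
      real (card {a \<in> carrier G. deg a = n \<and> residue Q a = r \<and> (\<forall>x\<in>U. chi a x = s x)})
      = real q ^ (n - deg Q) * ((real q - 1) / (2 * real q)) ^ card U"
begin

lemma prime_lin:
  assumes x: "x \<in> points"
  shows "prime G (lin x)"
proof (rule irreducible_prime[OF lin_closed[OF x]], rule irreducibleI)
  show "lin x \<notin> Units G" using deg_lin[OF x] deg_one by (auto simp: Units_eq_one)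
  fix b assume b: "b \<in> carrier G" "properfactor G b (lin x)"
  then obtain c where c: "c \<in> carrier G" "lin x = b \<otimes> c" by (auto simp: properfactor_def)
  then have "deg b + deg c = 1" using deg_lin[OF x] b by (simp add: deg_mult)
  moreover have "c \<noteq> \<one>" using b c by (auto simp: properfactor_def)
  ultimately have "deg b = 0" using c deg_pos_iff[of c] by linarith
  then show "b \<in> Units G" using b by (simp add: Units_eq_one deg_eq_0_iff)
qed

lemma divides_finprod_residue_iff:
  assumes "finite A" "Q \<in> carrier G" "f \<in> A \<rightarrow> carrier G" "b \<in> carrier G"
  shows "Q divides (\<Otimes>i\<in>A. residue Q (f i)) \<otimes> b \<longleftrightarrow> Q divides (\<Otimes>i\<in>A. f i) \<otimes> b"
  using assms
proof (induction A arbitrary: b rule: finite_induct)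
  case (insert i A)
  then have c: "f i \<in> carrier G" "residue Q (f i) \<in> carrier G" "f \<in> A \<rightarrow> carrier G"
    "(\<lambda>i. residue Q (f i)) \<in> A \<rightarrow> carrier G"
    by (auto intro!: residue_closed simp: Pi_iff)
  have "Q divides (\<Otimes>i\<in>insert i A. residue Q (f i)) \<otimes> b
      \<longleftrightarrow> Q divides (\<Otimes>i\<in>A. residue Q (f i)) \<otimes> (residue Q (f i) \<otimes> b)"
    using insert.hyps insert.prems c by (simp add: m_ac)
  also have "\<dots> \<longleftrightarrow> Q divides residue Q (f i) \<otimes> ((\<Otimes>i\<in>A. f i) \<otimes> b)"
    using insert.IH[of "residue Q (f i) \<otimes> b"] insert.prems c by (simp add: m_ac)
  also have "\<dots> \<longleftrightarrow> Q divides f i \<otimes> ((\<Otimes>i\<in>A. f i) \<otimes> b)"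
    by (rule divides_residue_mult_iff) (use insert.prems c in auto)
  also have "f i \<otimes> ((\<Otimes>i\<in>A. f i) \<otimes> b) = (\<Otimes>i\<in>insert i A. f i) \<otimes> b"
    using insert.hyps insert.prems c by (simp add: m_assoc)
  finally show ?case .
qed simp

lemma divides_family_prod_residue_iff:
  assumes "Q \<in> carrier G" "f \<in> UNIV \<rightarrow> carrier G"
  shows "Q divides family_prod (\<lambda>i. residue Q (f i)) \<longleftrightarrow> Q divides family_prod f"
  using divides_finprod_residue_iff[of UNIV Q f \<one>] residue_closed assms by (simp add: Pi_iff)

lemma card_families_residues:
  fixes n :: "'i::finite \<Rightarrow> int"
  assumes Q: "Q \<in> carrier G" and r: "r \<in> families (\<lambda>_. int (deg Q))"
    and T: "T \<subseteq> points" "\<And>x. x \<in> T \<Longrightarrow> chi Q x \<noteq> 0" and s: "\<And>x. x \<in> T \<Longrightarrow> s x \<in> sign_vectors"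
    and n: "\<And>i. int (deg Q) + int (card T) \<le> n i"
  shows "real (card {f \<in> families n. (\<lambda>i. residue Q (f i)) = r \<and> (\<forall>x\<in>T. \<forall>i. chi (f i) x = s x i)})
    = real q powi sum n UNIV / real q ^ (CARD('i) * deg Q)
      * ((real q - 1) / (2 * real q)) ^ (CARD('i) * card T)"
proof -
  define c where "c = ((real q - 1) / (2 * real q)) ^ card T"
  let ?F = "\<lambda>i. {a \<in> carrier G. deg a = nat (n i) \<and> residue Q a = r i \<and> (\<forall>x\<in>T. chi a x = s x i)}"
  have q: "real q > 0" using q_ge_2 by simp
  have "0 \<le> n i" for i using n[of i] by linarith
  then have "int d = n i \<longleftrightarrow> d = nat (n i)" for d i by (metis int_nat_eq nat_int)
  then have "{f \<in> families n. (\<lambda>i. residue Q (f i)) = r \<and> (\<forall>x\<in>T. \<forall>i. chi (f i) x = s x i)} = Pi\<^sub>E UNIV ?F"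
    by (auto simp: families_def PiE_UNIV_domain fun_eq_iff Pi_iff)
  then have "real (card {f \<in> families n. (\<lambda>i. residue Q (f i)) = r \<and> (\<forall>x\<in>T. \<forall>i. chi (f i) x = s x i)})
      = (\<Prod>i\<in>UNIV. real (card (?F i)))"
    by (simp add: card_PiE)
  also have "\<dots> = (\<Prod>i\<in>UNIV. real q powi n i / real q ^ deg Q * c)"
  proof (rule prod.cong[OF refl])
    fix i
    have "r i \<in> carrier G" "deg (r i) = deg Q" using r by (auto simp: families_def)
    moreover have "s x i \<in> {1, -1}" if "x \<in> T" for x using sign_vectorsD[OF s[OF that]] .
    moreover have "deg Q + card T \<le> nat (n i)" using n[of i] by linarith
    ultimately have "real (card (?F i)) = real q ^ (nat (n i) - deg Q) * c"
      using card_residue_class[OF Q _ _ T, of "r i" "\<lambda>x. s x i" "nat (n i)"] by (simp add: c_def)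
    also have "real q ^ (nat (n i) - deg Q) = real q powi n i / real q ^ deg Q"
      using n[of i] q by (simp add: power_diff power_int_def)
    finally show "real (card (?F i)) = real q powi n i / real q ^ deg Q * c" .
  qed
  also have "\<dots> = (\<Prod>i\<in>UNIV. real q powi n i) / real q ^ (CARD('i) * deg Q) * c ^ CARD('i)"
    by (simp add: prod.distrib prod_dividef mult.commute flip: power_mult)
  also have "(\<Prod>i\<in>UNIV. real q powi n i) = real q powi sum n UNIV"
    using q by (simp add: prod_power_int)
  finally show ?thesis by (simp add: c_def mult.commute flip: power_mult)
qed

text \<open>Whether \<open>E\<^sup>2\<close> divides \<open>\<Prod>\<^sub>i f\<^sub>i\<close> depends only on the residues of the \<open>f\<^sub>i\<close> modulo \<open>E\<^sup>2\<close>.\<close>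

definition square_density :: "'i::finite itself \<Rightarrow> 'm \<Rightarrow> real" where
  "square_density _ E =
    real (card {r \<in> families (\<lambda>_ :: 'i. 2 * int (deg E)). E \<otimes> E divides family_prod r})
      / real q ^ (CARD('i) * (2 * deg E))"

lemma card_families_square_divides:
  fixes n :: "'i::finite \<Rightarrow> int"
  assumes E: "E \<in> carrier G" and T: "T \<subseteq> points" "\<And>x. x \<in> T \<Longrightarrow> chi E x \<noteq> 0"
    and s: "\<And>x. x \<in> T \<Longrightarrow> s x \<in> sign_vectors"
    and n: "\<And>i. 2 * int (deg E) + int (card T) \<le> n i"
  shows "real (card {f \<in> families n. E \<otimes> E divides family_prod f \<and> (\<forall>x\<in>T. \<forall>i. chi (f i) x = s x i)})
    = square_density TYPE('i) E * real q powi sum n UNIV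
      * ((real q - 1) / (2 * real q)) ^ (CARD('i) * card T)"
proof -
  define Q where "Q = E \<otimes> E"
  define A where "A = {f \<in> families n. Q divides family_prod f \<and> (\<forall>x\<in>T. \<forall>i. chi (f i) x = s x i)}"
  define R where "R = {r \<in> families (\<lambda>_ :: 'i. int (deg Q)). Q divides family_prod r}"
  let ?residues = "\<lambda>f i. residue Q (f i)"
  have Q: "Q \<in> carrier G" "deg Q = 2 * deg E" using E by (simp_all add: Q_def deg_mult)
  have nz: "chi Q x \<noteq> 0" if "x \<in> T" for x using T that E chi_mult by (auto simp: Q_def subset_iff)
  have fin: "finite A" "finite R" by (auto simp: A_def R_def finite_families)
  have residue_iff: "Q divides family_prod (?residues f) \<longleftrightarrow> Q divides family_prod f"
    if "f \<in> families n" for f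
    using divides_family_prod_residue_iff[OF Q(1) families_closed[OF that]] .
  then have "?residues f \<in> R" if "f \<in> A" for f
    using that Q residue_closed deg_residue by (auto simp: A_def R_def families_def)
  then have image: "?residues ` A \<subseteq> R" by blast
  have "{f \<in> A. ?residues f = r}
      = {f \<in> families n. ?residues f = r \<and> (\<forall>x\<in>T. \<forall>i. chi (f i) x = s x i)}" if "r \<in> R" for r
    using that residue_iff by (auto simp: A_def R_def)
  then have "real (card {f \<in> A. ?residues f = r}) = real q powi sum n UNIV / real q ^ (CARD('i) * deg Q)
      * ((real q - 1) / (2 * real q)) ^ (CARD('i) * card T)" if "r \<in> R" for r
    using that n Q by (subst card_families_residues[OF Q(1) _ T(1) nz s, symmetric]) (auto simp: R_def)
  then have "real (card A) = real (card R) * (real q powi sum n UNIV / real q ^ (CARD('i) * deg Q)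
      * ((real q - 1) / (2 * real q)) ^ (CARD('i) * card T))"
    using sum.group[OF fin image, of "\<lambda>_. 1 :: real"] by simp
  then show ?thesis by (simp add: A_def R_def Q(2) square_density_def) (simp add: Q_def)
qed

definition nonvanishing :: "'x set \<Rightarrow> ('i \<Rightarrow> 'm) \<Rightarrow> bool" where
  "nonvanishing U f \<longleftrightarrow> (\<forall>x\<in>U. \<forall>i. chi (f i) x \<noteq> 0)"

definition weight :: "'x set \<Rightarrow> ('x \<Rightarrow> ('i \<Rightarrow> real) \<Rightarrow> real) \<Rightarrow> ('i \<Rightarrow> 'm) \<Rightarrow> real" where
  "weight T \<phi> f = (\<Prod>x\<in>T. \<phi> x (\<lambda>i. chi (f i) x))"

lemma abs_weight_le_one:
  assumes "T \<subseteq> points" "\<And>x. x \<in> T \<Longrightarrow> bounded_weight (\<phi> x)" "f \<in> UNIV \<rightarrow> carrier G"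
  shows "\<bar>weight T \<phi> f\<bar> \<le> 1"
  unfolding weight_def abs_prod
proof (rule prod_le_1)
  fix x assume x: "x \<in> T"
  then have "\<forall>i. chi (f i) x \<in> {-1, 0, 1}" using chi_values assms by blast
  then show "0 \<le> \<bar>\<phi> x (\<lambda>i. chi (f i) x)\<bar> \<and> \<bar>\<phi> x (\<lambda>i. chi (f i) x)\<bar> \<le> 1"
    using assms(2)[OF x] by (simp add: bounded_weight_def)
qed

definition divisible_sum ::
    "'x set \<Rightarrow> ('i::finite \<Rightarrow> int) \<Rightarrow> ('x \<Rightarrow> ('i \<Rightarrow> real) \<Rightarrow> real) \<Rightarrow> 'm \<Rightarrow> real" where
  "divisible_sum T n \<phi> E =
    (\<Sum>f | f \<in> families n \<and> nonvanishing T f \<and> E \<otimes> E divides family_prod f. weight T \<phi> f)"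

lemma abs_divisible_sum_le:
  assumes "T \<subseteq> points" "\<And>x. x \<in> T \<Longrightarrow> bounded_weight (\<phi> x)"
  shows "\<bar>divisible_sum T n \<phi> E\<bar> \<le> real (card {f \<in> families n. E \<otimes> E divides family_prod f})"
proof -
  let ?A = "{f. f \<in> families n \<and> nonvanishing T f \<and> E \<otimes> E divides family_prod f}"
  have "\<bar>divisible_sum T n \<phi> E\<bar> \<le> (\<Sum>f\<in>?A. \<bar>weight T \<phi> f\<bar>)"
    unfolding divisible_sum_def by (rule sum_abs)
  also have "\<dots> \<le> (\<Sum>f\<in>?A. 1)"
    by (intro sum_mono abs_weight_le_one assms) (auto dest: families_closed)
  also have "\<dots> \<le> real (card {f \<in> families n. E \<otimes> E divides family_prod f})"
    by (auto intro!: card_mono simp: finite_families)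
  finally show ?thesis .
qed

lemma divisible_sum_eq_0:
  assumes E: "E \<in> carrier G" and x: "x \<in> T" "x \<in> points" "chi E x = 0"
  shows "divisible_sum T n \<phi> E = 0"
proof -
  have "\<not> nonvanishing T f" if f: "f \<in> families n" "E \<otimes> E divides family_prod f" for f
  proof -
    have "lin x divides E \<otimes> E" using E x lin_closed by (simp add: chi_eq_0_iff divides_prod_l)
    then have "lin x divides family_prod f" using f lin_closed x E by (meson divides_trans)
    then obtain i where "lin x divides f i"
      using prime_divides_family_prod_iff prime_lin lin_closed x families_closed[OF f(1)] by blast
    then have "chi (f i) x = 0" using f x by (simp add: chi_eq_0_iff families_def)
    then show ?thesis using x by (auto simp: nonvanishing_def)
  qed
  then have "{f. f \<in> families n \<and> nonvanishing T f \<and> E \<otimes> E divides family_prod f} = {}" by blast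
  then show ?thesis by (simp only: divisible_sum_def sum.empty)
qed

lemma divisible_sum_eq:
  fixes n :: "'i::finite \<Rightarrow> int"
  assumes E: "E \<in> carrier G" and T: "T \<subseteq> points" "\<And>x. x \<in> T \<Longrightarrow> chi E x \<noteq> 0"
    and n: "\<And>i. 2 * int (deg E) + int (card T) \<le> n i"
  shows "divisible_sum T n \<phi> E = square_density TYPE('i) E * real q powi sum n UNIV
    * ((real q - 1) / real q) ^ (CARD('i) * card T) * (\<Prod>x\<in>T. sign_mean (\<phi> x))"
proof -
  let ?A = "{f. f \<in> families n \<and> nonvanishing T f \<and> E \<otimes> E divides family_prod f}"
  let ?values = "\<lambda>f. restrict (\<lambda>x i. chi (f i) x) T"
  let ?S = "T \<rightarrow>\<^sub>E (sign_vectors :: ('i \<Rightarrow> real) set)"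
  define K where "K = square_density TYPE('i) E * real q powi sum n UNIV
    * ((real q - 1) / (2 * real q)) ^ (CARD('i) * card T)"
  have finT: "finite T" using T(1) finite_points finite_subset by blast
  have finS: "finite ?S" using finT finite_sign_vectors by (intro finite_PiE)
  have "?values f \<in> ?S" if "f \<in> ?A" for f
    using that T(1) chi_values by (fastforce simp: nonvanishing_def sign_vectors_def families_def)
  then have image: "?values ` ?A \<subseteq> ?S" by blast
  have "{f \<in> ?A. ?values f = s}
      = {f \<in> families n. E \<otimes> E divides family_prod f \<and> (\<forall>x\<in>T. \<forall>i. chi (f i) x = s x i)}"
    if s: "s \<in> ?S" for s
  proof -
    have "?values f = s \<longleftrightarrow> (\<forall>x\<in>T. \<forall>i. chi (f i) x = s x i)" for f
      using s by (auto simp: fun_eq_iff PiE_def extensional_def)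
    moreover have "s x i \<noteq> 0" if "x \<in> T" for x i
      using sign_vectorsD[OF PiE_mem[OF s that], of i] by auto
    ultimately show ?thesis by (auto simp: nonvanishing_def)
  qed
  then have fibre: "real (card {f \<in> ?A. ?values f = s}) = K" if "s \<in> ?S" for s
    using that card_families_square_divides[OF E T PiE_mem[OF that] n] by (simp add: K_def)
  have "divisible_sum T n \<phi> E = (\<Sum>s\<in>?S. \<Sum>f | f \<in> ?A \<and> ?values f = s. weight T \<phi> f)"
    unfolding divisible_sum_def
    using sum.group[OF _ finS image, of "weight T \<phi>"] finite_families[of n] by simp
  also have "\<dots> = (\<Sum>s\<in>?S. \<Sum>f | f \<in> ?A \<and> ?values f = s. \<Prod>x\<in>T. \<phi> x (s x))"
    by (intro sum.cong refl) (auto simp: weight_def intro!: prod.cong)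
  also have "\<dots> = K * (\<Sum>s\<in>?S. \<Prod>x\<in>T. \<phi> x (s x))"
    using fibre by (simp add: sum_distrib_left)
  also have "(\<Sum>s\<in>?S. \<Prod>x\<in>T. \<phi> x (s x)) = (\<Prod>x\<in>T. \<Sum>a\<in>sign_vectors. \<phi> x a)"
    by (rule prod_sum_PiE[symmetric]) (use finT in \<open>simp_all add: finite_sign_vectors\<close>)
  also have "\<dots> = (\<Prod>x\<in>T. sign_mean (\<phi> x)) * 2 ^ (CARD('i) * card T)"
    by (simp add: sign_mean_def prod_dividef power_mult)
  also have "K * \<dots> = square_density TYPE('i) E * real q powi sum n UNIV
    * ((real q - 1) / real q) ^ (CARD('i) * card T) * (\<Prod>x\<in>T. sign_mean (\<phi> x))"
    by (simp add: K_def power_divide power_mult_distrib)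
  finally show ?thesis .
qed

end

section \<open>The squarefree sieve\<close>

definition tail_sum :: "nat \<Rightarrow> real \<Rightarrow> real" where
  "tail_sum d \<epsilon> = (\<Sum>j. real (j + 1) ^ d * 2 powr (- \<epsilon> * real j))"

lemma tail_summable:
  assumes "\<epsilon> > 0"
  shows "summable (\<lambda>j. real (j + 1) ^ d * 2 powr (- \<epsilon> * real j))"
proof (rule summable_comparison_test_bigo)
  show "summable (\<lambda>j. norm (1 / real j ^ 2))"
    using inverse_power_summable[of 2, where ?'a = real] by (simp add: divide_inverse norm_power)
  show "(\<lambda>j. real (j + 1) ^ d * 2 powr (- \<epsilon> * real j)) \<in> O(\<lambda>j. 1 / real j ^ 2)"
    using assms by real_asymp
qed

lemma tail_sum_ge_1:
  assumes "\<epsilon> > 0" shows "tail_sum d \<epsilon> \<ge> 1"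
proof -
  have "(\<Sum>j\<in>{0}. real (j + 1) ^ d * 2 powr (- \<epsilon> * real j)) \<le> tail_sum d \<epsilon>"
    unfolding tail_sum_def by (rule sum_le_suminf[OF tail_summable[OF assms]]) auto
  then show ?thesis by simp
qed

context equidistributed_monoid
begin

definition weighted_sum ::
    "'x set \<Rightarrow> 'x set \<Rightarrow> ('i::finite \<Rightarrow> int) \<Rightarrow> ('x \<Rightarrow> ('i \<Rightarrow> real) \<Rightarrow> real) \<Rightarrow> real" where
  "weighted_sum U T n \<phi> = (\<Sum>f | f \<in> sqfree_families n \<and> nonvanishing U f. weight T \<phi> f)"

definition moebius_term ::
    "'x set \<Rightarrow> ('i::finite \<Rightarrow> int) \<Rightarrow> ('x \<Rightarrow> ('i \<Rightarrow> real) \<Rightarrow> real) \<Rightarrow> nat \<Rightarrow> real" where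
  "moebius_term T n \<phi> j = (\<Sum>E | E \<in> carrier G \<and> deg E = j. moebius_mu E * divisible_sum T n \<phi> E)"

lemma square_divisor_deg_le:
  "\<lbrakk>f \<in> families n; E \<in> carrier G; E \<otimes> E divides family_prod f\<rbrakk> \<Longrightarrow> deg E \<le> nat (sum n UNIV)"
  using deg_divides_le[of "E \<otimes> E" "family_prod f"] deg_family_prod[of f n] by (simp add: deg_mult)

lemma moebius_term_sums: "moebius_term T n \<phi> sums weighted_sum T T n \<phi>"
proof -
  define N where "N = nat (sum n UNIV)"
  let ?B = "{f \<in> families n. nonvanishing T f}" and ?C = "{E \<in> carrier G. deg E \<le> N}"
  have fin: "finite ?B" using finite_families[of n] by simp
  note deg_le = square_divisor_deg_le[of _ n, folded N_def]
  have "weighted_sum T T n \<phi> = (\<Sum>f\<in>?B. of_bool (sqfree (family_prod f)) * weight T \<phi> f)"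
    unfolding weighted_sum_def
    by (rule sum.mono_neutral_cong_left) (use fin in \<open>auto simp: sqfree_families_def\<close>)
  also have "\<dots> = (\<Sum>f\<in>?B. \<Sum>E\<in>?C. of_bool (E \<otimes> E divides family_prod f) * (moebius_mu E * weight T \<phi> f))"
  proof (intro sum.cong refl)
    fix f assume f: "f \<in> ?B"
    then have prod: "family_prod f \<in> carrier G" using families_closed[of f n] by simp
    have "of_bool (sqfree (family_prod f)) * weight T \<phi> f
        = (\<Sum>E | E \<in> carrier G \<and> E \<otimes> E divides family_prod f. moebius_mu E * weight T \<phi> f)"
      by (simp flip: sum_moebius_square_divisors[OF prod] sum_distrib_right)
    also have "\<dots> = (\<Sum>E\<in>?C. of_bool (E \<otimes> E divides family_prod f) * (moebius_mu E * weight T \<phi> f))"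
      by (rule sum.mono_neutral_cong_left) (use deg_le f finite_deg_le in auto)
    finally show "of_bool (sqfree (family_prod f)) * weight T \<phi> f = \<dots>" .
  qed
  also have "\<dots> = (\<Sum>E\<in>?C. \<Sum>f\<in>?B. of_bool (E \<otimes> E divides family_prod f) * (moebius_mu E * weight T \<phi> f))"
    by (rule sum.swap)
  also have "\<dots> = (\<Sum>E\<in>?C. moebius_mu E * divisible_sum T n \<phi> E)"
    unfolding divisible_sum_def sum_distrib_left
    by (intro sum.cong refl sum.mono_neutral_cong_right) (use fin in auto)
  also have "\<dots> = (\<Sum>j\<le>N. \<Sum>E | E \<in> ?C \<and> deg E = j. moebius_mu E * divisible_sum T n \<phi> E)"
    by (rule sum.group[symmetric]) (auto simp: finite_deg_le)
  also have "\<dots> = (\<Sum>j\<le>N. moebius_term T n \<phi> j)"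
    unfolding moebius_term_def by (intro sum.cong refl) auto
  finally have "weighted_sum T T n \<phi> = (\<Sum>j\<le>N. moebius_term T n \<phi> j)" .
  moreover have "moebius_term T n \<phi> j = 0" if "j \<notin> {..N}" for j
  proof -
    have "divisible_sum T n \<phi> E = 0" if "E \<in> carrier G" "deg E = j" for E
      unfolding divisible_sum_def using deg_le[of _ E] that \<open>j \<notin> {..N}\<close> by (intro sum.neutral) auto
    then show ?thesis unfolding moebius_term_def by (intro sum.neutral) simp
  qed
  ultimately show ?thesis using sums_finite[of "{..N}" "moebius_term T n \<phi>"] by simp
qed

lemma abs_moebius_term_le:
  fixes n :: "'i::finite \<Rightarrow> int"
  assumes "T \<subseteq> points" "\<And>x. x \<in> T \<Longrightarrow> bounded_weight (\<phi> x)"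
  shows "\<bar>moebius_term T n \<phi> j\<bar> \<le> real (j + 1) ^ CARD('i \<times> 'i) / real q ^ j * real q powi sum n UNIV"
proof -
  have "\<bar>moebius_term T n \<phi> j\<bar> \<le> (\<Sum>E | E \<in> carrier G \<and> deg E = j. \<bar>moebius_mu E * divisible_sum T n \<phi> E\<bar>)"
    unfolding moebius_term_def by (rule sum_abs)
  also have "\<dots> \<le> (\<Sum>E | E \<in> carrier G \<and> deg E = j. 1 * real (card {f \<in> families n. E \<otimes> E divides family_prod f}))"
    unfolding abs_mult using abs_moebius_mu_le abs_divisible_sum_le[of T \<phi> n, OF assms]
    by (intro sum_mono mult_mono) auto
  also have "\<dots> \<le> real (j + 1) ^ CARD('i \<times> 'i) / real q ^ j * real q powi sum n UNIV"
    using sum_card_square_divides_le[of n j] by simp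
  finally show ?thesis .
qed

definition density_term :: "'i::finite itself \<Rightarrow> 'x set \<Rightarrow> nat \<Rightarrow> real" where
  "density_term \<tau> U j = ((real q - 1) / real q) ^ (CARD('i) * card U) *
    (\<Sum>E | E \<in> carrier G \<and> deg E = j \<and> (\<forall>x\<in>U. chi E x \<noteq> 0). moebius_mu E * square_density \<tau> E)"

text \<open>
  The density of the families that do not vanish at any point of \<open>U\<close> and whose product is not
  divisible by the square of a prime outside \<open>U\<close>.
\<close>

definition sieve_density :: "'i::finite itself \<Rightarrow> 'x set \<Rightarrow> real" where
  "sieve_density \<tau> U = (\<Sum>j. density_term \<tau> U j)"

lemma moebius_term_eq:
  fixes n :: "'i::finite \<Rightarrow> int"
  assumes T: "T \<subseteq> points" and n: "\<And>i. 2 * int j + int (card T) \<le> n i"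
  shows "moebius_term T n \<phi> j
    = density_term TYPE('i) T j * (\<Prod>x\<in>T. sign_mean (\<phi> x)) * real q powi sum n UNIV"
proof -
  have "moebius_term T n \<phi> j = (\<Sum>E | E \<in> carrier G \<and> deg E = j \<and> (\<forall>x\<in>T. chi E x \<noteq> 0).
      moebius_mu E * divisible_sum T n \<phi> E)"
    unfolding moebius_term_def
  proof (rule sum.mono_neutral_right)
    show "\<forall>E\<in>{E \<in> carrier G. deg E = j} - {E. E \<in> carrier G \<and> deg E = j \<and> (\<forall>x\<in>T. chi E x \<noteq> 0)}.
        moebius_mu E * divisible_sum T n \<phi> E = 0"
      using divisible_sum_eq_0 T by fastforce
  qed (auto simp: finite_deg)
  also have "\<dots> = (\<Sum>E | E \<in> carrier G \<and> deg E = j \<and> (\<forall>x\<in>T. chi E x \<noteq> 0).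
      moebius_mu E * square_density TYPE('i) E) * (((real q - 1) / real q) ^ (CARD('i) * card T)
      * (\<Prod>x\<in>T. sign_mean (\<phi> x)) * real q powi sum n UNIV)"
    unfolding sum_distrib_right using n T by (intro sum.cong refl) (simp add: divisible_sum_eq)
  finally show ?thesis by (simp add: density_term_def)
qed

lemma square_density_nonneg: "square_density \<tau> E \<ge> 0"
  by (simp add: square_density_def)

lemma sum_square_density_le:
  "(\<Sum>E | E \<in> carrier G \<and> deg E = j. square_density TYPE('i::finite) E) \<le> real (j + 1) ^ CARD('i \<times> 'i) / real q ^ j"
proof -
  have q: "real q ^ (CARD('i) * (2 * j)) > 0" using q_ge_2 by simp
  have "(\<Sum>i\<in>(UNIV :: 'i set). 2 * int j) = int (CARD('i) * (2 * j))" by simp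
  then have "real q powi (\<Sum>i\<in>(UNIV :: 'i set). 2 * int j) = real q ^ (CARD('i) * (2 * j))"
    by (simp only: power_int_of_nat)
  then show ?thesis
    using q sum_card_square_divides_le[of "\<lambda>_ :: 'i. 2 * int j" j]
    by (simp add: square_density_def divide_le_eq flip: sum_divide_distrib)
qed

lemma abs_density_term_le: "\<bar>density_term TYPE('i::finite) U j\<bar> \<le> real (j + 1) ^ CARD('i \<times> 'i) / real q ^ j"
proof -
  let ?D = "{E \<in> carrier G. deg E = j \<and> (\<forall>x\<in>U. chi E x \<noteq> 0)}"
  have "\<bar>\<Sum>E\<in>?D. moebius_mu E * square_density TYPE('i) E\<bar> \<le> (\<Sum>E\<in>?D. \<bar>moebius_mu E * square_density TYPE('i) E\<bar>)"
    by (rule sum_abs)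
  also have "\<dots> \<le> (\<Sum>E\<in>?D. 1 * square_density TYPE('i) E)"
    unfolding abs_mult using abs_moebius_mu_le square_density_nonneg by (intro sum_mono mult_mono) auto
  also have "\<dots> \<le> (\<Sum>E | E \<in> carrier G \<and> deg E = j. 1 * square_density TYPE('i) E)"
    using square_density_nonneg finite_deg by (intro sum_mono2) auto
  also have "\<dots> \<le> real (j + 1) ^ CARD('i \<times> 'i) / real q ^ j" using sum_square_density_le by simp
  finally have "\<bar>\<Sum>E\<in>?D. moebius_mu E * square_density TYPE('i) E\<bar> \<le> real (j + 1) ^ CARD('i \<times> 'i) / real q ^ j" .
  moreover have "\<bar>((real q - 1) / real q) ^ (CARD('i) * card U)\<bar> \<le> 1"
    using q_ge_2 by (simp add: power_abs power_le_one)
  ultimately show ?thesis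
    unfolding density_term_def abs_mult
    using mult_mono[of _ 1 "\<bar>\<Sum>E\<in>?D. moebius_mu E * square_density TYPE('i) E\<bar>"] by fastforce
qed

lemma inverse_power_le_tail:
  assumes "0 < \<epsilon>" "\<epsilon> < 1" "real_of_int i \<le> 2 * real j"
  shows "real (j + 1) ^ d / real q ^ j
    \<le> real (j + 1) ^ d * 2 powr (- \<epsilon> * real j) * real q powr (- ((1 - \<epsilon>) / 2) * real_of_int i)"
proof -
  have q: "real q \<ge> 2" using q_ge_2 by simp
  have "(1 - \<epsilon>) / 2 * real_of_int i \<le> (1 - \<epsilon>) / 2 * (2 * real j)"
    using assms by (intro mult_left_mono) auto
  then have exponent: "- (1 - \<epsilon>) * real j \<le> - ((1 - \<epsilon>) / 2) * real_of_int i" by (simp add: field_simps)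
  have "1 / real q ^ j = real q powr (- real j)"
    using q by (simp add: powr_minus powr_realpow divide_inverse)
  also have "- real j = - \<epsilon> * real j + - (1 - \<epsilon>) * real j" by (simp add: algebra_simps)
  also have "real q powr \<dots> = real q powr (- \<epsilon> * real j) * real q powr (- (1 - \<epsilon>) * real j)"
    by (rule powr_add)
  also have "\<dots> \<le> 2 powr (- \<epsilon> * real j) * real q powr (- ((1 - \<epsilon>) / 2) * real_of_int i)"
  proof (rule mult_mono)
    show "real q powr (- \<epsilon> * real j) \<le> 2 powr (- \<epsilon> * real j)"
      using assms q by (intro powr_mono2') auto
    show "real q powr (- (1 - \<epsilon>) * real j) \<le> real q powr (- ((1 - \<epsilon>) / 2) * real_of_int i)"
      using q exponent by (intro powr_mono) auto
  qed auto
  finally have "real (j + 1) ^ d * (1 / real q ^ j)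
      \<le> real (j + 1) ^ d * (2 powr (- \<epsilon> * real j) * real q powr (- ((1 - \<epsilon>) / 2) * real_of_int i))"
    by (rule mult_left_mono) simp
  then show ?thesis by (simp add: mult.assoc)
qed

lemma density_term_summable: "summable (density_term TYPE('i::finite) U)"
proof (rule summable_comparison_test)
  let ?u = "\<lambda>j. real (j + 1) ^ CARD('i \<times> 'i) * 2 powr (- (1/2) * real j)"
  have "\<bar>density_term TYPE('i) U j\<bar> \<le> ?u j" for j
    using abs_density_term_le[of U j, where ?'i = 'i] inverse_power_le_tail[of "1/2" 0 j "CARD('i \<times> 'i)"]
      q_ge_2 by simp
  then show "\<exists>N. \<forall>j\<ge>N. norm (density_term TYPE('i) U j) \<le> ?u j" by simp
  show "summable ?u" using tail_summable[of "1/2"] by simp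
qed

definition error_bound :: "nat \<Rightarrow> real \<Rightarrow> int \<Rightarrow> real" where
  "error_bound d \<epsilon> m = 2 * tail_sum d \<epsilon> * real q powr (- ((1 - \<epsilon>) / 2) * real_of_int m)"

lemma moebius_term_estimate:
  fixes n :: "'i::finite \<Rightarrow> int"
  assumes eps: "0 < \<epsilon>" "\<epsilon> < 1" and T: "T \<subseteq> points" and \<phi>: "\<And>x. x \<in> T \<Longrightarrow> bounded_weight (\<phi> x)"
    and n: "\<And>i. m + int (card T) \<le> n i"
  shows "\<bar>moebius_term T n \<phi> j / real q powi sum n UNIV
      - density_term TYPE('i) T j * (\<Prod>x\<in>T. sign_mean (\<phi> x))\<bar>
    \<le> 2 * (real (j + 1) ^ CARD('i \<times> 'i) * 2 powr (- \<epsilon> * real j))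
      * real q powr (- ((1 - \<epsilon>) / 2) * real_of_int m)"
    (is "\<bar>_ / ?Q - _ * ?P\<bar> \<le> ?bound")
proof -
  have Q: "?Q > 0" using q_ge_2 by simp
  consider (exact) "2 * int j \<le> m" | (tail) "m \<le> 2 * int j" by linarith
  then show ?thesis
  proof cases
    case exact
    then have "2 * int j + int (card T) \<le> n i" for i using n[of i] by linarith
    from moebius_term_eq[of T j n \<phi>, OF T this]
    have "moebius_term T n \<phi> j / ?Q = density_term TYPE('i) T j * ?P"
      using Q by (metis less_irrefl nonzero_mult_div_cancel_right)
    then show ?thesis by simp
  next
    case tail
    have "\<bar>?P\<bar> \<le> 1"
      unfolding abs_prod using abs_sign_mean_le_one[OF \<phi>] by (intro prod_le_1) auto
    then have "\<bar>density_term TYPE('i) T j * ?P\<bar> \<le> \<bar>density_term TYPE('i) T j\<bar>"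
      unfolding abs_mult by (intro mult_right_le_one_le) auto
    moreover have "\<bar>moebius_term T n \<phi> j / ?Q\<bar> \<le> real (j + 1) ^ CARD('i \<times> 'i) / real q ^ j"
      using abs_moebius_term_le[of T \<phi> n j, OF T \<phi>] Q by (simp add: abs_divide divide_le_eq)
    moreover have "2 * (real (j + 1) ^ CARD('i \<times> 'i) / real q ^ j) \<le> ?bound"
      using inverse_power_le_tail[OF eps, of m j "CARD('i \<times> 'i)"] tail by simp
    ultimately show ?thesis using abs_density_term_le[of T j, where ?'i = 'i] by linarith
  qed
qed

lemma weighted_sum_estimate_nonvanishing:
  fixes n :: "'i::finite \<Rightarrow> int"
  assumes eps: "0 < \<epsilon>" "\<epsilon> < 1" and T: "T \<subseteq> points" and \<phi>: "\<And>x. x \<in> T \<Longrightarrow> bounded_weight (\<phi> x)"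
    and n: "\<And>i. m + int (card T) \<le> n i"
  shows "\<bar>weighted_sum T T n \<phi> / real q powi sum n UNIV
      - sieve_density TYPE('i) T * (\<Prod>x\<in>T. sign_mean (\<phi> x))\<bar> \<le> error_bound CARD('i \<times> 'i) \<epsilon> m"
proof -
  let ?Q = "real q powi sum n UNIV" and ?P = "\<Prod>x\<in>T. sign_mean (\<phi> x)"
  let ?bound = "\<lambda>j. 2 * (real (j + 1) ^ CARD('i \<times> 'i) * 2 powr (- \<epsilon> * real j))
    * real q powr (- ((1 - \<epsilon>) / 2) * real_of_int m)"
  have "(\<lambda>j. moebius_term T n \<phi> j / ?Q - density_term TYPE('i) T j * ?P)
      sums (weighted_sum T T n \<phi> / ?Q - sieve_density TYPE('i) T * ?P)"
    unfolding sieve_density_def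
    by (intro sums_diff sums_divide sums_mult2 moebius_term_sums summable_sums density_term_summable)
  moreover have "?bound sums error_bound CARD('i \<times> 'i) \<epsilon> m"
    unfolding error_bound_def tail_sum_def
    by (intro sums_mult2 sums_mult summable_sums tail_summable eps)
  moreover have "norm (moebius_term T n \<phi> j / ?Q - density_term TYPE('i) T j * ?P) \<le> ?bound j" for j
    unfolding real_norm_def by (rule moebius_term_estimate[OF eps T \<phi> n])
  ultimately show ?thesis
    using norm_suminf_le[of "\<lambda>j. moebius_term T n \<phi> j / ?Q - density_term TYPE('i) T j * ?P" ?bound]
    by (simp add: sums_iff del: of_nat_add)
qed

lemma error_bound_nonneg: "0 < \<epsilon> \<Longrightarrow> error_bound d \<epsilon> m \<ge> 0"
  using tail_sum_ge_1[of \<epsilon> d] by (simp add: error_bound_def)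

lemma error_bound_antimono:
  assumes "0 < \<epsilon>" "\<epsilon> < 1" "m \<le> m'"
  shows "error_bound d \<epsilon> m' \<le> error_bound d \<epsilon> m"
proof -
  have "(1 - \<epsilon>) / 2 * real_of_int m \<le> (1 - \<epsilon>) / 2 * real_of_int m'"
    using assms by (intro mult_left_mono) auto
  then have "real q powr (- ((1 - \<epsilon>) / 2) * real_of_int m') \<le> real q powr (- ((1 - \<epsilon>) / 2) * real_of_int m)"
    using q_ge_2 by (intro powr_mono) auto
  then show ?thesis
    unfolding error_bound_def using tail_sum_ge_1[OF assms(1), of d] by (intro mult_left_mono) auto
qed

lemma error_bound_diff:
  "error_bound d \<epsilon> (m - l) = error_bound d \<epsilon> m * real q powr ((1 - \<epsilon>) / 2 * real_of_int l)"
  by (simp add: error_bound_def algebra_simps diff_divide_distrib flip: powr_add)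

lemma error_bound_pred:
  assumes "0 < \<epsilon>" "\<epsilon> < 1"
  shows "error_bound d \<epsilon> (m - 1) / real q \<le> error_bound d \<epsilon> m"
proof -
  have q: "real q \<ge> 2" using q_ge_2 by simp
  have "real q powr ((1 - \<epsilon>) / 2) \<le> real q powr 1" using assms q by (intro powr_mono) auto
  then have "error_bound d \<epsilon> m * real q powr ((1 - \<epsilon>) / 2) \<le> error_bound d \<epsilon> m * real q"
    using q error_bound_nonneg[OF assms(1)] by (intro mult_left_mono) auto
  then show ?thesis using q by (simp add: error_bound_diff divide_le_eq)
qed

lemma error_bound_tendsto_0:
  assumes "0 < \<epsilon>" "\<epsilon> < 1"
  shows "(\<lambda>m. error_bound d \<epsilon> (int m)) \<longlonglongrightarrow> 0"
proof -
  define c where "c = (1 - \<epsilon>) / 2"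
  have "c > 0" "real q > 1" using assms q_ge_2 by (simp_all add: c_def)
  then have "(\<lambda>m::nat. real q powr (- c * real m)) \<longlonglongrightarrow> 0" by real_asymp
  from tendsto_mult_right_zero[OF this, of "2 * tail_sum d \<epsilon>"] show ?thesis
    by (simp add: error_bound_def c_def)
qed

lemma card_sqfree_families_estimate:
  fixes n :: "'i::finite \<Rightarrow> int"
  assumes "0 < \<epsilon>" "\<epsilon> < 1" "\<And>i. m \<le> n i"
  shows "\<bar>real (card (sqfree_families n)) / real q powi sum n UNIV - sieve_density TYPE('i) {}\<bar>
    \<le> error_bound CARD('i \<times> 'i) \<epsilon> m"
proof -
  have "weighted_sum {} {} n (\<lambda>_ _. 1) = real (card (sqfree_families n))"
    by (simp add: weighted_sum_def weight_def nonvanishing_def)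
  then show ?thesis
    using weighted_sum_estimate_nonvanishing[of \<epsilon> "{}" "\<lambda>_ _. 1" m n] assms by simp
qed

subsection \<open>The density of squarefree products\<close>

lemma sieve_density_empty_nonneg: "sieve_density TYPE('i::finite) {} \<ge> 0"
proof -
  have nonneg: "0 \<le> sieve_density TYPE('i) {} + error_bound CARD('i \<times> 'i) (1/2) (int m)" for m
  proof -
    let ?n = "\<lambda>_ :: 'i. int m"
    have "0 \<le> real (card (sqfree_families ?n)) / real q powi sum ?n UNIV" by simp
    moreover have "\<bar>real (card (sqfree_families ?n)) / real q powi sum ?n UNIV - sieve_density TYPE('i) {}\<bar>
        \<le> error_bound CARD('i \<times> 'i) (1/2) (int m)"
      by (rule card_sqfree_families_estimate) auto
    ultimately show ?thesis by linarith
  qed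
  have "(\<lambda>m. sieve_density TYPE('i) {} + error_bound CARD('i \<times> 'i) (1/2) (int m))
      \<longlonglongrightarrow> sieve_density TYPE('i) {} + 0"
    by (intro tendsto_add tendsto_const error_bound_tendsto_0) auto
  from LIMSEQ_le_const[OF this, of 0] show ?thesis using nonneg by auto
qed

lemma card_sqfree_families_pair_degree_le:
  fixes n :: "'i::finite \<Rightarrow> int"
  assumes eps: "0 < \<epsilon>" "\<epsilon> < 1" and n: "\<And>i. m \<le> n i" and A: "A \<in> families_of_total_degree j"
  shows "real (card (sqfree_families (\<lambda>i. n i - pair_degree A i)))
    \<le> (sieve_density TYPE('i) {} + error_bound CARD('i \<times> 'i) \<epsilon> (m - 2 * int j))
      * (real q powi sum n UNIV / (real q ^ j * real q ^ j))"
proof -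
  have q: "real q > 0" using q_ge_2 by simp
  have "m - 2 * int j \<le> n i - pair_degree A i" for i
    using pair_degree_le[of A i] A n[of i] by (simp add: families_of_total_degree_def del: of_nat_sum)
  note estimate = card_sqfree_families_estimate[of \<epsilon> "m - 2 * int j" "\<lambda>i. n i - pair_degree A i", OF eps this]
  have "(\<Sum>i\<in>UNIV. n i - pair_degree A i) = sum n UNIV - 2 * int j"
    using A by (simp add: sum_subtractf sum_pair_degree families_of_total_degree_def)
  then have powi: "real q powi (\<Sum>i\<in>UNIV. n i - pair_degree A i) = real q powi sum n UNIV / (real q ^ j * real q ^ j)"
    using q by (simp add: power_int_diff power_int_mult power2_eq_square mult.commute)
  have "real (card (sqfree_families (\<lambda>i. n i - pair_degree A i)))
        / (real q powi sum n UNIV / (real q ^ j * real q ^ j))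
      \<le> sieve_density TYPE('i) {} + error_bound CARD('i \<times> 'i) \<epsilon> (m - 2 * int j)"
    using estimate unfolding powi by linarith
  then show ?thesis using q by (subst (asm) pos_divide_le_eq) auto
qed

lemma sum_card_sqfree_families_le:
  fixes n :: "'i::finite \<Rightarrow> int"
  assumes eps: "0 < \<epsilon>" "\<epsilon> < 1" and n: "\<And>i. m \<le> n i"
  shows "(\<Sum>A\<in>families_of_total_degree j. real (card (sqfree_families (\<lambda>i. n i - pair_degree A i))))
    \<le> real (j + 1) ^ CARD('i \<times> 'i) * 2 powr (- \<epsilon> * real j)
      * (real q powi sum n UNIV * (sieve_density TYPE('i) {} + error_bound CARD('i \<times> 'i) \<epsilon> m))"
proof -
  let ?d = "CARD('i \<times> 'i)" and ?D = "sieve_density TYPE('i) {}"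
  define Q where "Q = real q powi sum n UNIV"
  define t where "t = real (j + 1) ^ ?d * 2 powr (- \<epsilon> * real j)"
  have q: "real q \<ge> 2" using q_ge_2 by simp
  have Q: "Q > 0" using q by (simp add: Q_def)
  have D: "?D \<ge> 0" "error_bound ?d \<epsilon> m' \<ge> 0" for m'
    using sieve_density_empty_nonneg error_bound_nonneg[OF eps(1)] by auto
  have "(\<Sum>A\<in>families_of_total_degree j. real (card (sqfree_families (\<lambda>i. n i - pair_degree A i))))
      \<le> real (card (families_of_total_degree j :: ('i \<times> 'i \<Rightarrow> 'm) set))
        * ((?D + error_bound ?d \<epsilon> (m - 2 * int j)) * (Q / (real q ^ j * real q ^ j)))"
    unfolding Q_def by (rule sum_bounded_above) (rule card_sqfree_families_pair_degree_le[OF eps n])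
  also have "\<dots> \<le> (real (j + 1) ^ ?d * real q ^ j)
      * ((?D + error_bound ?d \<epsilon> (m - 2 * int j)) * (Q / (real q ^ j * real q ^ j)))"
    using Q D q by (intro mult_right_mono card_families_of_total_degree_le) auto
  also have "\<dots> = Q * (real (j + 1) ^ ?d / real q ^ j * ?D
      + real (j + 1) ^ ?d / real q ^ j * error_bound ?d \<epsilon> (m - 2 * int j))"
    using q by (simp add: field_simps)
  also have "\<dots> \<le> Q * (t * ?D + t * error_bound ?d \<epsilon> m)"
  proof (intro mult_left_mono add_mono)
    show "real (j + 1) ^ ?d / real q ^ j * ?D \<le> t * ?D"
      using inverse_power_le_tail[OF eps, of 0 j ?d] D q by (intro mult_right_mono) (auto simp: t_def)
    have "real (j + 1) ^ ?d / real q ^ j \<le> t * real q powr (- ((1 - \<epsilon>) / 2) * real_of_int (2 * int j))"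
      using inverse_power_le_tail[OF eps, of "2 * int j" j ?d] by (simp add: t_def)
    then have "real (j + 1) ^ ?d / real q ^ j * error_bound ?d \<epsilon> (m - 2 * int j)
        \<le> t * real q powr (- ((1 - \<epsilon>) / 2) * real_of_int (2 * int j)) * error_bound ?d \<epsilon> (m - 2 * int j)"
      using D(2) by (rule mult_right_mono)
    also have "\<dots> = t * error_bound ?d \<epsilon> m"
      using error_bound_diff[of ?d \<epsilon> "m - 2 * int j" "- (2 * int j)"] by (simp add: mult_ac)
    finally show "real (j + 1) ^ ?d / real q ^ j * error_bound ?d \<epsilon> (m - 2 * int j) \<le> t * error_bound ?d \<epsilon> m" .
  qed (use Q in simp)
  finally show ?thesis by (simp add: Q_def t_def algebra_simps)
qed

text \<open>
  Every family arises from a squarefree one by \<open>pair_scale\<close>, so a positive proportion of the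
  families is squarefree.
\<close>

lemma one_le_tail_sum_mult_sieve_density:
  assumes eps: "0 < \<epsilon>" "\<epsilon> < 1"
  shows "1 \<le> tail_sum CARD('i \<times> 'i) \<epsilon> * (sieve_density TYPE('i::finite) {} + error_bound CARD('i \<times> 'i) \<epsilon> (int m))"
proof -
  let ?n = "\<lambda>_ :: 'i. int m" and ?d = "CARD('i \<times> 'i)"
  let ?N = "nat (sum ?n UNIV)"
  define Q where "Q = real q powi sum ?n UNIV"
  define D where "D = sieve_density TYPE('i) {} + error_bound ?d \<epsilon> (int m)"
  have Q: "Q > 0" using q_ge_2 by (simp add: Q_def)
  have D: "D \<ge> 0" using sieve_density_empty_nonneg[where ?'i = 'i] error_bound_nonneg[OF eps(1)]
    by (simp add: D_def)
  have "Q = real (card (families ?n))" unfolding Q_def by (rule card_families[symmetric]) simp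
  also have "\<dots> \<le> (\<Sum>j\<le>?N. \<Sum>A\<in>families_of_total_degree j. real (card (sqfree_families (\<lambda>i. ?n i - pair_degree A i))))"
    using of_nat_mono[OF card_families_le_sum_sqfree_families[of ?n], where ?'a = real] by simp
  also have "\<dots> \<le> (\<Sum>j\<le>?N. real (j + 1) ^ ?d * 2 powr (- \<epsilon> * real j) * (Q * D))"
    unfolding Q_def D_def by (intro sum_mono sum_card_sqfree_families_le eps) simp
  also have "\<dots> = (\<Sum>j\<le>?N. real (j + 1) ^ ?d * 2 powr (- \<epsilon> * real j)) * (Q * D)"
    by (rule sum_distrib_right[symmetric])
  also have "\<dots> \<le> tail_sum ?d \<epsilon> * (Q * D)"
    unfolding tail_sum_def using Q D
    by (intro mult_right_mono sum_le_suminf tail_summable eps) auto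
  finally have "Q * 1 \<le> Q * (tail_sum ?d \<epsilon> * D)" by (simp add: mult_ac)
  then show ?thesis using Q by (simp only: mult_le_cancel_left_pos D_def)
qed

lemma sieve_density_empty_ge:
  assumes eps: "0 < \<epsilon>" "\<epsilon> < 1"
  shows "sieve_density TYPE('i::finite) {} \<ge> 1 / tail_sum CARD('i \<times> 'i) \<epsilon>"
proof -
  let ?K = "tail_sum CARD('i \<times> 'i) \<epsilon>"
  have "(\<lambda>m. ?K * (sieve_density TYPE('i) {} + error_bound CARD('i \<times> 'i) \<epsilon> (int m)))
      \<longlonglongrightarrow> ?K * (sieve_density TYPE('i) {} + 0)"
    by (intro tendsto_intros error_bound_tendsto_0 eps)
  then have "1 \<le> ?K * (sieve_density TYPE('i) {} + 0)"
    by (rule LIMSEQ_le_const) (use one_le_tail_sum_mult_sieve_density[OF eps] in blast)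
  moreover have "?K \<ge> 1" by (rule tail_sum_ge_1[OF eps(1)])
  ultimately show ?thesis by (simp add: divide_le_eq mult.commute)
qed

section \<open>Splitting off the zeros at a point\<close>

lemma nonvanishing_insert_iff:
  assumes f: "f \<in> families n" and x: "x \<in> points"
  shows "nonvanishing (insert x U) f \<longleftrightarrow> nonvanishing U f \<and> (\<forall>i. \<not> lin x divides f i)"
  using assms by (auto simp: nonvanishing_def families_def chi_eq_0_iff)

lemma bij_betw_scale_at:
  assumes p: "p \<in> carrier G"
  shows "bij_betw (scale_at i p) (families (n(i := n i - int (deg p)))) {f \<in> families n. p divides f i}"
proof (rule bij_betw_imageI)
  show "inj_on (scale_at i p) (families (n(i := n i - int (deg p))))"
  proof (rule inj_onI)
    fix f g assume fg: "f \<in> families (n(i := n i - int (deg p)))" "g \<in> families (n(i := n i - int (deg p)))"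
      and eq: "scale_at i p f = scale_at i p g"
    have "f l = g l" for l
      using fun_cong[OF eq, of l] fg p by (cases "l = i") (auto simp: scale_at_def families_def l_cancel)
    then show "f = g" ..
  qed
  show "scale_at i p ` families (n(i := n i - int (deg p))) = {f \<in> families n. p divides f i}"
  proof (intro equalityI subsetI)
    fix f assume f: "f \<in> {f \<in> families n. p divides f i}"
    then obtain c where c: "c \<in> carrier G" "f i = p \<otimes> c" by auto
    then have "f(i := c) \<in> families (n(i := n i - int (deg p)))"
      using f p by (auto simp: families_def deg_mult dest: spec[of _ i])
    moreover have "f = scale_at i p (f(i := c))" using c by (auto simp: scale_at_def)
    ultimately show "f \<in> scale_at i p ` families (n(i := n i - int (deg p)))" by blast
  qed (use p in \<open>auto simp: scale_at_def families_def deg_mult split: if_splits\<close>)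
qed

lemma sqfree_nonvanishing_scale_at_iff:
  assumes x: "x \<in> points" "x \<notin> U" and U: "U \<subseteq> points" and g: "g \<in> families n"
  shows "sqfree (family_prod (scale_at i (lin x) g)) \<and> nonvanishing U (scale_at i (lin x) g)
    \<longleftrightarrow> sqfree (family_prod g) \<and> nonvanishing (insert x U) g"
proof -
  have gc: "g \<in> UNIV \<rightarrow> carrier G" by (rule families_closed[OF g])
  have "sqfree (family_prod (scale_at i (lin x) g)) \<longleftrightarrow> sqfree (family_prod g) \<and> (\<forall>l. \<not> lin x divides g l)"
    using gc x prime_divides_family_prod_iff[OF prime_lin lin_closed gc]
    by (simp add: family_prod_scale_at lin_closed sqfree_prime_mult_iff prime_lin)
  moreover have "chi (scale_at i (lin x) g l) y \<noteq> 0 \<longleftrightarrow> chi (g l) y \<noteq> 0" if "y \<in> U" for l y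
  proof -
    have y: "y \<in> points" "y \<noteq> x" using that x U by auto
    then have "chi (lin x \<otimes> g i) y = chi (lin x) y * chi (g i) y"
      using gc x by (intro chi_mult lin_closed) auto
    then show ?thesis using chi_lin[of x y] x y by (auto simp: scale_at_def)
  qed
  then have "nonvanishing U (scale_at i (lin x) g) \<longleftrightarrow> nonvanishing U g" by (auto simp: nonvanishing_def)
  ultimately show ?thesis using nonvanishing_insert_iff[OF g x(1)] by blast
qed

lemma bij_betw_scale_at_lin:
  assumes x: "x \<in> points" "x \<notin> U" and U: "U \<subseteq> points"
  shows "bij_betw (scale_at i (lin x))
    {g. g \<in> sqfree_families (n(i := n i - 1)) \<and> nonvanishing (insert x U) g}
    {f. f \<in> sqfree_families n \<and> nonvanishing U f \<and> lin x divides f i}" (is "bij_betw ?m ?A ?B")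
proof -
  let ?n = "n(i := n i - 1)"
  have bij: "bij_betw ?m (families ?n) {f \<in> families n. lin x divides f i}"
    using bij_betw_scale_at[OF lin_closed[OF x(1)], of i n] deg_lin[OF x(1)] by simp
  then have image: "?m ` families ?n = {f \<in> families n. lin x divides f i}" by (simp add: bij_betw_def)
  have "?A = {g \<in> families ?n. ?m g \<in> ?B}"
    using sqfree_nonvanishing_scale_at_iff[OF x U, of _ ?n i] image
    by (auto simp: sqfree_families_def)
  moreover have "?B \<subseteq> ?m ` families ?n" unfolding image by (auto simp: sqfree_families_def)
  ultimately have "?m ` ?A = ?B" by auto
  then show ?thesis using bij by (auto simp: sqfree_families_def intro: bij_betw_subset)
qed

definition shift_weight ::
    "'i \<Rightarrow> 'x \<Rightarrow> ('x \<Rightarrow> ('i \<Rightarrow> real) \<Rightarrow> real) \<Rightarrow> 'x \<Rightarrow> ('i \<Rightarrow> real) \<Rightarrow> real" where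
  "shift_weight i x \<phi> y a = \<phi> y (a(i := chi (lin x) y * a i))"

lemma weight_scale_at_lin:
  assumes "x \<in> points" "T \<subseteq> points" "f \<in> UNIV \<rightarrow> carrier G"
  shows "weight T \<phi> (scale_at i (lin x) f) = weight T (shift_weight i x \<phi>) f"
  unfolding weight_def
proof (rule prod.cong[OF refl])
  fix y assume "y \<in> T"
  then have "chi (lin x \<otimes> f i) y = chi (lin x) y * chi (f i) y"
    using assms by (intro chi_mult lin_closed) auto
  then have "(\<lambda>l. chi (scale_at i (lin x) f l) y) = (\<lambda>l. chi (f l) y)(i := chi (lin x) y * chi (f i) y)"
    by (auto simp: scale_at_def)
  then show "\<phi> y (\<lambda>l. chi (scale_at i (lin x) f l) y) = shift_weight i x \<phi> y (\<lambda>l. chi (f l) y)"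
    by (simp only: shift_weight_def)
qed

lemma weighted_sum_split:
  fixes n :: "'i::finite \<Rightarrow> int"
  assumes x: "x \<in> points" "x \<notin> U" and U: "U \<subseteq> points" and T: "T \<subseteq> points"
  shows "weighted_sum U T n \<phi> = weighted_sum (insert x U) T n \<phi>
    + (\<Sum>i\<in>UNIV. weighted_sum (insert x U) T (n(i := n i - 1)) (shift_weight i x \<phi>))"
proof -
  let ?Z = "\<lambda>i. {f. f \<in> sqfree_families n \<and> nonvanishing U f \<and> lin x divides f i}"
  let ?N = "{f. f \<in> sqfree_families n \<and> nonvanishing (insert x U) f}"
  have fin: "finite (?Z i)" "finite ?N" for i by (auto simp: finite_sqfree_families)
  have N: "?N = {f. f \<in> sqfree_families n \<and> nonvanishing U f \<and> (\<forall>i. \<not> lin x divides f i)}"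
    using nonvanishing_insert_iff[OF _ x(1)] by (auto simp: sqfree_families_def)
  have "\<not> (lin x divides f i \<and> lin x divides f j)" if "f \<in> sqfree_families n" "i \<noteq> j" for f i j
  proof -
    have "coprime_elts (f i) (f j)"
      using that sqfree_family_prodD(2)[of f i j] by (auto simp: sqfree_families_def families_closed)
    moreover have "lin x \<noteq> \<one>" using prime_ne_one prime_lin x by blast
    ultimately show ?thesis using lin_closed[OF x(1)] by (auto simp: coprime_elts_def)
  qed
  then have disj: "?Z i \<inter> ?Z j = {}" if "i \<noteq> j" for i j using that by blast
  have "{f. f \<in> sqfree_families n \<and> nonvanishing U f} = ?N \<union> (\<Union>i. ?Z i)" unfolding N by blast
  then have "weighted_sum U T n \<phi> = sum (weight T \<phi>) (?N \<union> (\<Union>i. ?Z i))" by (simp only: weighted_sum_def)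
  also have "\<dots> = sum (weight T \<phi>) ?N + sum (weight T \<phi>) (\<Union>i. ?Z i)"
    by (rule sum.union_disjoint) (use fin N in auto)
  also have "sum (weight T \<phi>) (\<Union>i. ?Z i) = (\<Sum>i\<in>UNIV. sum (weight T \<phi>) (?Z i))"
    by (rule sum.UNION_disjoint) (use fin disj in auto)
  also have "\<dots> = (\<Sum>i\<in>UNIV. weighted_sum (insert x U) T (n(i := n i - 1)) (shift_weight i x \<phi>))"
  proof (rule sum.cong[OF refl])
    fix i
    have "sum (weight T \<phi>) (?Z i) = (\<Sum>g | g \<in> sqfree_families (n(i := n i - 1)) \<and> nonvanishing (insert x U) g.
        weight T \<phi> (scale_at i (lin x) g))"
      by (rule sum.reindex_bij_betw[OF bij_betw_scale_at_lin[OF x U], symmetric])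
    also have "\<dots> = weighted_sum (insert x U) T (n(i := n i - 1)) (shift_weight i x \<phi>)"
      unfolding weighted_sum_def using x T
      by (intro sum.cong refl weight_scale_at_lin) (auto simp: sqfree_families_def dest: families_closed)
    finally show "sum (weight T \<phi>) (?Z i) = weighted_sum (insert x U) T (n(i := n i - 1)) (shift_weight i x \<phi>)" .
  qed
  finally show ?thesis by (simp only: weighted_sum_def)
qed

lemma shift_weight_at_point: "x \<in> points \<Longrightarrow> shift_weight i x \<phi> x = (\<lambda>a. \<phi> x (a(i := 0)))"
  using chi_eq_0_iff[of "lin x" x] lin_closed[of x] by (simp add: shift_weight_def fun_eq_iff)

lemma mean_shift_weight:
  assumes "x \<in> points" "y \<in> points" "y \<noteq> x"
  shows "sign_mean (shift_weight i x \<phi> y) = sign_mean (\<phi> y)"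
    "local_mean q (shift_weight i x \<phi> y) = local_mean q (\<phi> y)"
proof -
  define \<sigma> where "\<sigma> = (\<lambda>l. if l = i then chi (lin x) y else 1)"
  have "chi (lin x) y \<in> {1, -1}"
    using chi_values[OF lin_closed] chi_lin[of x y] assms by auto
  then have "\<sigma> \<in> sign_vectors" by (simp add: \<sigma>_def sign_vectors_def)
  moreover have "a(i := chi (lin x) y * a i) = (\<lambda>l. \<sigma> l * a l)" for a by (auto simp: \<sigma>_def)
  then have "shift_weight i x \<phi> y = (\<lambda>a. \<phi> y (\<lambda>l. \<sigma> l * a l))"
    by (intro ext) (simp only: shift_weight_def)
  ultimately show "sign_mean (shift_weight i x \<phi> y) = sign_mean (\<phi> y)"
    "local_mean q (shift_weight i x \<phi> y) = local_mean q (\<phi> y)"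
    by (simp_all only: sign_mean_twist local_mean_twist)
qed

lemma bounded_weight_shift:
  fixes \<phi> :: "'x \<Rightarrow> ('i \<Rightarrow> real) \<Rightarrow> real"
  assumes "x \<in> points" "y \<in> points" "bounded_weight (\<phi> y)"
  shows "bounded_weight (shift_weight i x \<phi> y)"
  unfolding bounded_weight_def shift_weight_def
proof (intro allI impI bounded_weightD[OF assms(3)])
  fix a :: "'i \<Rightarrow> real" and l assume a: "\<forall>i. a i \<in> {-1, 0, 1}"
  have "chi (lin x) y \<in> {-1, 0, 1}" using chi_values[OF lin_closed] assms by blast
  moreover have "a i \<in> {-1, 0, 1}" "a l \<in> {-1, 0, 1}" using a by blast+
  ultimately show "(a(i := chi (lin x) y * a i)) l \<in> {-1, 0, 1}" by auto
qed

lemma sum_decrease_at: "sum (n(i := n i - 1)) UNIV = sum n UNIV - (1 :: int)"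
  for i :: "'i::finite"
proof -
  have "sum (n(i := n i - 1)) UNIV = (\<Sum>l\<in>UNIV. n l - of_bool (l = i))"
    by (rule sum.cong) auto
  then show ?thesis by (simp add: sum_subtractf)
qed

text \<open>Lowering a degree by one costs a factor \<open>1 / q\<close>, which makes up for the weaker error term.\<close>

lemma estimate_with_lowered_degrees:
  fixes W :: real and w \<mu> :: "'i::finite \<Rightarrow> real"
  assumes "\<bar>W / real q powi N - M\<bar> \<le> e" and "\<And>i. \<bar>w i / real q powi (N - 1) - \<mu> i\<bar> \<le> e'"
    and "e' / real q \<le> e"
  shows "\<bar>(W + (\<Sum>i\<in>UNIV. w i)) / real q powi N - (M + (\<Sum>i\<in>UNIV. \<mu> i) / real q)\<bar>
    \<le> (1 + real CARD('i)) * e"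
proof -
  have q: "real q > 0" using q_ge_2 by simp
  have "\<bar>w i / real q powi N - \<mu> i / real q\<bar> \<le> e" for i
  proof -
    have "w i / real q powi N - \<mu> i / real q = (w i / real q powi (N - 1) - \<mu> i) / real q"
      using q by (simp add: power_int_diff field_simps)
    also have "\<bar>\<dots>\<bar> \<le> e' / real q" using assms(2)[of i] q by (simp add: abs_divide divide_right_mono)
    finally show ?thesis using assms(3) by linarith
  qed
  then have "\<bar>\<Sum>i\<in>UNIV. w i / real q powi N - \<mu> i / real q\<bar> \<le> (\<Sum>i\<in>(UNIV :: 'i set). e)"
    by (intro order_trans[OF sum_abs] sum_mono)
  moreover have "(W + (\<Sum>i\<in>UNIV. w i)) / real q powi N - (M + (\<Sum>i\<in>UNIV. \<mu> i) / real q)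
      = (W / real q powi N - M) + (\<Sum>i\<in>UNIV. w i / real q powi N - \<mu> i / real q)"
    by (simp add: add_divide_distrib sum_subtractf sum_divide_distrib)
  ultimately show ?thesis using assms(1) by (simp add: distrib_right)
qed

lemma prod_mean_shift_weight:
  assumes "x \<in> points" "S \<subseteq> points" "x \<notin> S"
  shows "(\<Prod>y\<in>S. sign_mean (shift_weight i x \<phi> y)) = (\<Prod>y\<in>S. sign_mean (\<phi> y))"
    "(\<Prod>y\<in>S. local_mean q (shift_weight i x \<phi> y)) = (\<Prod>y\<in>S. local_mean q (\<phi> y))"
  using assms by (auto intro!: prod.cong mean_shift_weight)

lemma weighted_sum_estimate_step:
  fixes n :: "'i::finite \<Rightarrow> int"
  assumes x: "x \<in> points" "x \<notin> U" and U: "U \<subseteq> points" and T: "T \<subseteq> points"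
    and main: "\<bar>weighted_sum (insert x U) T n \<phi> / real q powi sum n UNIV - M * sign_mean (\<phi> x)\<bar> \<le> e"
    and lowered: "\<And>i. \<bar>weighted_sum (insert x U) T (n(i := n i - 1)) (shift_weight i x \<phi>)
      / real q powi (sum n UNIV - 1) - M * sign_mean (\<lambda>a. \<phi> x (a(i := 0)))\<bar> \<le> e'"
    and "e' / real q \<le> e"
  shows "\<bar>weighted_sum U T n \<phi> / real q powi sum n UNIV
    - M * (1 + real CARD('i) / real q) * local_mean q (\<phi> x)\<bar> \<le> (1 + real CARD('i)) * e"
proof -
  have "M * sign_mean (\<phi> x) + (\<Sum>i\<in>UNIV. M * sign_mean (\<lambda>a. \<phi> x (a(i := 0)))) / real q
      = M * (sign_mean (\<phi> x) + (\<Sum>i\<in>UNIV. sign_mean (\<lambda>a. \<phi> x (a(i := 0)))) / real q)"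
    by (simp add: algebra_simps sum_distrib_left)
  then have main_term: "M * sign_mean (\<phi> x) + (\<Sum>i\<in>UNIV. M * sign_mean (\<lambda>a. \<phi> x (a(i := 0)))) / real q
      = M * (1 + real CARD('i) / real q) * local_mean q (\<phi> x)"
    by (simp only: local_mean_mult_norm[symmetric] mult.assoc)
  show ?thesis
    using estimate_with_lowered_degrees[where \<mu> = "\<lambda>i. M * sign_mean (\<lambda>a. \<phi> x (a(i := 0)))",
        OF main lowered \<open>e' / real q \<le> e\<close>]
    unfolding weighted_sum_split[OF x U T] main_term .
qed

lemma weighted_sum_estimate_partial:
  fixes n :: "'i::finite \<Rightarrow> int" and T :: "'x set"
  defines "mass \<equiv> 1 + real CARD('i) / real q"
  assumes eps: "0 < \<epsilon>" "\<epsilon> < 1" and T: "T \<subseteq> points" and V: "finite V" "V \<subseteq> T"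
    and \<phi>: "\<And>x. x \<in> T \<Longrightarrow> bounded_weight (\<phi> x)" and n: "\<And>i. m + int (card T) \<le> n i"
  shows "\<bar>weighted_sum (T - V) T n \<phi> / real q powi sum n UNIV - sieve_density TYPE('i) T * mass ^ card V
      * ((\<Prod>x\<in>T - V. sign_mean (\<phi> x)) * (\<Prod>x\<in>V. local_mean q (\<phi> x)))\<bar>
    \<le> (1 + real CARD('i)) ^ card V * error_bound CARD('i \<times> 'i) \<epsilon> m"
  using V \<phi> n
proof (induction V arbitrary: n m \<phi> rule: finite_induct)
  case empty
  then show ?case using weighted_sum_estimate_nonvanishing[OF eps T, of \<phi> m n] by simp
next
  case (insert x V)
  let ?d = "CARD('i \<times> 'i)" and ?r = "real CARD('i)"
  define D where "D = sieve_density TYPE('i) T * mass ^ card V"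
  define P where "P = (\<Prod>y\<in>T - insert x V. sign_mean (\<phi> y)) * (\<Prod>y\<in>V. local_mean q (\<phi> y))"
  define e where "e = (1 + ?r) ^ card V * error_bound ?d \<epsilon> m"
  define e' where "e' = (1 + ?r) ^ card V * error_bound ?d \<epsilon> (m - 1)"
  have x: "x \<in> points" "x \<notin> T - insert x V" "T - insert x V \<subseteq> points" and V: "V \<subseteq> T"
    and TV: "insert x (T - insert x V) = T - V"
    using insert T by auto
  have fin: "finite (T - insert x V)" using T finite_points finite_subset by blast
  have split: "(\<Prod>y\<in>T - V. F y) = F x * (\<Prod>y\<in>T - insert x V. F y)" for F :: "'x \<Rightarrow> real"
    unfolding TV[symmetric] using fin by simp
  have main: "\<bar>weighted_sum (T - V) T n \<phi> / real q powi sum n UNIV - D * P * sign_mean (\<phi> x)\<bar> \<le> e"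
    using insert.IH[of \<phi> m n, OF V insert.prems(2,3)] by (simp add: D_def P_def e_def split mult_ac)
  have lowered: "\<bar>weighted_sum (T - V) T (n(i := n i - 1)) (shift_weight i x \<phi>) / real q powi (sum n UNIV - 1)
      - D * P * sign_mean (\<lambda>a. \<phi> x (a(i := 0)))\<bar> \<le> e'" for i
  proof -
    have "(\<Prod>y\<in>T - insert x V. sign_mean (shift_weight i x \<phi> y)) = (\<Prod>y\<in>T - insert x V. sign_mean (\<phi> y))"
      "(\<Prod>y\<in>V. local_mean q (shift_weight i x \<phi> y)) = (\<Prod>y\<in>V. local_mean q (\<phi> y))"
      by (rule prod_mean_shift_weight; use x insert.hyps V T in auto)+
    moreover have "sign_mean (shift_weight i x \<phi> x) = sign_mean (\<lambda>a. \<phi> x (a(i := 0)))"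
      by (simp add: shift_weight_at_point[OF x(1)])
    moreover have "m - 1 + int (card T) \<le> (n(i := n i - 1)) l" for l using insert.prems(3)[of l] by auto
    moreover have "bounded_weight (shift_weight i x \<phi> y)" if "y \<in> T" for y
      using that T x(1) insert.prems(2) by (intro bounded_weight_shift) auto
    ultimately show ?thesis
      using insert.IH[OF V, of "shift_weight i x \<phi>" "m - 1" "n(i := n i - 1)"]
      by (simp add: D_def P_def e'_def split mult_ac sum_decrease_at del: fun_upd_apply)
  qed
  have "e' / real q \<le> e"
    using mult_left_mono[OF error_bound_pred[OF eps, of ?d m], of "(1 + ?r) ^ card V"]
    by (simp add: e_def e'_def)
  from weighted_sum_estimate_step[OF x T main[folded TV] lowered[folded TV] this, folded mass_def] show ?case
    using insert.hyps by (simp add: D_def P_def e_def mult_ac)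
qed

lemma weighted_sum_estimate:
  fixes n :: "'i::finite \<Rightarrow> int"
  assumes "0 < \<epsilon>" "\<epsilon> < 1" and T: "T \<subseteq> points"
    and "\<And>x. x \<in> T \<Longrightarrow> bounded_weight (\<phi> x)" and "\<And>i. m + int (card T) \<le> n i"
  shows "\<bar>weighted_sum {} T n \<phi> / real q powi sum n UNIV - sieve_density TYPE('i) T
      * (1 + real CARD('i) / real q) ^ card T * (\<Prod>x\<in>T. local_mean q (\<phi> x))\<bar>
    \<le> (1 + real CARD('i)) ^ card T * error_bound CARD('i \<times> 'i) \<epsilon> m"
  using weighted_sum_estimate_partial[OF assms(1,2) T finite_subset[OF T finite_points] order_refl assms(4,5)]
  by simp

section \<open>The projective line\<close>

definition sign_twist ::
    "('i \<Rightarrow> real) \<Rightarrow> ('x \<Rightarrow> ('i \<Rightarrow> real) \<Rightarrow> real) \<Rightarrow> 'x \<Rightarrow> ('i \<Rightarrow> real) \<Rightarrow> real" where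
  "sign_twist \<sigma> \<phi> x a = \<phi> x (\<lambda>i. \<sigma> i * a i)"

text \<open>
  The signs \<open>\<sigma>\<close> are the characters of the leading coefficients and \<open>\<psi>\<close> is the weight at infinity,
  where a member of lowered degree behaves as if it vanished.
\<close>

definition projective_sum :: "'x set \<Rightarrow> ('i::finite \<Rightarrow> int) \<Rightarrow> ('x \<Rightarrow> ('i \<Rightarrow> real) \<Rightarrow> real)
    \<Rightarrow> (('i \<Rightarrow> real) \<Rightarrow> real) \<Rightarrow> ('i \<Rightarrow> real) \<Rightarrow> real" where
  "projective_sum T n \<phi> \<psi> \<sigma> = \<psi> \<sigma> * weighted_sum {} T n (sign_twist \<sigma> \<phi>)
    + (\<Sum>i\<in>UNIV. \<psi> (\<sigma>(i := 0)) * weighted_sum {} T (n(i := n i - 1)) (sign_twist \<sigma> \<phi>))"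

definition projective_count :: "('i::finite \<Rightarrow> int) \<Rightarrow> real" where
  "projective_count n = real (card (sqfree_families n))
    + (\<Sum>i\<in>UNIV. real (card (sqfree_families (n(i := n i - 1)))))"

lemma bounded_weight_sign_twist:
  fixes \<phi> :: "'x \<Rightarrow> ('i \<Rightarrow> real) \<Rightarrow> real"
  assumes "\<sigma> \<in> sign_vectors" "bounded_weight (\<phi> x)"
  shows "bounded_weight (sign_twist \<sigma> \<phi> x)"
  unfolding bounded_weight_def sign_twist_def
proof (intro allI impI bounded_weightD[OF assms(2)])
  fix a :: "'i \<Rightarrow> real" and i assume "\<forall>i. a i \<in> {-1, 0, 1}"
  then have "a i \<in> {-1, 0, 1}" by blast
  then show "\<sigma> i * a i \<in> {-1, 0, 1}" using sign_vectorsD[OF assms(1), of i] by auto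
qed

lemma local_mean_sign_twist: "\<sigma> \<in> sign_vectors \<Longrightarrow> local_mean q (sign_twist \<sigma> \<phi> x) = local_mean q (\<phi> x)"
  unfolding sign_twist_def by (rule local_mean_twist)

lemma abs_mult_diff_le: "\<lbrakk>\<bar>c\<bar> \<le> 1; \<bar>a - b\<bar> \<le> e\<rbrakk> \<Longrightarrow> \<bar>c * a - c * b\<bar> \<le> e" for a b c e :: real
  using mult_mono[of "\<bar>c\<bar>" 1 "\<bar>a - b\<bar>" e] by (simp add: abs_mult flip: right_diff_distrib)

lemma sign_twisted_weighted_sum_estimate:
  fixes n :: "'i::finite \<Rightarrow> int"
  assumes eps: "0 < \<epsilon>" "\<epsilon> < 1" and T: "T \<subseteq> points" and \<phi>: "\<And>x. x \<in> T \<Longrightarrow> bounded_weight (\<phi> x)"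
    and \<sigma>: "\<sigma> \<in> sign_vectors" and n: "\<And>i. m + int (card T) \<le> n i"
  shows "\<bar>weighted_sum {} T n (sign_twist \<sigma> \<phi>) / real q powi sum n UNIV - sieve_density TYPE('i) T
      * (1 + real CARD('i) / real q) ^ card T * (\<Prod>x\<in>T. local_mean q (\<phi> x))\<bar>
    \<le> (1 + real CARD('i)) ^ card T * error_bound CARD('i \<times> 'i) \<epsilon> m"
proof -
  have "bounded_weight (sign_twist \<sigma> \<phi> x)" if "x \<in> T" for x
    by (rule bounded_weight_sign_twist) (rule \<sigma>, rule \<phi>[OF that])
  from weighted_sum_estimate[of \<epsilon> T "sign_twist \<sigma> \<phi>" m n, OF eps T this n] show ?thesis
    by (simp add: local_mean_sign_twist[OF \<sigma>])
qed

lemma projective_sum_estimate: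
  fixes n :: "'i::finite \<Rightarrow> int"
  assumes eps: "0 < \<epsilon>" "\<epsilon> < 1" and T: "T \<subseteq> points" and \<phi>: "\<And>x. x \<in> T \<Longrightarrow> bounded_weight (\<phi> x)"
    and \<psi>: "bounded_weight \<psi>" and \<sigma>: "\<sigma> \<in> sign_vectors" and n: "\<And>i. m + int (card T) \<le> n i"
  shows "\<bar>projective_sum T n \<phi> \<psi> \<sigma> / real q powi sum n UNIV - sieve_density TYPE('i) T
      * (1 + real CARD('i) / real q) ^ card T * (\<Prod>x\<in>T. local_mean q (\<phi> x))
      * (\<psi> \<sigma> + (\<Sum>i\<in>UNIV. \<psi> (\<sigma>(i := 0))) / real q)\<bar>
    \<le> (1 + real CARD('i)) ^ (card T + 1) * error_bound CARD('i \<times> 'i) \<epsilon> m"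
proof -
  let ?d = "CARD('i \<times> 'i)" and ?r = "real CARD('i)"
  define M where "M = sieve_density TYPE('i) T * (1 + ?r / real q) ^ card T * (\<Prod>x\<in>T. local_mean q (\<phi> x))"
  define e where "e m = (1 + ?r) ^ card T * error_bound ?d \<epsilon> m" for m
  have estimate: "\<bar>weighted_sum {} T n' (sign_twist \<sigma> \<phi>) / real q powi sum n' UNIV - M\<bar> \<le> e m'"
    if "\<And>i. m' + int (card T) \<le> n' i" for n' m'
    unfolding M_def e_def
    by (rule sign_twisted_weighted_sum_estimate[of \<epsilon> T \<phi> \<sigma> m' n', OF eps T \<phi> \<sigma> that])
  have "\<bar>\<psi> \<sigma>\<bar> \<le> 1"
    by (rule bounded_weightD[OF \<psi>]) (use sign_vectorsD[OF \<sigma>] in auto)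
  from abs_mult_diff_le[OF this estimate[OF n]]
  have main: "\<bar>\<psi> \<sigma> * weighted_sum {} T n (sign_twist \<sigma> \<phi>) / real q powi sum n UNIV - \<psi> \<sigma> * M\<bar> \<le> e m"
    by simp
  have lowered: "\<bar>\<psi> (\<sigma>(i := 0)) * weighted_sum {} T (n(i := n i - 1)) (sign_twist \<sigma> \<phi>)
      / real q powi (sum n UNIV - 1) - \<psi> (\<sigma>(i := 0)) * M\<bar> \<le> e (m - 1)" for i
  proof -
    have "m - 1 + int (card T) \<le> (n(i := n i - 1)) l" for l using n[of l] by auto
    from estimate[of "m - 1" "n(i := n i - 1)", OF this]
    have "\<bar>weighted_sum {} T (n(i := n i - 1)) (sign_twist \<sigma> \<phi>) / real q powi (sum n UNIV - 1) - M\<bar> \<le> e (m - 1)"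
      by (simp only: sum_decrease_at)
    moreover have "\<bar>\<psi> (\<sigma>(i := 0))\<bar> \<le> 1"
      by (rule bounded_weightD[OF \<psi>]) (use sign_vectorsD[OF \<sigma>] in auto)
    ultimately show ?thesis using abs_mult_diff_le by fastforce
  qed
  have "e (m - 1) / real q \<le> e m"
    using mult_left_mono[OF error_bound_pred[OF eps, of ?d m], of "(1 + ?r) ^ card T"]
    by (simp add: e_def)
  from estimate_with_lowered_degrees[where \<mu> = "\<lambda>i. \<psi> (\<sigma>(i := 0)) * M", OF main lowered this]
  have "\<bar>projective_sum T n \<phi> \<psi> \<sigma> / real q powi sum n UNIV
      - (\<psi> \<sigma> * M + (\<Sum>i\<in>UNIV. \<psi> (\<sigma>(i := 0)) * M) / real q)\<bar> \<le> (1 + ?r) * e m"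
    unfolding projective_sum_def .
  moreover have "\<psi> \<sigma> * M + (\<Sum>i\<in>UNIV. \<psi> (\<sigma>(i := 0)) * M) / real q
      = M * (\<psi> \<sigma> + (\<Sum>i\<in>UNIV. \<psi> (\<sigma>(i := 0))) / real q)"
    by (simp add: algebra_simps flip: sum_distrib_left)
  ultimately show ?thesis by (simp add: M_def e_def)
qed

lemma mean_projective_sum_estimate:
  fixes n :: "'i::finite \<Rightarrow> int"
  assumes eps: "0 < \<epsilon>" "\<epsilon> < 1" and T: "T \<subseteq> points" and \<phi>: "\<And>x. x \<in> T \<Longrightarrow> bounded_weight (\<phi> x)"
    and \<psi>: "bounded_weight \<psi>" and n: "\<And>i. m + int (card T) \<le> n i"
  shows "\<bar>sign_mean (projective_sum T n \<phi> \<psi>) / real q powi sum n UNIV - sieve_density TYPE('i) T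
      * (1 + real CARD('i) / real q) ^ (card T + 1) * ((\<Prod>x\<in>T. local_mean q (\<phi> x)) * local_mean q \<psi>)\<bar>
    \<le> (1 + real CARD('i)) ^ (card T + 1) * error_bound CARD('i \<times> 'i) \<epsilon> m"
proof -
  define M where "M = sieve_density TYPE('i) T * (1 + real CARD('i) / real q) ^ card T
    * (\<Prod>x\<in>T. local_mean q (\<phi> x))"
  have "\<bar>sign_mean (\<lambda>\<sigma>. projective_sum T n \<phi> \<psi> \<sigma> / real q powi sum n UNIV
      - M * (\<psi> \<sigma> + (\<Sum>i\<in>UNIV. \<psi> (\<sigma>(i := 0))) / real q))\<bar>
    \<le> (1 + real CARD('i)) ^ (card T + 1) * error_bound CARD('i \<times> 'i) \<epsilon> m"
    unfolding M_def by (rule abs_sign_mean_le) (rule projective_sum_estimate[OF eps T \<phi> \<psi> _ n])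
  moreover have "sign_mean (\<lambda>\<sigma>. \<psi> \<sigma> + (\<Sum>i\<in>UNIV. \<psi> (\<sigma>(i := 0))) / real q)
      = (1 + real CARD('i) / real q) * local_mean q \<psi>"
    by (simp add: local_mean_mult_norm sign_mean_add sign_mean_divide sign_mean_sum)
  ultimately show ?thesis
    by (simp add: sign_mean_diff sign_mean_divide sign_mean_mult_left M_def mult_ac)
qed

lemma projective_sum_one: "projective_sum T n (\<lambda>_ _. 1) (\<lambda>_. 1) = (\<lambda>_. projective_count n)"
  by (simp add: projective_sum_def projective_count_def weighted_sum_def weight_def nonvanishing_def
      sign_twist_def fun_eq_iff)

lemma abs_weighted_sum_le:
  assumes "T \<subseteq> points" "\<And>x. x \<in> T \<Longrightarrow> bounded_weight (\<phi> x)"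
  shows "\<bar>weighted_sum {} T n \<phi>\<bar> \<le> real (card (sqfree_families n))"
proof -
  have "\<bar>weighted_sum {} T n \<phi>\<bar> \<le> (\<Sum>f\<in>sqfree_families n. \<bar>weight T \<phi> f\<bar>)"
    by (simp add: weighted_sum_def nonvanishing_def sum_abs)
  also have "\<dots> \<le> (\<Sum>f\<in>sqfree_families n. 1)"
    by (intro sum_mono abs_weight_le_one assms) (auto simp: sqfree_families_def dest: families_closed)
  finally show ?thesis by simp
qed

lemma abs_projective_sum_le:
  fixes n :: "'i::finite \<Rightarrow> int"
  assumes T: "T \<subseteq> points" and \<phi>: "\<And>x. x \<in> T \<Longrightarrow> bounded_weight (\<phi> x)"
    and \<psi>: "bounded_weight \<psi>" and \<sigma>: "\<sigma> \<in> sign_vectors"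
  shows "\<bar>projective_sum T n \<phi> \<psi> \<sigma>\<bar> \<le> projective_count n"
proof -
  have weighted: "\<bar>c * weighted_sum {} T n' (sign_twist \<sigma> \<phi>)\<bar> \<le> real (card (sqfree_families n'))"
    if "\<bar>c\<bar> \<le> 1" for c n'
  proof -
    have "\<bar>weighted_sum {} T n' (sign_twist \<sigma> \<phi>)\<bar> \<le> real (card (sqfree_families n'))"
      by (intro abs_weighted_sum_le T bounded_weight_sign_twist \<sigma> \<phi>)
    then show ?thesis using mult_mono[OF that, of _ "real (card (sqfree_families n'))"]
      by (simp add: abs_mult)
  qed
  have "\<bar>\<psi> \<sigma>\<bar> \<le> 1" "\<bar>\<psi> (\<sigma>(i := 0))\<bar> \<le> 1" for i
    by (rule bounded_weightD[OF \<psi>]; use sign_vectorsD[OF \<sigma>] in auto)+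
  then show ?thesis
    unfolding projective_sum_def projective_count_def
    by (intro order_trans[OF abs_triangle_ineq] add_mono order_trans[OF sum_abs] sum_mono weighted)
qed

lemma projective_count_ge:
  fixes n :: "'i::finite \<Rightarrow> int"
  assumes eps: "0 < \<epsilon>" "\<epsilon> < 1" and n: "\<And>i. m \<le> n i"
    and small: "2 * tail_sum CARD('i \<times> 'i) \<epsilon> * error_bound CARD('i \<times> 'i) \<epsilon> m \<le> 1"
  shows "real q powi sum n UNIV / (2 * tail_sum CARD('i \<times> 'i) \<epsilon>) \<le> projective_count n"
proof -
  let ?K = "tail_sum CARD('i \<times> 'i) \<epsilon>" and ?e = "error_bound CARD('i \<times> 'i) \<epsilon> m"
  have q: "real q powi sum n UNIV > 0" using q_ge_2 by simp
  have K: "?K \<ge> 1" by (rule tail_sum_ge_1[OF eps(1)])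
  have "1 / ?K - ?e \<le> real (card (sqfree_families n)) / real q powi sum n UNIV"
    using card_sqfree_families_estimate[of \<epsilon> m n, OF eps n] sieve_density_empty_ge[OF eps, where ?'i = 'i]
    by linarith
  moreover have "?e \<le> 1 / (2 * ?K)" using small K by (simp add: pos_le_divide_eq mult_ac)
  moreover have "1 / ?K - 1 / (2 * ?K) = 1 / (2 * ?K)" using K by (simp add: field_simps)
  ultimately have "1 / (2 * ?K) \<le> real (card (sqfree_families n)) / real q powi sum n UNIV" by linarith
  then have "real q powi sum n UNIV / (2 * ?K) \<le> real (card (sqfree_families n))"
    using q by (simp add: pos_le_divide_eq)
  also have "\<dots> \<le> projective_count n" by (simp add: projective_count_def sum_nonneg)
  finally show ?thesis .
qed

lemma ratio_estimate:
  fixes A B Q D \<mu> K e :: real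
  assumes "\<bar>A / Q - D * \<mu>\<bar> \<le> e" "\<bar>B / Q - D\<bar> \<le> e" and \<mu>: "\<bar>\<mu>\<bar> \<le> 1"
    and "Q > 0" "K > 0" "Q / (2 * K) \<le> B"
  shows "\<bar>A / B - \<mu>\<bar> \<le> 4 * K * e"
proof -
  have "0 \<le> e" using assms(1) by linarith
  have "0 < Q / (2 * K)" using assms by simp
  then have B: "B > 0" using assms by linarith
  have "A / Q - \<mu> * (B / Q) = (A / Q - D * \<mu>) - (\<mu> * (B / Q) - \<mu> * D)" by simp
  then have diff: "\<bar>A / Q - \<mu> * (B / Q)\<bar> \<le> 2 * e"
    using assms(1) abs_mult_diff_le[OF \<mu> assms(2)] by linarith
  have "A / B - \<mu> = (A / Q - \<mu> * (B / Q)) * (Q / B)" using B assms by (simp add: field_simps)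
  then have "\<bar>A / B - \<mu>\<bar> = \<bar>A / Q - \<mu> * (B / Q)\<bar> * (Q / B)" using B assms by (simp add: abs_mult)
  also have "\<dots> \<le> (2 * e) * (2 * K)"
    using diff B assms \<open>0 \<le> e\<close> by (intro mult_mono) (simp_all add: field_simps)
  finally show ?thesis by (simp add: mult_ac)
qed

lemma projective_mean_estimate:
  fixes n :: "'i::finite \<Rightarrow> int"
  assumes eps: "0 < \<epsilon>" "\<epsilon> < 1" and T: "T \<subseteq> points" and \<phi>: "\<And>x. x \<in> T \<Longrightarrow> bounded_weight (\<phi> x)"
    and \<psi>: "bounded_weight \<psi>" and n: "\<And>i. m \<le> n i"
  shows "\<bar>sign_mean (projective_sum T n \<phi> \<psi>) / projective_count n
      - (\<Prod>x\<in>T. local_mean q (\<phi> x)) * local_mean q \<psi>\<bar>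
    \<le> 4 * tail_sum CARD('i \<times> 'i) \<epsilon> * ((1 + real CARD('i)) ^ (card T + 1)
      * error_bound CARD('i \<times> 'i) \<epsilon> (m - int (card T)))"
    (is "\<bar>?A / ?B - ?\<mu>\<bar> \<le> 4 * ?K * ?e")
proof -
  let ?error = "error_bound CARD('i \<times> 'i) \<epsilon>"
  have K: "?K \<ge> 1" by (rule tail_sum_ge_1[OF eps(1)])
  have "\<bar>\<Prod>x\<in>T. local_mean q (\<phi> x)\<bar> \<le> 1"
    unfolding abs_prod using abs_local_mean_le_one[OF \<phi>] by (intro prod_le_1) auto
  then have \<mu>: "\<bar>?\<mu>\<bar> \<le> 1"
    unfolding abs_mult using abs_local_mean_le_one[OF \<psi>] by (intro mult_le_one) auto
  consider (small) "2 * ?K * ?error m \<le> 1" | (large) "1 < 2 * ?K * ?error m" by linarith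
  then show ?thesis
  proof cases
    case small
    have one: "bounded_weight (\<lambda>_ :: 'i \<Rightarrow> real. 1)" by (simp add: bounded_weight_def)
    have n': "m - int (card T) + int (card T) \<le> n i" for i using n[of i] by simp
    have "\<bar>?B / real q powi sum n UNIV
        - sieve_density TYPE('i) T * (1 + real CARD('i) / real q) ^ (card T + 1)\<bar> \<le> ?e"
      using mean_projective_sum_estimate[OF eps T one one n']
      by (simp add: projective_sum_one sign_mean_const local_mean_one)
    moreover have "real q powi sum n UNIV > 0" using q_ge_2 by simp
    ultimately show ?thesis
      using ratio_estimate[OF mean_projective_sum_estimate[OF eps T \<phi> \<psi> n'] _ \<mu> _ _ projective_count_ge[OF eps n small]]
        K by simp
  next
    case large
    have "?B \<ge> 0" by (simp add: projective_count_def sum_nonneg)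
    moreover have "\<bar>?A\<bar> \<le> ?B" by (rule abs_sign_mean_le) (rule abs_projective_sum_le[OF T \<phi> \<psi>])
    ultimately have "\<bar>?A / ?B\<bar> \<le> 1" by (cases "?B = 0") (simp_all add: abs_divide divide_le_eq)
    then have "\<bar>?A / ?B - ?\<mu>\<bar> \<le> 2" using \<mu> by linarith
    also have "2 \<le> 4 * ?K * ?error m" using large by simp
    also have "\<dots> \<le> 4 * ?K * (1 * ?error (m - int (card T)))"
      using K error_bound_antimono[OF eps, of "m - int (card T)" m] by (intro mult_left_mono) auto
    also have "\<dots> \<le> 4 * ?K * ?e"
      using K error_bound_nonneg[OF eps(1)]
      by (intro mult_left_mono mult_right_mono one_le_power) auto
    finally show ?thesis .
  qed
qed

end

section \<open>The quadratic character\<close>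

locale finite_odd_field = field R for R :: "'a ring" (structure) +
  assumes finite_carrier: "finite (carrier R)" and odd_card: "odd (card (carrier R))"
begin

abbreviation q :: nat where "q \<equiv> card (carrier R)"
abbreviation quad_char :: "'a \<Rightarrow> int" where "quad_char \<equiv> quadratic_char R"
abbreviation nonzero :: "'a set" where "nonzero \<equiv> carrier R - {\<zero>}"

lemma q_ge_3: "q \<ge> 3"
proof -
  have "card {\<zero>, \<one>} \<le> q" by (rule card_mono[OF finite_carrier]) auto
  then have "q \<ge> 2" using one_not_zero by simp
  then show ?thesis using odd_card by (cases "q = 2") auto
qed

lemma nonzero_inv: "a \<in> nonzero \<Longrightarrow> inv a \<in> nonzero \<and> inv a \<otimes> a = \<one> \<and> a \<otimes> inv a = \<one>"
  using field_Units Units_inv_Units by auto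

lemma quad_char_eq_0_iff: "quad_char a = 0 \<longleftrightarrow> a = \<zero>"
  by (simp add: quadratic_char_def)

lemma quad_char_values: "quad_char a \<in> {-1, 0, 1}"
  by (simp add: quadratic_char_def)

text \<open>On a generator of the cyclic group \<open>\<bbbF>\<^sub>q\<^sup>*\<close> of even order, the squares are the even powers.\<close>

lemma quad_char_generatorE:
  obtains g where "g \<in> nonzero" "\<And>a. a \<in> nonzero \<Longrightarrow> \<exists>i::nat. a = g [^] i"
    "\<And>i::nat. quad_char (g [^] i) = (-1) ^ i"
proof -
  obtain g where g: "g \<in> nonzero" "nonzero = {g [^] i | i::nat. i \<in> UNIV}"
    using finite_field_mult_group_has_gen[OF finite_carrier] by (auto simp: mult_of_simps)
  interpret units: group "Multiplicative_Group.mult_of R" by (rule field_mult_group)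
  have pow: "a [^]\<^bsub>Multiplicative_Group.mult_of R\<^esub> (i::nat) = a [^] i" for a i
    by (simp only: Multiplicative_Group.nat_pow_mult_of)
  have "generate (Multiplicative_Group.mult_of R) {g} = {g [^] i | i::nat. i \<in> UNIV}"
    using units.generate_pow_on_finite_carrier[of g] finite_carrier g(1) by (simp add: pow)
  also note g(2)[symmetric]
  finally have "generate (Multiplicative_Group.mult_of R) {g} = nonzero" .
  then have "units.ord g = q - 1"
    using units.generate_pow_card[of g] g(1) finite_carrier by simp
  then have even_ord: "even (units.ord g)" using odd_card by simp
  have "quad_char (g [^] i) = (-1) ^ i" for i :: nat
  proof -
    have nz: "g [^] i \<in> nonzero" using g by blast
    have "even i" if b: "b \<in> carrier R" "g [^] i = b \<otimes> b" for b
    proof -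
      have "b \<in> nonzero" using b nz by auto
      then obtain j :: nat where "b = g [^] j" using g(2) by blast
      then have "g [^] i = g [^] (j + j)" using b g(1) by (simp add: nat_pow_mult)
      then have "int (units.ord g) dvd int (j + j) - int i"
        using units.int_pow_eq[of g "int i" "int (j + j)"] g(1)
        by (simp add: int_pow_int pow del: of_nat_add)
      then have "even (int (j + j) - int i)" using even_ord by (meson dvd_trans even_of_nat)
      then show "even i" by simp
    qed
    moreover have "g [^] i = g [^] (i div 2) \<otimes> g [^] (i div 2)" if "even i"
      using that g(1) by (simp add: nat_pow_mult flip: mult_2)
    ultimately show ?thesis
      using nz g(1) by (cases "even i") (auto simp: quadratic_char_def)
  qed
  then show thesis using g by (intro that[of g]) auto
qed

lemma quad_char_mult:
  assumes "a \<in> carrier R" "b \<in> carrier R"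
  shows "quad_char (a \<otimes> b) = quad_char a * quad_char b"
proof (cases "a = \<zero> \<or> b = \<zero>")
  case True
  then show ?thesis using assms by (auto simp: quadratic_char_def)
next
  case False
  obtain g where g: "g \<in> nonzero" "\<And>a. a \<in> nonzero \<Longrightarrow> \<exists>i::nat. a = g [^] i"
    "\<And>i::nat. quad_char (g [^] i) = (-1) ^ i"
    by (rule quad_char_generatorE) blast
  obtain i j :: nat where ij: "a = g [^] i" "b = g [^] j" using g(2) False assms by blast
  then have "a \<otimes> b = g [^] (i + j)" using g(1) by (simp add: nat_pow_mult)
  then show ?thesis by (simp add: ij g(3) power_add)
qed

lemma card_quad_char:
  assumes s: "s \<in> {1, -1}"
  shows "2 * card {a \<in> carrier R. quad_char a = s} = q - 1"
proof -
  define A where "A s = {a \<in> carrier R. quad_char a = s}" for s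
  have fin: "finite (A s)" for s using finite_carrier by (simp add: A_def)
  obtain g where g: "g \<in> nonzero" and g_pow: "\<And>i::nat. quad_char (g [^] i) = (-1) ^ i"
    by (rule quad_char_generatorE) blast
  have quad_char_g: "quad_char g = -1" using g_pow[of 1] g by simp
  have "card (A s) \<le> card (A (- s))" for s
  proof (rule card_inj_on_le[OF _ _ fin])
    show "inj_on ((\<otimes>) g) (A s)"
      by (rule inj_onI) (use g in \<open>simp add: A_def m_lcancel\<close>)
    show "(\<otimes>) g ` A s \<subseteq> A (- s)"
      using g quad_char_g by (auto simp: A_def quad_char_mult)
  qed
  from this[of 1] this[of "-1"] have "card (A 1) = card (A (-1))" by simp
  moreover have "A 1 \<union> A (-1) = nonzero"
    by (auto simp: A_def quadratic_char_def)
  moreover have "A 1 \<inter> A (-1) = {}" by (auto simp: A_def)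
  ultimately have "2 * card (A 1) = q - 1 \<and> 2 * card (A (-1)) = q - 1"
    using card_Un_disjoint[OF fin[of 1] fin[of "-1"]] by simp
  then show ?thesis using s by (auto simp: A_def)
qed

section \<open>Monic polynomials\<close>

abbreviation P where "P \<equiv> poly_ring R"

sublocale UP: domain P
  by (rule univ_poly_is_domain[OF carrier_is_subring])

definition monic_polys :: "'a list set" where
  "monic_polys = {f \<in> carrier P. f \<noteq> [] \<and> lead_coeff f = \<one>}"

definition monic_monoid :: "'a list monoid" where
  "monic_monoid = \<lparr>carrier = monic_polys, mult = mult P, one = one P\<rparr>"

abbreviation monic_polys_of_degree :: "nat \<Rightarrow> 'a list set" where
  "monic_polys_of_degree n \<equiv> {f \<in> monic_polys. degree f = n}"

lemma carrier_monic_monoid: "carrier monic_monoid = monic_polys"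
  and mult_monic_monoid: "mult monic_monoid = mult P"
  and one_monic_monoid: "one monic_monoid = one P"
  by (simp_all add: monic_monoid_def)

lemma carrier_P: "f \<in> carrier P \<longleftrightarrow> f = [] \<or> set f \<subseteq> carrier R \<and> lead_coeff f \<noteq> \<zero>"
  unfolding univ_poly_carrier[symmetric] polynomial_def ..

lemma monic_polys_closed: "f \<in> monic_polys \<Longrightarrow> f \<in> carrier P"
  and monic_polys_nonempty: "f \<in> monic_polys \<Longrightarrow> f \<noteq> []"
  by (auto simp: monic_polys_def)

lemma lead_coeff_closed: "\<lbrakk>f \<in> carrier P; f \<noteq> []\<rbrakk> \<Longrightarrow> lead_coeff f \<in> nonzero"
  by (auto simp: carrier_P)

lemma
  assumes "f \<in> carrier P" "g \<in> carrier P" "f \<noteq> []" "g \<noteq> []"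
  shows mult_nonempty: "f \<otimes>\<^bsub>P\<^esub> g \<noteq> []"
    and degree_mult: "degree (f \<otimes>\<^bsub>P\<^esub> g) = degree f + degree g"
    and lead_coeff_mult: "lead_coeff (f \<otimes>\<^bsub>P\<^esub> g) = lead_coeff f \<otimes> lead_coeff g"
proof -
  show "f \<otimes>\<^bsub>P\<^esub> g \<noteq> []" using UP.integral[OF _ assms(1,2)] assms by (auto simp: univ_poly_zero)
  show "degree (f \<otimes>\<^bsub>P\<^esub> g) = degree f + degree g"
    using poly_mult_degree_eq[OF carrier_is_subring, of f g] assms
    by (simp add: univ_poly_mult univ_poly_carrier)
  show "lead_coeff (f \<otimes>\<^bsub>P\<^esub> g) = lead_coeff f \<otimes> lead_coeff g"
    using poly_mult_lead_coeff[OF carrier_is_subring, of f g] assms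
    by (simp add: univ_poly_mult univ_poly_carrier)
qed

lemma monic_polys_mult: "\<lbrakk>f \<in> monic_polys; g \<in> monic_polys\<rbrakk> \<Longrightarrow> f \<otimes>\<^bsub>P\<^esub> g \<in> monic_polys"
  by (auto simp: monic_polys_def mult_nonempty lead_coeff_mult)

lemma degree_monic_mult:
  "\<lbrakk>f \<in> monic_polys; g \<in> monic_polys\<rbrakk> \<Longrightarrow> degree (f \<otimes>\<^bsub>P\<^esub> g) = degree f + degree g"
  by (rule degree_mult) (simp_all add: monic_polys_def)

lemma one_monic: "\<one>\<^bsub>P\<^esub> \<in> monic_polys"
  using UP.one_closed by (auto simp: monic_polys_def univ_poly_one)

lemma monic_degree_0: "\<lbrakk>f \<in> monic_polys; degree f = 0\<rbrakk> \<Longrightarrow> f = \<one>\<^bsub>P\<^esub>"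
  by (cases f) (auto simp: monic_polys_def univ_poly_one)

lemma Units_P: "f \<in> Units P \<longleftrightarrow> f \<in> carrier P \<and> f \<noteq> [] \<and> degree f = 0"
  by (rule univ_poly_units'[OF carrier_is_subfield])

lemma monic_Units: "f \<in> monic_polys \<Longrightarrow> f \<in> Units P \<longleftrightarrow> f = \<one>\<^bsub>P\<^esub>"
  using monic_degree_0[of f] by (auto simp: Units_P monic_polys_def univ_poly_one)

lemma monic_quotient:
  assumes "a \<in> monic_polys" "a \<otimes>\<^bsub>P\<^esub> c \<in> monic_polys" "c \<in> carrier P"
  shows "c \<in> monic_polys"
proof -
  have c: "c \<noteq> []" using assms UP.r_null[of a] by (auto simp: univ_poly_zero monic_polys_def)
  then have "lead_coeff c \<in> carrier R" using lead_coeff_closed assms by blast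
  then have "lead_coeff c = \<one>" using lead_coeff_mult[of a c] assms c by (simp add: monic_polys_def)
  then show ?thesis using assms c by (simp add: monic_polys_def)
qed

lemma divides_monic_monoid_iff:
  "\<lbrakk>a \<in> monic_polys; b \<in> monic_polys\<rbrakk> \<Longrightarrow> a divides\<^bsub>monic_monoid\<^esub> b \<longleftrightarrow> a divides\<^bsub>P\<^esub> b"
  unfolding factor_def carrier_monic_monoid mult_monic_monoid
  using monic_quotient monic_polys_closed by blast

lemma comm_monoid_cancel_monic_monoid: "comm_monoid_cancel monic_monoid"
proof (rule comm_monoid_cancelI)
  show "comm_monoid monic_monoid"
    unfolding monic_monoid_def
    by (rule comm_monoidI)
      (simp_all add: monic_polys_mult one_monic monic_polys_closed UP.m_assoc, simp add: UP.m_comm monic_polys_closed)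
  fix a b c assume "a \<otimes>\<^bsub>monic_monoid\<^esub> c = b \<otimes>\<^bsub>monic_monoid\<^esub> c"
    "a \<in> carrier monic_monoid" "b \<in> carrier monic_monoid" "c \<in> carrier monic_monoid"
  then show "a = b" using UP.m_rcancel[of c a b]
    by (auto simp: monic_monoid_def monic_polys_def univ_poly_zero)
qed

lemma card_monic_polys_of_degree: "card (monic_polys_of_degree n) = q ^ n"
proof -
  have "bij_betw ((#) \<one>) {xs. set xs \<subseteq> carrier R \<and> length xs = n} (monic_polys_of_degree n)"
  proof (rule bij_betw_imageI)
    show "(#) \<one> ` {xs. set xs \<subseteq> carrier R \<and> length xs = n} = monic_polys_of_degree n"
    proof (intro equalityI subsetI)
      fix f assume f: "f \<in> monic_polys_of_degree n"
      then obtain a xs where "f = a # xs" by (cases f) (auto simp: monic_polys_def)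
      then show "f \<in> (#) \<one> ` {xs. set xs \<subseteq> carrier R \<and> length xs = n}"
        using f by (auto simp: monic_polys_def carrier_P)
    qed (auto simp: monic_polys_def carrier_P)
  qed simp
  from bij_betw_same_card[OF this] show ?thesis
    using card_lists_length_eq[OF finite_carrier, of n] by simp
qed

lemma finite_monic_polys_of_degree: "finite (monic_polys_of_degree n)"
  using card_monic_polys_of_degree[of n] q_ge_3 by (intro card_ge_0_finite) simp

lemma const_closed: "c \<in> nonzero \<Longrightarrow> [c] \<in> carrier P"
  by (auto simp: carrier_P)

lemma const_mult_const: "\<lbrakk>c \<in> nonzero; d \<in> nonzero\<rbrakk> \<Longrightarrow> [c] \<otimes>\<^bsub>P\<^esub> [d] = [c \<otimes> d]"
  using poly_mult_const(1)[OF carrier_is_subring, of "[d]" c]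
  by (simp add: univ_poly_mult polynomial_def)

lemma
  assumes "c \<in> nonzero" "f \<in> carrier P" "f \<noteq> []"
  shows const_mult_nonempty: "[c] \<otimes>\<^bsub>P\<^esub> f \<noteq> []"
    and degree_const_mult: "degree ([c] \<otimes>\<^bsub>P\<^esub> f) = degree f"
    and lead_coeff_const_mult: "lead_coeff ([c] \<otimes>\<^bsub>P\<^esub> f) = c \<otimes> lead_coeff f"
  using assms const_closed[OF assms(1)] mult_nonempty[of "[c]" f] degree_mult[of "[c]" f]
    lead_coeff_mult[of "[c]" f] by simp_all

lemma const_mult_cancel:
  assumes "c \<in> nonzero" "d \<in> nonzero" "c \<otimes> d = \<one>" "f \<in> carrier P"
  shows "[c] \<otimes>\<^bsub>P\<^esub> ([d] \<otimes>\<^bsub>P\<^esub> f) = f"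
proof -
  have "[c] \<otimes>\<^bsub>P\<^esub> ([d] \<otimes>\<^bsub>P\<^esub> f) = ([c] \<otimes>\<^bsub>P\<^esub> [d]) \<otimes>\<^bsub>P\<^esub> f"
    using assms const_closed by (simp add: UP.m_assoc)
  also have "[c] \<otimes>\<^bsub>P\<^esub> [d] = \<one>\<^bsub>P\<^esub>"
    using assms by (simp add: const_mult_const univ_poly_one)
  finally show ?thesis using assms by simp
qed

definition monic_part :: "'a list \<Rightarrow> 'a list" where
  "monic_part f = [inv (lead_coeff f)] \<otimes>\<^bsub>P\<^esub> f"

lemma
  assumes f: "f \<in> carrier P" "f \<noteq> []"
  shows monic_part_monic: "monic_part f \<in> monic_polys"
    and degree_monic_part: "degree (monic_part f) = degree f"
    and lead_coeff_mult_monic_part: "[lead_coeff f] \<otimes>\<^bsub>P\<^esub> monic_part f = f"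
proof -
  let ?c = "lead_coeff f"
  have c: "?c \<in> nonzero" by (rule lead_coeff_closed[OF f])
  then have i: "inv ?c \<in> nonzero" "inv ?c \<otimes> ?c = \<one>" "?c \<otimes> inv ?c = \<one>" using nonzero_inv by auto
  have "monic_part f \<in> carrier P" using const_closed[OF i(1)] f by (simp add: monic_part_def)
  then show "monic_part f \<in> monic_polys"
    using const_mult_nonempty[OF i(1) f] lead_coeff_const_mult[OF i(1) f] i(2)
    by (simp add: monic_polys_def monic_part_def)
  show "degree (monic_part f) = degree f"
    unfolding monic_part_def by (rule degree_const_mult[OF i(1) f])
  show "[?c] \<otimes>\<^bsub>P\<^esub> monic_part f = f"
    unfolding monic_part_def by (rule const_mult_cancel[OF c i(1,3) f(1)])
qed

lemma
  assumes c: "c \<in> nonzero" and f: "f \<in> monic_polys"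
  shows lead_coeff_const_mult_monic: "lead_coeff ([c] \<otimes>\<^bsub>P\<^esub> f) = c"
    and monic_part_const_mult: "monic_part ([c] \<otimes>\<^bsub>P\<^esub> f) = f"
proof -
  show lead: "lead_coeff ([c] \<otimes>\<^bsub>P\<^esub> f) = c"
    using lead_coeff_const_mult[OF c, of f] c f by (simp add: monic_polys_def)
  show "monic_part ([c] \<otimes>\<^bsub>P\<^esub> f) = f"
    using const_mult_cancel[of "inv c" c f] nonzero_inv[OF c] c monic_polys_closed[OF f]
    by (simp add: monic_part_def lead)
qed

lemma irreducible_monic_imp_pirreducible:
  assumes p: "p \<in> monic_polys" "irreducible monic_monoid p"
  shows "pirreducible (carrier R) p"
proof -
  interpret M: comm_monoid_cancel monic_monoid by (rule comm_monoid_cancel_monic_monoid)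
  have Units_monic: "Units monic_monoid \<subseteq> Units P"
    using monic_polys_closed
    by (auto simp: Units_def carrier_monic_monoid mult_monic_monoid one_monic_monoid)
  have pc: "p \<in> carrier P" "p \<noteq> []" using p by (auto simp: monic_polys_def)
  show ?thesis
  proof (rule pirreducibleI[OF carrier_is_subring pc])
    show "p \<notin> Units P"
      using p monic_Units M.Units_one_closed by (auto simp: irreducible_def one_monic_monoid)
    fix u v assume uv: "u \<in> carrier P" "v \<in> carrier P" "p = u \<otimes>\<^bsub>P\<^esub> v"
    have ne: "u \<noteq> []" "v \<noteq> []" using uv pc UP.l_null UP.r_null by (auto simp: univ_poly_zero)
    define u' v' where "u' = monic_part u" and "v' = monic_part v"
    note u' = monic_part_monic[OF uv(1) ne(1), folded u'_def] degree_monic_part[OF uv(1) ne(1), folded u'_def]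
    note v' = monic_part_monic[OF uv(2) ne(2), folded v'_def] degree_monic_part[OF uv(2) ne(2), folded v'_def]
    have lc: "lead_coeff u \<in> nonzero" "lead_coeff v \<in> nonzero" "lead_coeff u \<otimes> lead_coeff v = \<one>"
      using lead_coeff_closed uv ne lead_coeff_mult[OF uv(1,2) ne] p by (auto simp: monic_polys_def)
    have "p = ([lead_coeff u] \<otimes>\<^bsub>P\<^esub> u') \<otimes>\<^bsub>P\<^esub> ([lead_coeff v] \<otimes>\<^bsub>P\<^esub> v')"
      using uv(3) lead_coeff_mult_monic_part[OF uv(1) ne(1)] lead_coeff_mult_monic_part[OF uv(2) ne(2)]
      by (simp add: u'_def v'_def)
    also have "\<dots> = [lead_coeff u] \<otimes>\<^bsub>P\<^esub> ([lead_coeff v] \<otimes>\<^bsub>P\<^esub> (u' \<otimes>\<^bsub>P\<^esub> v'))"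
      using const_closed[OF lc(1)] const_closed[OF lc(2)] u'(1) v'(1)
      by (simp only: monic_polys_closed UP.m_ac UP.m_closed)
    also have "\<dots> = u' \<otimes>\<^bsub>P\<^esub> v'"
      using u'(1) v'(1) by (intro const_mult_cancel[OF lc] UP.m_closed monic_polys_closed)
    finally have "irreducible monic_monoid (u' \<otimes>\<^bsub>monic_monoid\<^esub> v')"
      using p(2) by (simp add: mult_monic_monoid)
    then have "u' \<in> Units P \<or> v' \<in> Units P"
      using u' v' Units_monic by (elim M.irreducible_prodE) (auto simp: carrier_monic_monoid)
    then show "u \<in> Units P \<or> v \<in> Units P" using uv ne u'(2) v'(2) by (auto simp: Units_P)
  qed
qed

lemma irreducible_monic_imp_prime:
  assumes p: "p \<in> monic_polys" "irreducible monic_monoid p"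
  shows "prime monic_monoid p"
proof (rule primeI)
  show "p \<notin> Units monic_monoid" using p(2) by (simp add: irreducible_def)
  note pc = monic_polys_closed[OF p(1)]
  have "pprime (carrier R) p"
    using pprime_iff_pirreducible[OF carrier_is_subfield pc] irreducible_monic_imp_pirreducible[OF p] by simp
  note p_dvd = pprimeE(3)[OF carrier_is_subfield pc this, unfolded pdivides_def]
  fix a b assume "a \<in> carrier monic_monoid" "b \<in> carrier monic_monoid"
    "p divides\<^bsub>monic_monoid\<^esub> a \<otimes>\<^bsub>monic_monoid\<^esub> b"
  then show "p divides\<^bsub>monic_monoid\<^esub> a \<or> p divides\<^bsub>monic_monoid\<^esub> b"
    using p(1) p_dvd[of a b]
    by (simp add: carrier_monic_monoid mult_monic_monoid divides_monic_monoid_iff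
        monic_polys_mult monic_polys_closed)
qed

section \<open>Division with remainder and values of monic polynomials\<close>

lemma eval_closed: "\<lbrakk>f \<in> carrier P; x \<in> carrier R\<rbrakk> \<Longrightarrow> eval f x \<in> carrier R"
  by (rule eval_in_carrier) (auto simp: carrier_P)

lemma eval_mult:
  "\<lbrakk>f \<in> carrier P; g \<in> carrier P; x \<in> carrier R\<rbrakk> \<Longrightarrow> eval (f \<otimes>\<^bsub>P\<^esub> g) x = eval f x \<otimes> eval g x"
  using ring_hom_mult[OF eval_is_hom[OF carrier_is_subring, of x], of f g] by simp

lemma eval_add:
  "\<lbrakk>f \<in> carrier P; g \<in> carrier P; x \<in> carrier R\<rbrakk> \<Longrightarrow> eval (f \<oplus>\<^bsub>P\<^esub> g) x = eval f x \<oplus> eval g x"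
  using ring_hom_add[OF eval_is_hom[OF carrier_is_subring, of x], of f g] by simp

lemma
  assumes h: "h \<in> carrier P" "h \<noteq> []" and a: "a \<in> carrier P" "a = [] \<or> degree a < degree h"
  shows degree_add_lower: "degree (h \<oplus>\<^bsub>P\<^esub> a) = degree h"
    and monic_add_lower_iff: "h \<oplus>\<^bsub>P\<^esub> a \<in> monic_polys \<longleftrightarrow> h \<in> monic_polys"
proof -
  have "length (h \<oplus>\<^bsub>P\<^esub> a) = length h \<and> lead_coeff (h \<oplus>\<^bsub>P\<^esub> a) = lead_coeff h"
  proof (cases "a = []")
    case True
    then show ?thesis using UP.r_zero[OF h(1)] by (simp add: univ_poly_zero)
  next
    case False
    then have lt: "length a < length h" using a by auto
    then have len: "length (poly_add h a) = length h"
      using poly_add_length_eq[OF carrier_is_subring, of h a] h a by (simp add: univ_poly_carrier)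
    then have ne: "poly_add h a \<noteq> []" using h by auto
    have "lead_coeff (poly_add h a) = coeff (poly_add h a) (degree h)"
      using lead_coeff_simp[OF ne] len by simp
    also have "\<dots> = coeff h (degree h) \<oplus> coeff a (degree h)"
      using poly_add_coeff[of h a] h a by (auto simp: carrier_P)
    also have "coeff a (degree h) = \<zero>" using a False by (intro coeff_degree) auto
    also have "coeff h (degree h) = lead_coeff h" by (rule lead_coeff_simp[OF h(2)])
    finally show ?thesis using len lead_coeff_closed[OF h] by (simp add: univ_poly_add)
  qed
  moreover from this have "h \<oplus>\<^bsub>P\<^esub> a \<noteq> []" using h(2) by auto
  ultimately show "degree (h \<oplus>\<^bsub>P\<^esub> a) = degree h" "h \<oplus>\<^bsub>P\<^esub> a \<in> monic_polys \<longleftrightarrow> h \<in> monic_polys"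
    using h a by (simp_all add: monic_polys_def)
qed

lemma
  assumes "f \<in> carrier P" "Q \<in> monic_polys"
  shows pdiv_closed: "f pdiv Q \<in> carrier P" and pmod_closed: "f pmod Q \<in> carrier P"
    and pmod_lower: "f pmod Q = [] \<or> degree (f pmod Q) < degree Q"
    and pdiv_pmod_eq: "Q \<otimes>\<^bsub>P\<^esub> (f pdiv Q) \<oplus>\<^bsub>P\<^esub> (f pmod Q) = f"
  using long_division_closed[OF carrier_is_subfield assms(1) monic_polys_closed[OF assms(2)]]
    pmod_degree[OF carrier_is_subfield assms(1) monic_polys_closed monic_polys_nonempty, OF assms(2,2)]
    pdiv_pmod[OF carrier_is_subfield assms(1) monic_polys_closed[OF assms(2)]]
  by simp_all

lemma
  assumes Q: "Q \<in> monic_polys" and g: "g \<in> carrier P" and a: "a \<in> carrier P" "a = [] \<or> degree a < degree Q"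
  shows pdiv_mult_add: "(Q \<otimes>\<^bsub>P\<^esub> g \<oplus>\<^bsub>P\<^esub> a) pdiv Q = g" and pmod_mult_add: "(Q \<otimes>\<^bsub>P\<^esub> g \<oplus>\<^bsub>P\<^esub> a) pmod Q = a"
proof -
  let ?f = "Q \<otimes>\<^bsub>P\<^esub> g \<oplus>\<^bsub>P\<^esub> a"
  have "(g, a) = (?f pdiv Q, ?f pmod Q)"
    using monic_polys_closed[OF Q] monic_polys_nonempty[OF Q] g
    by (intro long_divisionI[OF carrier_is_subfield] long_dividesI a) (auto intro: a)
  then show "?f pdiv Q = g" "?f pmod Q = a" by simp_all
qed

lemma pdiv_monic:
  assumes f: "f \<in> monic_polys" and Q: "Q \<in> monic_polys" and le: "degree Q \<le> degree f"
  shows "f pdiv Q \<in> monic_polys_of_degree (degree f - degree Q)"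
proof -
  note fc = monic_polys_closed[OF f] and Qc = monic_polys_closed[OF Q]
  note division = pdiv_closed[OF fc Q] pmod_closed[OF fc Q] pmod_lower[OF fc Q] pdiv_pmod_eq[OF fc Q]
  have b: "f pdiv Q \<noteq> []"
  proof
    assume "f pdiv Q = []"
    then have "f pmod Q = f"
      using division(4) UP.r_null[OF Qc] UP.l_zero[OF division(2)] by (simp add: univ_poly_zero)
    then show False using division(3) le monic_polys_nonempty[OF f] by simp
  qed
  note Qb = mult_nonempty[OF Qc division(1) monic_polys_nonempty[OF Q] b]
    degree_mult[OF Qc division(1) monic_polys_nonempty[OF Q] b]
  note lower = UP.m_closed[OF Qc division(1)] Qb(1) division(2)
  have r: "f pmod Q = [] \<or> degree (f pmod Q) < degree (Q \<otimes>\<^bsub>P\<^esub> (f pdiv Q))"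
    using division(3) Qb(2) by auto
  have "Q \<otimes>\<^bsub>P\<^esub> (f pdiv Q) \<in> monic_polys"
    using monic_add_lower_iff[OF lower r] f division(4) by simp
  moreover have "degree f = degree Q + degree (f pdiv Q)"
    using degree_add_lower[OF lower r] Qb(2) division(4) by simp
  ultimately show ?thesis using monic_quotient[OF Q _ division(1)] by simp
qed

lemma bij_betw_monic_remainder:
  assumes Q: "Q \<in> monic_polys" "degree Q \<le> n" and a: "a \<in> carrier P" "a = [] \<or> degree a < degree Q"
  shows "bij_betw (\<lambda>g. Q \<otimes>\<^bsub>P\<^esub> g \<oplus>\<^bsub>P\<^esub> a) (monic_polys_of_degree (n - degree Q))
    {f \<in> monic_polys_of_degree n. f pmod Q = a}"
proof (rule bij_betwI[where g = "\<lambda>f. f pdiv Q"])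
  show "(\<lambda>g. Q \<otimes>\<^bsub>P\<^esub> g \<oplus>\<^bsub>P\<^esub> a) \<in> monic_polys_of_degree (n - degree Q) \<rightarrow>
      {f \<in> monic_polys_of_degree n. f pmod Q = a}"
  proof (intro funcsetI CollectI conjI)
    fix g assume "g \<in> monic_polys_of_degree (n - degree Q)"
    then have g: "g \<in> monic_polys" "degree g = n - degree Q" by auto
    then have Qg: "Q \<otimes>\<^bsub>P\<^esub> g \<in> monic_polys" "degree (Q \<otimes>\<^bsub>P\<^esub> g) = n"
      using monic_polys_mult[OF Q(1)] degree_monic_mult[OF Q(1)] Q(2) by auto
    then have "a = [] \<or> degree a < degree (Q \<otimes>\<^bsub>P\<^esub> g)" using a(2) Q(2) by auto
    note add = degree_add_lower[OF monic_polys_closed[OF Qg(1)] monic_polys_nonempty[OF Qg(1)] a(1) this]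
      monic_add_lower_iff[OF monic_polys_closed[OF Qg(1)] monic_polys_nonempty[OF Qg(1)] a(1) this]
    show "Q \<otimes>\<^bsub>P\<^esub> g \<oplus>\<^bsub>P\<^esub> a \<in> monic_polys" using add(2) Qg(1) by simp
    show "degree (Q \<otimes>\<^bsub>P\<^esub> g \<oplus>\<^bsub>P\<^esub> a) = n" using add(1) Qg(2) by simp
    show "(Q \<otimes>\<^bsub>P\<^esub> g \<oplus>\<^bsub>P\<^esub> a) pmod Q = a" by (rule pmod_mult_add[OF Q(1) monic_polys_closed[OF g(1)] a])
  qed
  show "(\<lambda>f. f pdiv Q) \<in> {f \<in> monic_polys_of_degree n. f pmod Q = a} \<rightarrow> monic_polys_of_degree (n - degree Q)"
    using pdiv_monic[OF _ Q(1)] Q(2) by auto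
  show "(Q \<otimes>\<^bsub>P\<^esub> g \<oplus>\<^bsub>P\<^esub> a) pdiv Q = g" if "g \<in> monic_polys_of_degree (n - degree Q)" for g
    using that by (intro pdiv_mult_add[OF Q(1) _ a]) (simp add: monic_polys_closed)
  show "Q \<otimes>\<^bsub>P\<^esub> (f pdiv Q) \<oplus>\<^bsub>P\<^esub> a = f" if "f \<in> {f \<in> monic_polys_of_degree n. f pmod Q = a}" for f
    using that pdiv_pmod_eq[OF monic_polys_closed Q(1)] by auto
qed

lemma card_monic_remainder_values:
  assumes Q: "Q \<in> monic_polys" "degree Q \<le> n" and a: "a \<in> carrier P" "a = [] \<or> degree a < degree Q"
    and U: "U \<subseteq> carrier R"
  shows "card {f \<in> monic_polys_of_degree n. f pmod Q = a \<and> (\<forall>x\<in>U. eval f x \<in> B x)}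
    = card {g \<in> monic_polys_of_degree (n - degree Q).
        \<forall>x\<in>U. eval g x \<in> {v \<in> carrier R. eval Q x \<otimes> v \<oplus> eval a x \<in> B x}}"
proof -
  let ?B = "\<lambda>x. {v \<in> carrier R. eval Q x \<otimes> v \<oplus> eval a x \<in> B x}"
  have "eval (Q \<otimes>\<^bsub>P\<^esub> g \<oplus>\<^bsub>P\<^esub> a) x \<in> B x \<longleftrightarrow> eval g x \<in> ?B x"
    if "g \<in> monic_polys_of_degree (n - degree Q)" "x \<in> U" for g x
    using that U a(1) Q(1) by (auto simp: eval_add eval_mult eval_closed monic_polys_closed subset_iff)
  then have "bij_betw (\<lambda>g. Q \<otimes>\<^bsub>P\<^esub> g \<oplus>\<^bsub>P\<^esub> a) {g \<in> monic_polys_of_degree (n - degree Q). \<forall>x\<in>U. eval g x \<in> ?B x}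
      {f \<in> {f \<in> monic_polys_of_degree n. f pmod Q = a}. \<forall>x\<in>U. eval f x \<in> B x}"
    by (intro bij_betw_Collect[OF bij_betw_monic_remainder[OF Q a]] ball_cong refl)
  from bij_betw_same_card[OF this] show ?thesis by (simp add: conj_ac)
qed

lemma card_affine_preimage:
  assumes c: "c \<in> nonzero" and d: "d \<in> carrier R" and B: "B \<subseteq> carrier R"
  shows "card {v \<in> carrier R. c \<otimes> v \<oplus> d \<in> B} = card B"
proof -
  have "inj_on (\<lambda>v. c \<otimes> v \<oplus> d) (carrier R)"
    using c d by (intro inj_onI) (simp add: m_lcancel)
  moreover from this have "(\<lambda>v. c \<otimes> v \<oplus> d) ` carrier R = carrier R"
    using c d by (intro endo_inj_surj[OF finite_carrier]) auto
  ultimately have "bij_betw (\<lambda>v. c \<otimes> v \<oplus> d) {v \<in> carrier R. c \<otimes> v \<oplus> d \<in> B} B"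
    using B unfolding bij_betw_def inj_on_def by (auto simp: image_iff)
  then show ?thesis by (rule bij_betw_same_card)
qed

definition linear_factor :: "'a \<Rightarrow> 'a list" where "linear_factor x = [\<one>, \<ominus> x]"

lemma linear_factor_monic: "x \<in> carrier R \<Longrightarrow> linear_factor x \<in> monic_polys_of_degree 1"
  by (auto simp: linear_factor_def monic_polys_def carrier_P)

lemma eval_linear_factor: "\<lbrakk>x \<in> carrier R; y \<in> carrier R\<rbrakk> \<Longrightarrow> eval (linear_factor x) y = y \<ominus> x"
  by (simp add: linear_factor_def a_minus_def)

lemma pmod_linear_factor:
  assumes x: "x \<in> carrier R" and f: "f \<in> carrier P"
  shows "f pmod linear_factor x = poly_of_const (eval f x)"
proof -
  have L: "linear_factor x \<in> monic_polys" "degree (linear_factor x) = 1" using linear_factor_monic[OF x]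
    by auto
  note division = pdiv_closed[OF f L(1)] pmod_closed[OF f L(1)] pmod_lower[OF f L(1)] pdiv_pmod_eq[OF f L(1)]
  have "eval f x = eval (linear_factor x \<otimes>\<^bsub>P\<^esub> (f pdiv linear_factor x) \<oplus>\<^bsub>P\<^esub> (f pmod linear_factor x)) x"
    unfolding division(4) ..
  also have "\<dots> = eval (f pmod linear_factor x) x"
    using x division(1,2) monic_polys_closed[OF L(1)] eval_closed[OF division(1) x] eval_closed[OF division(2) x]
    by (simp add: eval_add eval_mult eval_linear_factor r_right_minus_eq[THEN iffD2])
  also have "poly_of_const \<dots> = f pmod linear_factor x"
    using division(2,3) x unfolding L(2)
    by (cases "f pmod linear_factor x") (auto simp: poly_of_const_def carrier_P)
  finally show ?thesis by simp
qed

lemma card_value_eq_and_values_in: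
  assumes x: "x \<in> carrier R" and c: "c \<in> carrier R" and U: "U \<subseteq> carrier R" and n: "1 \<le> n"
  shows "card {f \<in> monic_polys_of_degree n. eval f x = c \<and> (\<forall>y\<in>U. eval f y \<in> B y)}
    = card {g \<in> monic_polys_of_degree (n - 1). \<forall>y\<in>U. eval g y \<in> {v \<in> carrier R. (y \<ominus> x) \<otimes> v \<oplus> c \<in> B y}}"
proof -
  have L: "linear_factor x \<in> monic_polys" "degree (linear_factor x) = 1" using linear_factor_monic[OF x]
    by auto
  have a: "poly_of_const c \<in> carrier P" "poly_of_const c = [] \<or> degree (poly_of_const c) < degree (linear_factor x)"
    using c by (auto simp: poly_of_const_def carrier_P linear_factor_def)
  have "f pmod linear_factor x = poly_of_const c \<longleftrightarrow> eval f x = c" if "f \<in> monic_polys" for f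
    unfolding pmod_linear_factor[OF x monic_polys_closed[OF that]] by (auto simp: poly_of_const_def)
  then have "{f \<in> monic_polys_of_degree n. eval f x = c \<and> (\<forall>y\<in>U. eval f y \<in> B y)}
      = {f \<in> monic_polys_of_degree n. f pmod linear_factor x = poly_of_const c \<and> (\<forall>y\<in>U. eval f y \<in> B y)}"
    by auto
  also have "card \<dots> = card {g \<in> monic_polys_of_degree (n - 1).
      \<forall>y\<in>U. eval g y \<in> {v \<in> carrier R. eval (linear_factor x) y \<otimes> v \<oplus> eval (poly_of_const c) y \<in> B y}}"
    using card_monic_remainder_values[OF L(1) _ a U, of n B] n by (simp only: L(2))
  also have "\<dots> = card {g \<in> monic_polys_of_degree (n - 1).
      \<forall>y\<in>U. eval g y \<in> {v \<in> carrier R. (y \<ominus> x) \<otimes> v \<oplus> c \<in> B y}}"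
  proof -
    have "eval (linear_factor x) y = y \<ominus> x" "eval (poly_of_const c) y = c" if "y \<in> U" for y
      using that U x c by (auto simp: eval_linear_factor poly_of_const_def)
    then show ?thesis by (simp cong: ball_cong)
  qed
  finally show ?thesis .
qed

lemma card_values_in:
  assumes "finite U" "U \<subseteq> carrier R" "\<And>x. x \<in> U \<Longrightarrow> B x \<subseteq> carrier R" "card U \<le> n"
  shows "card {f \<in> monic_polys_of_degree n. \<forall>x\<in>U. eval f x \<in> B x} = q ^ (n - card U) * (\<Prod>x\<in>U. card (B x))"
  using assms
proof (induction U arbitrary: n B rule: finite_induct)
  case empty
  then show ?case using card_monic_polys_of_degree by simp
next
  case (insert x U)
  have x: "x \<in> carrier R" "B x \<subseteq> carrier R" and U: "U \<subseteq> carrier R" and n: "card U \<le> n - 1" "1 \<le> n"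
    using insert by auto
  let ?A = "\<lambda>c. {f \<in> monic_polys_of_degree n. eval f x = c \<and> (\<forall>y\<in>U. eval f y \<in> B y)}"
  have card_A: "card (?A c) = q ^ (n - 1 - card U) * (\<Prod>y\<in>U. card (B y))" if "c \<in> B x" for c
  proof -
    have c: "c \<in> carrier R" using that x by blast
    have "card (?A c) = q ^ (n - 1 - card U) * (\<Prod>y\<in>U. card {v \<in> carrier R. (y \<ominus> x) \<otimes> v \<oplus> c \<in> B y})"
      unfolding card_value_eq_and_values_in[OF x(1) c U n(2)] by (rule insert.IH[OF U _ n(1)]) blast
    also have "(\<Prod>y\<in>U. card {v \<in> carrier R. (y \<ominus> x) \<otimes> v \<oplus> c \<in> B y}) = (\<Prod>y\<in>U. card (B y))"
      using insert.hyps insert.prems(2) U x(1) c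
      by (intro prod.cong refl card_affine_preimage) (auto simp: subset_iff)
    finally show ?thesis .
  qed
  have "{f \<in> monic_polys_of_degree n. \<forall>y\<in>insert x U. eval f y \<in> B y} = (\<Union>c\<in>B x. ?A c)" by auto
  moreover have "card (\<Union>c\<in>B x. ?A c) = (\<Sum>c\<in>B x. card (?A c))"
  proof (rule card_UN_disjoint)
    show "finite (B x)" using x finite_carrier finite_subset by blast
    show "\<forall>c\<in>B x. finite (?A c)"
      by (intro ballI finite_subset[OF _ finite_monic_polys_of_degree[of n]]) auto
  qed auto
  ultimately have "card {f \<in> monic_polys_of_degree n. \<forall>y\<in>insert x U. eval f y \<in> B y}
      = (\<Sum>c\<in>B x. card (?A c))"
    by (simp only:)
  also have "\<dots> = (\<Sum>c\<in>B x. q ^ (n - 1 - card U) * (\<Prod>y\<in>U. card (B y)))"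
    by (rule sum.cong[OF refl card_A])
  finally show ?case using insert.hyps by simp
qed

lemma linear_factor_divides_iff:
  assumes x: "x \<in> carrier R" and f: "f \<in> monic_polys"
  shows "linear_factor x divides\<^bsub>P\<^esub> f \<longleftrightarrow> eval f x = \<zero>"
  using pdivides_imp_is_root[OF monic_polys_nonempty[OF f] x]
    is_root_imp_pdivides[OF monic_polys_closed[OF f], of x] x monic_polys_nonempty[OF f]
  unfolding pdivides_def linear_factor_def is_root_def by blast

text \<open>The abbreviation \<open>degree\<close> does not survive simplification, so the grading is a constant of its own.\<close>

definition monic_degree :: "'a list \<Rightarrow> nat" where "monic_degree f = degree f"

definition char_at :: "'a list \<Rightarrow> 'a \<Rightarrow> real" where "char_at f x = real_of_int (quad_char (eval f x))"

definition monic_residue :: "'a list \<Rightarrow> 'a list \<Rightarrow> 'a list" where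
  "monic_residue Q f = Q \<oplus>\<^bsub>P\<^esub> (f pmod Q)"

lemma
  assumes "f \<in> carrier P" "Q \<in> monic_polys"
  shows monic_residue_closed: "monic_residue Q f \<in> monic_polys"
    and degree_monic_residue: "degree (monic_residue Q f) = degree Q"
    and pmod_monic_residue: "monic_residue Q f pmod Q = f pmod Q"
proof -
  note rem = pmod_closed[OF assms] pmod_lower[OF assms]
    and Q = monic_polys_closed[OF assms(2)] monic_polys_nonempty[OF assms(2)]
  show "monic_residue Q f \<in> monic_polys" "degree (monic_residue Q f) = degree Q"
    unfolding monic_residue_def monic_add_lower_iff[OF Q rem] by (rule assms degree_add_lower[OF Q rem])+
  show "monic_residue Q f pmod Q = f pmod Q"
    using pmod_mult_add[OF assms(2) UP.one_closed rem] Q by (simp add: monic_residue_def)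
qed

lemma monic_residue_same_degree:
  assumes "r \<in> monic_polys" "Q \<in> monic_polys" "degree r = degree Q"
  shows "monic_residue Q r = r"
proof -
  have "r pdiv Q = \<one>\<^bsub>P\<^esub>" using pdiv_monic[OF assms(1,2)] assms(3) monic_degree_0 by auto
  then show ?thesis
    using pdiv_pmod_eq[of r Q] assms monic_polys_closed by (simp add: monic_residue_def)
qed

lemma monic_residue_eq_iff:
  assumes "f \<in> carrier P" "Q \<in> monic_polys" "r \<in> monic_polys" "degree r = degree Q"
  shows "monic_residue Q f = r \<longleftrightarrow> f pmod Q = r pmod Q"
  using pmod_monic_residue[OF assms(1,2)] monic_residue_same_degree[OF assms(3,2,4)]
  by (auto simp: monic_residue_def)

lemma divides_mult_add_mult_iff:
  assumes "Q \<in> carrier P" "u \<in> carrier P" "r \<in> carrier P" "b \<in> carrier P"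
  shows "Q divides\<^bsub>P\<^esub> (Q \<otimes>\<^bsub>P\<^esub> u \<oplus>\<^bsub>P\<^esub> r) \<otimes>\<^bsub>P\<^esub> b \<longleftrightarrow> Q divides\<^bsub>P\<^esub> r \<otimes>\<^bsub>P\<^esub> b"
proof
  assume "Q divides\<^bsub>P\<^esub> (Q \<otimes>\<^bsub>P\<^esub> u \<oplus>\<^bsub>P\<^esub> r) \<otimes>\<^bsub>P\<^esub> b"
  then obtain c where c: "c \<in> carrier P" "(Q \<otimes>\<^bsub>P\<^esub> u \<oplus>\<^bsub>P\<^esub> r) \<otimes>\<^bsub>P\<^esub> b = Q \<otimes>\<^bsub>P\<^esub> c" by (auto simp: factor_def)
  have "r \<otimes>\<^bsub>P\<^esub> b = (Q \<otimes>\<^bsub>P\<^esub> u \<oplus>\<^bsub>P\<^esub> r) \<otimes>\<^bsub>P\<^esub> b \<ominus>\<^bsub>P\<^esub> Q \<otimes>\<^bsub>P\<^esub> (u \<otimes>\<^bsub>P\<^esub> b)" using assms by algebra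
  also have "\<dots> = Q \<otimes>\<^bsub>P\<^esub> (c \<ominus>\<^bsub>P\<^esub> u \<otimes>\<^bsub>P\<^esub> b)" unfolding c(2) using assms c(1) by algebra
  finally show "Q divides\<^bsub>P\<^esub> r \<otimes>\<^bsub>P\<^esub> b" using assms c(1) by (intro dividesI) auto
next
  assume "Q divides\<^bsub>P\<^esub> r \<otimes>\<^bsub>P\<^esub> b"
  then obtain c where c: "c \<in> carrier P" "r \<otimes>\<^bsub>P\<^esub> b = Q \<otimes>\<^bsub>P\<^esub> c" by (auto simp: factor_def)
  have "(Q \<otimes>\<^bsub>P\<^esub> u \<oplus>\<^bsub>P\<^esub> r) \<otimes>\<^bsub>P\<^esub> b = Q \<otimes>\<^bsub>P\<^esub> (u \<otimes>\<^bsub>P\<^esub> b) \<oplus>\<^bsub>P\<^esub> r \<otimes>\<^bsub>P\<^esub> b" using assms by algebra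
  also have "\<dots> = Q \<otimes>\<^bsub>P\<^esub> (u \<otimes>\<^bsub>P\<^esub> b \<oplus>\<^bsub>P\<^esub> c)" unfolding c(2) using assms c(1) by algebra
  finally show "Q divides\<^bsub>P\<^esub> (Q \<otimes>\<^bsub>P\<^esub> u \<oplus>\<^bsub>P\<^esub> r) \<otimes>\<^bsub>P\<^esub> b" using assms c(1) by (intro dividesI) auto
qed

lemma divides_monic_residue_mult_iff:
  assumes f: "f \<in> monic_polys" and Q: "Q \<in> monic_polys" and b: "b \<in> carrier P"
  shows "Q divides\<^bsub>P\<^esub> monic_residue Q f \<otimes>\<^bsub>P\<^esub> b \<longleftrightarrow> Q divides\<^bsub>P\<^esub> f \<otimes>\<^bsub>P\<^esub> b"
proof -
  note fc = monic_polys_closed[OF f] and Qc = monic_polys_closed[OF Q]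
  note rem = pmod_closed[OF fc Q]
  have "Q divides\<^bsub>P\<^esub> monic_residue Q f \<otimes>\<^bsub>P\<^esub> b \<longleftrightarrow> Q divides\<^bsub>P\<^esub> (f pmod Q) \<otimes>\<^bsub>P\<^esub> b"
    using divides_mult_add_mult_iff[OF Qc UP.one_closed rem b] Qc by (simp add: monic_residue_def)
  also have "\<dots> \<longleftrightarrow> Q divides\<^bsub>P\<^esub> f \<otimes>\<^bsub>P\<^esub> b"
    using divides_mult_add_mult_iff[OF Qc pdiv_closed[OF fc Q] rem b] pdiv_pmod_eq[OF fc Q] by simp
  finally show ?thesis .
qed

lemma card_monic_residue_class:
  assumes Q: "Q \<in> monic_polys" and r: "r \<in> monic_polys" "degree r = degree Q"
    and U: "U \<subseteq> carrier R" "\<And>x. x \<in> U \<Longrightarrow> char_at Q x \<noteq> 0"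
    and s: "\<And>x. x \<in> U \<Longrightarrow> s x \<in> {1, -1}" and n: "degree Q + card U \<le> n"
  shows "real (card {f \<in> monic_polys_of_degree n. monic_residue Q f = r \<and> (\<forall>x\<in>U. char_at f x = s x)})
    = real q ^ (n - degree Q) * ((real q - 1) / (2 * real q)) ^ card U"
proof -
  define V where "V x = {w \<in> carrier R. quad_char w = s x}" for x
  let ?a = "r pmod Q" and ?k = "n - degree Q"
  let ?B = "\<lambda>x. {v \<in> carrier R. eval Q x \<otimes> v \<oplus> eval ?a x \<in> V x}"
  note a = pmod_closed[OF monic_polys_closed[OF r(1)] Q] pmod_lower[OF monic_polys_closed[OF r(1)] Q]
  have V: "real (card (V x)) = (real q - 1) / 2" if x: "x \<in> U" for x
  proof -
    obtain t :: int where t: "s x = of_int t" "t \<in> {1, -1}" using s[OF x] by force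
    then have "2 * card (V x) = q - 1" using card_quad_char[OF t(2)] by (simp add: V_def)
    then have "2 * real (card (V x)) = real (q - 1)" by (metis of_nat_mult of_nat_numeral)
    then show ?thesis using q_ge_3 by (simp add: of_nat_diff)
  qed
  have "char_at f x = s x \<longleftrightarrow> eval f x \<in> V x" if "f \<in> monic_polys" "x \<in> U" for f x
    using that U(1) by (auto simp: char_at_def V_def eval_closed monic_polys_closed)
  then have "{f \<in> monic_polys_of_degree n. monic_residue Q f = r \<and> (\<forall>x\<in>U. char_at f x = s x)}
      = {f \<in> monic_polys_of_degree n. f pmod Q = ?a \<and> (\<forall>x\<in>U. eval f x \<in> V x)}"
    using monic_residue_eq_iff[OF monic_polys_closed Q r] by auto
  also have "card \<dots> = card {g \<in> monic_polys_of_degree ?k. \<forall>x\<in>U. eval g x \<in> ?B x}"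
    using card_monic_remainder_values[OF Q _ a U(1), of n V] n by simp
  also have "\<dots> = q ^ (?k - card U) * (\<Prod>x\<in>U. card (?B x))"
    using U finite_carrier finite_subset n by (intro card_values_in) auto
  also have "(\<Prod>x\<in>U. card (?B x)) = (\<Prod>x\<in>U. card (V x))"
  proof (rule prod.cong[OF refl], rule card_affine_preimage)
    fix x assume x: "x \<in> U"
    then show "eval Q x \<in> nonzero" "eval ?a x \<in> carrier R"
      using U a(1) Q by (auto simp: char_at_def quad_char_eq_0_iff eval_closed monic_polys_closed)
  qed (auto simp: V_def)
  finally have "real (card {f \<in> monic_polys_of_degree n. monic_residue Q f = r \<and> (\<forall>x\<in>U. char_at f x = s x)})
      = real q ^ (?k - card U) * ((real q - 1) / 2) ^ card U"
    by (simp add: V)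
  also have "real q ^ (?k - card U) = real q ^ ?k / real q ^ card U"
    using n q_ge_3 by (simp add: power_diff power_add)
  finally show ?thesis by (simp add: power_divide power_mult_distrib)
qed

sublocale M: equidistributed_monoid monic_monoid q monic_degree "carrier R" linear_factor char_at monic_residue
proof -
  interpret comm_monoid_cancel monic_monoid by (rule comm_monoid_cancel_monic_monoid)
  show "equidistributed_monoid monic_monoid q monic_degree (carrier R) linear_factor char_at monic_residue"
  proof (unfold_locales, unfold carrier_monic_monoid mult_monic_monoid one_monic_monoid)
    show "prime monic_monoid p" if "p \<in> monic_polys" "irreducible monic_monoid p" for p
      by (rule irreducible_monic_imp_prime[OF that])
    show "2 \<le> q" using q_ge_3 by simp
    show "monic_degree (f \<otimes>\<^bsub>P\<^esub> g) = monic_degree f + monic_degree g"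
      if "f \<in> monic_polys" "g \<in> monic_polys" for f g
      unfolding monic_degree_def by (rule degree_monic_mult[OF that])
    show "f = \<one>\<^bsub>P\<^esub>" if "f \<in> monic_polys" "monic_degree f = 0" for f
      using that monic_degree_0 by (simp add: monic_degree_def)
    show "card {f \<in> monic_polys. monic_degree f = n} = q ^ n" for n
      unfolding monic_degree_def by (rule card_monic_polys_of_degree)
    show "linear_factor x \<in> monic_polys" "monic_degree (linear_factor x) = 1" if "x \<in> carrier R" for x
      using linear_factor_monic[OF that] by (simp_all add: monic_degree_def)
    show "char_at (f \<otimes>\<^bsub>P\<^esub> g) x = char_at f x * char_at g x"
      if "f \<in> monic_polys" "g \<in> monic_polys" "x \<in> carrier R" for f g x
      using that by (simp add: char_at_def eval_mult quad_char_mult eval_closed monic_polys_closed)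
    show "char_at f x \<in> {- 1, 0, 1}" for f x
      using quad_char_values[of "eval f x"] by (auto simp: char_at_def)
    show "char_at f x = 0 \<longleftrightarrow> linear_factor x divides\<^bsub>monic_monoid\<^esub> f"
      if "f \<in> monic_polys" "x \<in> carrier R" for f x
      using that linear_factor_monic[OF that(2)]
      by (simp add: char_at_def quad_char_eq_0_iff divides_monic_monoid_iff linear_factor_divides_iff)
    show "char_at (linear_factor x) y \<noteq> 0" if "x \<in> carrier R" "y \<in> carrier R" "x \<noteq> y" for x y
      using that by (simp add: char_at_def quad_char_eq_0_iff eval_linear_factor)
    show "monic_residue Q f \<in> monic_polys" "monic_degree (monic_residue Q f) = monic_degree Q"
      if "Q \<in> monic_polys" "f \<in> monic_polys" for Q f
      unfolding monic_degree_def using that monic_residue_closed degree_monic_residue monic_polys_closed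
      by blast+
    show "Q divides\<^bsub>monic_monoid\<^esub> monic_residue Q f \<otimes>\<^bsub>P\<^esub> g \<longleftrightarrow> Q divides\<^bsub>monic_monoid\<^esub> f \<otimes>\<^bsub>P\<^esub> g"
      if "Q \<in> monic_polys" "f \<in> monic_polys" "g \<in> monic_polys" for Q f g
      using that by (simp add: divides_monic_monoid_iff divides_monic_residue_mult_iff monic_residue_closed
          monic_polys_mult monic_polys_closed)
    fix Q r :: "'a list" and U :: "'a set" and s :: "'a \<Rightarrow> real" and n
    assume "Q \<in> monic_polys" "r \<in> monic_polys" "monic_degree r = monic_degree Q" "U \<subseteq> carrier R"
      "\<And>x. x \<in> U \<Longrightarrow> char_at Q x \<noteq> 0" "\<And>x. x \<in> U \<Longrightarrow> s x \<in> {1, -1}" "monic_degree Q + card U \<le> n"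
    then show "real (card {f \<in> monic_polys.
          monic_degree f = n \<and> monic_residue Q f = r \<and> (\<forall>x\<in>U. char_at f x = s x)})
        = real q ^ (n - monic_degree Q) * ((real q - 1) / (2 * real q)) ^ card U"
      using card_monic_residue_class[of Q r U s n] by (simp add: monic_degree_def)
  qed (rule finite_carrier)
qed

section \<open>Squarefree polynomials and their monic parts\<close>

lemma const_mult_associated:
  assumes "c \<in> nonzero" "f \<in> carrier P"
  shows "[c] \<otimes>\<^bsub>P\<^esub> f \<sim>\<^bsub>P\<^esub> f"
proof -
  have "[c] \<in> Units P" using assms const_closed by (simp add: Units_P)
  then show ?thesis using assms const_closed
    by (intro UP.associatedI2'[of _ _ "[c]"]) (simp_all add: UP.m_comm)
qed

lemma
  assumes "c \<in> nonzero" "u \<in> carrier P" "f \<in> carrier P"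
  shows const_mult_divides_iff: "[c] \<otimes>\<^bsub>P\<^esub> u divides\<^bsub>P\<^esub> f \<longleftrightarrow> u divides\<^bsub>P\<^esub> f"
    and divides_const_mult_iff: "u divides\<^bsub>P\<^esub> [c] \<otimes>\<^bsub>P\<^esub> f \<longleftrightarrow> u divides\<^bsub>P\<^esub> f"
proof -
  note closed = UP.m_closed[OF const_closed[OF assms(1)]]
  show "[c] \<otimes>\<^bsub>P\<^esub> u divides\<^bsub>P\<^esub> f \<longleftrightarrow> u divides\<^bsub>P\<^esub> f"
    using const_mult_associated[OF assms(1,2)] UP.divides_cong_l UP.associated_sym closed assms by meson
  show "u divides\<^bsub>P\<^esub> [c] \<otimes>\<^bsub>P\<^esub> f \<longleftrightarrow> u divides\<^bsub>P\<^esub> f"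
    using const_mult_associated[OF assms(1,3)] UP.divides_cong_r UP.associated_sym closed assms by meson
qed

lemma zero_not_divides: "\<lbrakk>f \<in> carrier P; f \<noteq> []\<rbrakk> \<Longrightarrow> \<not> [] divides\<^bsub>P\<^esub> f"
  using zero_pdivides[of f] by (simp add: pdivides_def)

lemma ball_Units_iff_ball_monic:
  assumes scale: "\<And>c v. \<lbrakk>c \<in> nonzero; v \<in> monic_polys\<rbrakk> \<Longrightarrow> D ([c] \<otimes>\<^bsub>P\<^esub> v) \<longleftrightarrow> D v" and "\<not> D []"
  shows "(\<forall>u\<in>carrier P. D u \<longrightarrow> u \<in> Units P) \<longleftrightarrow> (\<forall>v\<in>monic_polys. D v \<longrightarrow> v = \<one>\<^bsub>P\<^esub>)"
proof (intro iffI ballI impI)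
  fix v assume "\<forall>u\<in>carrier P. D u \<longrightarrow> u \<in> Units P" "v \<in> monic_polys" "D v"
  then show "v = \<one>\<^bsub>P\<^esub>" using monic_polys_closed monic_Units by blast
next
  fix u assume monic: "\<forall>v\<in>monic_polys. D v \<longrightarrow> v = \<one>\<^bsub>P\<^esub>" and u: "u \<in> carrier P" "D u"
  then have ne: "u \<noteq> []" using \<open>\<not> D []\<close> by auto
  then have "D (monic_part u)"
    using u(2) scale[OF lead_coeff_closed[OF u(1) ne] monic_part_monic[OF u(1) ne]]
    unfolding lead_coeff_mult_monic_part[OF u(1) ne] by simp
  then have "monic_part u = \<one>\<^bsub>P\<^esub>" using monic monic_part_monic[OF u(1) ne] by blast
  then have "degree u = 0" using degree_monic_part[OF u(1) ne] by (simp add: univ_poly_one)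
  then show "u \<in> Units P" using Units_P u(1) ne by blast
qed

lemma squarefree_in_const_mult_iff:
  assumes c: "c \<in> nonzero" and f: "f \<in> monic_polys"
  shows "squarefree_in P ([c] \<otimes>\<^bsub>P\<^esub> f) \<longleftrightarrow> M.sqfree f"
proof -
  note fc = monic_polys_closed[OF f]
  have "squarefree_in P ([c] \<otimes>\<^bsub>P\<^esub> f) \<longleftrightarrow> (\<forall>u\<in>carrier P. u \<otimes>\<^bsub>P\<^esub> u divides\<^bsub>P\<^esub> f \<longrightarrow> u \<in> Units P)"
    unfolding squarefree_in_def using divides_const_mult_iff[OF c _ fc] by (simp add: numeral_2_eq_2)
  also have "\<dots> \<longleftrightarrow> (\<forall>v\<in>monic_polys. v \<otimes>\<^bsub>P\<^esub> v divides\<^bsub>P\<^esub> f \<longrightarrow> v = \<one>\<^bsub>P\<^esub>)"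
  proof (rule ball_Units_iff_ball_monic)
    fix c v assume c: "c \<in> nonzero" and v: "v \<in> monic_polys"
    have "([c] \<otimes>\<^bsub>P\<^esub> v) \<otimes>\<^bsub>P\<^esub> ([c] \<otimes>\<^bsub>P\<^esub> v) = [c] \<otimes>\<^bsub>P\<^esub> ([c] \<otimes>\<^bsub>P\<^esub> (v \<otimes>\<^bsub>P\<^esub> v))"
      using const_closed[OF c] monic_polys_closed[OF v] by (simp only: UP.m_ac UP.m_closed)
    then show "([c] \<otimes>\<^bsub>P\<^esub> v) \<otimes>\<^bsub>P\<^esub> ([c] \<otimes>\<^bsub>P\<^esub> v) divides\<^bsub>P\<^esub> f \<longleftrightarrow> v \<otimes>\<^bsub>P\<^esub> v divides\<^bsub>P\<^esub> f"
      using const_closed[OF c] monic_polys_closed[OF v] by (simp add: const_mult_divides_iff[OF c _ fc])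
  next
    show "\<not> [] \<otimes>\<^bsub>P\<^esub> [] divides\<^bsub>P\<^esub> f"
      using zero_not_divides[OF fc monic_polys_nonempty[OF f]] UP.l_null[OF UP.zero_closed]
      by (simp add: univ_poly_zero)
  qed
  also have "\<dots> \<longleftrightarrow> M.sqfree f"
    using f by (simp add: M.sqfree_def carrier_monic_monoid mult_monic_monoid one_monic_monoid
        divides_monic_monoid_iff monic_polys_mult)
  finally show ?thesis .
qed

lemma coprime_in_const_mult_iff:
  assumes c: "c \<in> nonzero" "d \<in> nonzero" and f: "f \<in> monic_polys" and g: "g \<in> monic_polys"
  shows "coprime_in P ([c] \<otimes>\<^bsub>P\<^esub> f) ([d] \<otimes>\<^bsub>P\<^esub> g) \<longleftrightarrow> M.coprime_elts f g"
proof -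
  note fc = monic_polys_closed[OF f] and gc = monic_polys_closed[OF g]
  have "coprime_in P ([c] \<otimes>\<^bsub>P\<^esub> f) ([d] \<otimes>\<^bsub>P\<^esub> g)
      \<longleftrightarrow> (\<forall>u\<in>carrier P. u divides\<^bsub>P\<^esub> f \<and> u divides\<^bsub>P\<^esub> g \<longrightarrow> u \<in> Units P)"
    unfolding coprime_in_def
    using divides_const_mult_iff[OF c(1) _ fc] divides_const_mult_iff[OF c(2) _ gc] by blast
  also have "\<dots> \<longleftrightarrow> (\<forall>v\<in>monic_polys. v divides\<^bsub>P\<^esub> f \<and> v divides\<^bsub>P\<^esub> g \<longrightarrow> v = \<one>\<^bsub>P\<^esub>)"
    by (rule ball_Units_iff_ball_monic)
      (use zero_not_divides[OF fc monic_polys_nonempty[OF f]] in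
        \<open>auto simp: const_mult_divides_iff fc gc monic_polys_closed\<close>)
  also have "\<dots> \<longleftrightarrow> M.coprime_elts f g"
    using f g by (auto simp: M.coprime_elts_def carrier_monic_monoid one_monic_monoid divides_monic_monoid_iff)
  finally show ?thesis .
qed

end

section \<open>Families of three polynomials\<close>

definition vec3 :: "'b \<Rightarrow> 'b \<Rightarrow> 'b \<Rightarrow> 3 \<Rightarrow> 'b" where
  "vec3 a b c = (\<lambda>i. if i = 1 then a else if i = 2 then b else c)"

lemma vec3_simps [simp]: "vec3 a b c 1 = a" "vec3 a b c 2 = b" "vec3 a b c 3 = c"
  by (simp_all add: vec3_def)

lemma vec3_eta: "vec3 (f 1) (f 2) (f 3) = f"
proof
  fix i :: 3 show "vec3 (f 1) (f 2) (f 3) i = f i" by (metis exhaust_3 vec3_simps)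
qed

lemma sign_mean_3:
  "sign_mean F = (\<Sum>a\<in>{1, -1}. \<Sum>b\<in>{1, -1}. \<Sum>c\<in>{1, -1}. F (vec3 a b c)) / 8"
proof -
  let ?S = "{1, -1} :: real set"
  have "bij_betw (\<lambda>(a, b, c). vec3 a b c) (?S \<times> ?S \<times> ?S) sign_vectors"
  proof (rule bij_betwI[where g = "\<lambda>a. (a 1, a 2, a 3)"])
    show "(\<lambda>(a, b, c). vec3 a b c) \<in> ?S \<times> ?S \<times> ?S \<rightarrow> sign_vectors"
      by (auto simp: sign_vectors_def vec3_def)
    show "(\<lambda>a :: 3 \<Rightarrow> real. (a 1, a 2, a 3)) \<in> sign_vectors \<rightarrow> ?S \<times> ?S \<times> ?S"
    proof (rule funcsetI)
      fix a :: "3 \<Rightarrow> real" assume a: "a \<in> sign_vectors"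
      show "(a 1, a 2, a 3) \<in> ?S \<times> ?S \<times> ?S"
        using sign_vectorsD[OF a, of 1] sign_vectorsD[OF a, of 2] sign_vectorsD[OF a, of 3]
        by (simp only: mem_Times_iff fst_conv snd_conv)
    qed
    show "(\<lambda>(a, b, c). vec3 a b c) (a 1, a 2, a 3) = a" for a :: "3 \<Rightarrow> real"
      by (simp only: prod.case vec3_eta)
  qed auto
  from sum.reindex_bij_betw[OF this, of F, symmetric] show ?thesis
    by (simp add: sign_mean_def sum.cartesian_product split_def)
qed

definition pairing :: "(3 \<Rightarrow> real) \<Rightarrow> real" where
  "pairing a = a 1 * a 2 + a 1 * a 3 + a 2 * a 3"

lemma abs_pairing_le: "(\<And>i. a i \<in> {-1, 0, 1}) \<Longrightarrow> \<bar>pairing a\<bar> \<le> 3"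
proof -
  assume "\<And>i. a i \<in> {-1, 0, 1}"
  from this[of 1] this[of 2] this[of 3] show ?thesis by (auto simp: pairing_def)
qed

lemma set_point_pmf: "set_pmf (point_pmf q) \<subseteq> {-1, 1, 3}"
proof -
  have "3 * (real q + 2) + (6 + real q) = 4 * (real q + 3)" by simp
  then have "measure_pmf.prob (point_pmf q) {-1, 1, 3} = 1"
    by (simp add: measure_measure_pmf_finite pmf_point_pmf add_eq_0_iff flip: add_divide_distrib)
  then show ?thesis by (auto simp: measure_pmf.prob_eq_1 AE_measure_pmf_iff)
qed

lemma integral_point_pmf:
  "measure_pmf.expectation (point_pmf q) g
    = (real q * g 3 + 3 * (real q + 2) * g (-1) + 6 * g 1) / (4 * (real q + 3))"
proof -
  have "measure_pmf.expectation (point_pmf q) g = (\<Sum>x\<in>{-1, 1, 3}. g x * pmf (point_pmf q) x)"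
    by (rule integral_measure_pmf_real) (use set_point_pmf in auto)
  then show ?thesis by (simp add: pmf_point_pmf algebra_simps flip: add_divide_distrib)
qed

lemma local_mean_pairing:
  assumes "q > 0"
  shows "local_mean q (\<lambda>a. g (pairing a)) = measure_pmf.expectation (point_pmf q) g"
proof -
  have "local_mean q (\<lambda>a. g (pairing a)) = (g 3 / 4 + 3 * g (-1) / 4 + 3 * (g 1 + g (-1)) / (2 * real q)) / (1 + 3 / real q)"
    by (simp add: local_mean_def sign_mean_3 sum_3 pairing_def add_divide_distrib)
  also have "g 3 / 4 + 3 * g (-1) / 4 + 3 * (g 1 + g (-1)) / (2 * real q)
      = (real q * g 3 + 3 * (real q + 2) * g (-1) + 6 * g 1) / (4 * real q)"
    using assms by (simp add: field_simps)
  also have "1 + 3 / real q = (real q + 3) / real q"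
    using assms by (simp add: field_simps)
  also have "(real q * g 3 + 3 * (real q + 2) * g (-1) + 6 * g 1) / (4 * real q) / ((real q + 3) / real q)
      = (real q * g 3 + 3 * (real q + 2) * g (-1) + 6 * g 1) / (4 * (real q + 3))"
    using assms by simp
  finally show ?thesis by (simp only: integral_point_pmf)
qed

context finite_odd_field
begin

definition curve_triple :: "'a \<Rightarrow> 'a \<Rightarrow> (3 \<Rightarrow> 'a list) \<Rightarrow> 'a list \<times> 'a list \<times> 'a list" where
  "curve_triple \<alpha> \<beta> f = (f 1, [\<alpha>] \<otimes>\<^bsub>P\<^esub> f 2, [\<beta>] \<otimes>\<^bsub>P\<^esub> f 3)"

lemma sqfree_families_monic: "f \<in> M.sqfree_families n \<Longrightarrow> f i \<in> monic_polys"
  by (simp add: M.sqfree_families_def M.families_def carrier_monic_monoid)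

lemma const_mult_in_sqfree_polys_iff:
  assumes "c \<in> nonzero" "f \<in> monic_polys"
  shows "[c] \<otimes>\<^bsub>P\<^esub> f \<in> sqfree_polys R d \<longleftrightarrow> int (monic_degree f) = d \<and> M.sqfree f"
  using const_closed[OF assms(1)] monic_polys_closed[OF assms(2)]
    const_mult_nonempty[OF assms(1) monic_polys_closed monic_polys_nonempty, OF assms(2,2)]
  by (simp only: sqfree_polys_def monic_degree_def univ_poly_zero mem_Collect_eq Diff_iff singleton_iff UP.m_closed
      squarefree_in_const_mult_iff[OF assms]
      degree_const_mult[OF assms(1) monic_polys_closed monic_polys_nonempty, OF assms(2,2)]) simp

lemma curve_triple_in_coprime_triples_iff:
  assumes c: "\<alpha> \<in> nonzero" "\<beta> \<in> nonzero" and f: "\<And>i. f i \<in> monic_polys"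
  shows "curve_triple \<alpha> \<beta> f \<in> coprime_triples R (n 1) (n 2) (n 3) \<longleftrightarrow> f \<in> M.sqfree_families n"
proof -
  have one: "\<one> \<in> nonzero" by simp
  have f1: "[\<one>] \<otimes>\<^bsub>P\<^esub> f 1 = f 1"
    using UP.l_one[OF monic_polys_closed[OF f]] by (simp only: univ_poly_one)
  have sym: "M.coprime_elts a b \<longleftrightarrow> M.coprime_elts b a" for a b by (auto simp: M.coprime_elts_def)
  have "f \<in> M.sqfree_families n \<longleftrightarrow> (\<forall>i. int (monic_degree (f i)) = n i \<and> M.sqfree (f i))
      \<and> M.coprime_elts (f 1) (f 2) \<and> M.coprime_elts (f 1) (f 3) \<and> M.coprime_elts (f 2) (f 3)"
    using f M.sqfree_family_prod_iff[of f]
    by (auto simp: M.sqfree_families_def M.families_def carrier_monic_monoid forall_3 sym[of "f 2" "f 1"]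
        sym[of "f 3" "f 1"] sym[of "f 3" "f 2"])
  also have "\<dots> \<longleftrightarrow> curve_triple \<alpha> \<beta> f \<in> coprime_triples R (n 1) (n 2) (n 3)"
    using const_mult_in_sqfree_polys_iff[OF one f, of 1 "n 1", unfolded f1]
      const_mult_in_sqfree_polys_iff[OF c(1) f, of 2 "n 2"] const_mult_in_sqfree_polys_iff[OF c(2) f, of 3 "n 3"]
      coprime_in_const_mult_iff[OF one c(1) f f, of 1 2, unfolded f1]
      coprime_in_const_mult_iff[OF one c(2) f f, of 1 3, unfolded f1]
      coprime_in_const_mult_iff[OF c f f, of 2 3] f[of 1]
    by (auto simp: coprime_triples_def monic_sqfree_polys_def curve_triple_def forall_3 monic_polys_def)
  finally show ?thesis ..
qed

lemma bij_betw_curve_triple: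
  "bij_betw (\<lambda>((\<alpha>, \<beta>), f). curve_triple \<alpha> \<beta> f) ((nonzero \<times> nonzero) \<times> M.sqfree_families n)
    (coprime_triples R (n 1) (n 2) (n 3))"
proof (rule bij_betwI[where g = "\<lambda>(f, g, h). ((lead_coeff g, lead_coeff h), vec3 f (monic_part g) (monic_part h))"])
  show "(\<lambda>((\<alpha>, \<beta>), f). curve_triple \<alpha> \<beta> f)
      \<in> (nonzero \<times> nonzero) \<times> M.sqfree_families n \<rightarrow> coprime_triples R (n 1) (n 2) (n 3)"
    using curve_triple_in_coprime_triples_iff sqfree_families_monic by fastforce
  have inverse: "((lead_coeff g, lead_coeff h), vec3 f (monic_part g) (monic_part h))
        \<in> (nonzero \<times> nonzero) \<times> M.sqfree_families n
      \<and> curve_triple (lead_coeff g) (lead_coeff h) (vec3 f (monic_part g) (monic_part h)) = (f, g, h)"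
    if t: "(f, g, h) \<in> coprime_triples R (n 1) (n 2) (n 3)" for f g h
  proof -
    have f: "f \<in> monic_polys" and g: "g \<in> carrier P" "g \<noteq> []" and h: "h \<in> carrier P" "h \<noteq> []"
      using t by (auto simp: coprime_triples_def monic_sqfree_polys_def sqfree_polys_def monic_polys_def univ_poly_zero)
    note c = lead_coeff_closed[OF g] lead_coeff_closed[OF h]
    have eq: "curve_triple (lead_coeff g) (lead_coeff h) (vec3 f (monic_part g) (monic_part h)) = (f, g, h)"
      by (simp only: curve_triple_def vec3_simps lead_coeff_mult_monic_part[OF g] lead_coeff_mult_monic_part[OF h])
    moreover have "vec3 f (monic_part g) (monic_part h) i \<in> monic_polys" for i
      using f monic_part_monic[OF g] monic_part_monic[OF h] by (simp add: vec3_def)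
    ultimately show ?thesis
      using curve_triple_in_coprime_triples_iff[OF c, of "vec3 f (monic_part g) (monic_part h)" n] t c
      by simp
  qed
  show "(\<lambda>(f, g, h). ((lead_coeff g, lead_coeff h), vec3 f (monic_part g) (monic_part h)))
      \<in> coprime_triples R (n 1) (n 2) (n 3) \<rightarrow> (nonzero \<times> nonzero) \<times> M.sqfree_families n"
    using inverse by fastforce
  show "(\<lambda>((\<alpha>, \<beta>), f). curve_triple \<alpha> \<beta> f)
        ((\<lambda>(f, g, h). ((lead_coeff g, lead_coeff h), vec3 f (monic_part g) (monic_part h))) t) = t"
    if "t \<in> coprime_triples R (n 1) (n 2) (n 3)" for t
    using inverse that by (cases t) auto
  show "(\<lambda>(f, g, h). ((lead_coeff g, lead_coeff h), vec3 f (monic_part g) (monic_part h)))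
        ((\<lambda>((\<alpha>, \<beta>), f). curve_triple \<alpha> \<beta> f) x) = x"
    if "x \<in> (nonzero \<times> nonzero) \<times> M.sqfree_families n" for x
  proof -
    obtain \<alpha> \<beta> f where x: "x = ((\<alpha>, \<beta>), f)" by (metis prod.exhaust)
    show ?thesis
      using that vec3_eta[of f] sqfree_families_monic[of f n]
      by (simp add: x curve_triple_def lead_coeff_const_mult_monic monic_part_const_mult)
  qed
qed

lemma sum_coprime_triples:
  "(\<Sum>t\<in>coprime_triples R (n 1) (n 2) (n 3). F t)
    = (\<Sum>\<alpha>\<in>nonzero. \<Sum>\<beta>\<in>nonzero. \<Sum>f\<in>M.sqfree_families n. F (curve_triple \<alpha> \<beta> f))"
proof -
  have "(\<Sum>t\<in>coprime_triples R (n 1) (n 2) (n 3). F t)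
      = (\<Sum>(c, f)\<in>(nonzero \<times> nonzero) \<times> M.sqfree_families n. F (curve_triple (fst c) (snd c) f))"
    using sum.reindex_bij_betw[OF bij_betw_curve_triple, of F n, symmetric] by (simp add: split_def)
  also have "\<dots> = (\<Sum>c\<in>nonzero \<times> nonzero. \<Sum>f\<in>M.sqfree_families n. F (curve_triple (fst c) (snd c) f))"
    by (rule sum.cartesian_product[symmetric])
  also have "\<dots> = (\<Sum>\<alpha>\<in>nonzero. \<Sum>\<beta>\<in>nonzero. \<Sum>f\<in>M.sqfree_families n. F (curve_triple \<alpha> \<beta> f))"
    by (simp add: sum.cartesian_product')
  finally show ?thesis .
qed

lemma sum_biquadratic_family:
  fixes n :: "3 \<Rightarrow> int"
  shows "(\<Sum>t\<in>biquadratic_family R (n 1) (n 2) (n 3). F t) = (\<Sum>t\<in>coprime_triples R (n 1) (n 2) (n 3). F t)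
    + (\<Sum>i\<in>UNIV. \<Sum>t\<in>coprime_triples R ((n(i := n i - 1)) 1) ((n(i := n i - 1)) 2) ((n(i := n i - 1)) 3). F t)"
proof -
  have disjoint: "coprime_triples R a b c \<inter> coprime_triples R a' b' c' = {}"
    if "(a, b, c) \<noteq> (a', b', c')" for a b c a' b' c'
    using that by (auto simp: coprime_triples_def monic_sqfree_polys_def sqfree_polys_def)
  have finite: "finite (coprime_triples R a b c)" for a b c
    by (rule finite_subset[OF _ finite_biquadratic_family[OF finite_carrier, of a b c]])
      (auto simp: biquadratic_family_def)
  show ?thesis
    unfolding biquadratic_family_def
    by (simp add: sum_3 sum.union_disjoint finite Int_Un_distrib2 disjoint add.assoc)
qed

section \<open>Character sums of the curves at projective points\<close>

definition point_sum :: "'a list \<times> 'a list \<times> 'a list \<Rightarrow> 'a option \<Rightarrow> real" where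
  "point_sum = (\<lambda>(f, f1, f2) x. real_of_int (quadratic_char_at R (f \<otimes>\<^bsub>P\<^esub> f1) x
    + quadratic_char_at R (f \<otimes>\<^bsub>P\<^esub> f2) x + quadratic_char_at R (f1 \<otimes>\<^bsub>P\<^esub> f2) x))"

definition leading_signs :: "'a \<Rightarrow> 'a \<Rightarrow> 3 \<Rightarrow> real" where
  "leading_signs \<alpha> \<beta> = vec3 1 (of_int (quad_char \<alpha>)) (of_int (quad_char \<beta>))"

lemma point_sum_Some:
  assumes c: "\<alpha> \<in> nonzero" "\<beta> \<in> nonzero" and f: "\<And>i. f i \<in> monic_polys" and x: "x \<in> carrier R"
  shows "point_sum (curve_triple \<alpha> \<beta> f) (Some x) = pairing (\<lambda>i. leading_signs \<alpha> \<beta> i * char_at (f i) x)"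
proof -
  have char: "quad_char (eval (u \<otimes>\<^bsub>P\<^esub> v) x) = quad_char (eval u x) * quad_char (eval v x)"
    if "u \<in> carrier P" "v \<in> carrier P" for u v
    using that x by (simp add: eval_mult quad_char_mult eval_closed)
  have "eval [\<alpha>] x = \<alpha>" "eval [\<beta>] x = \<beta>" using c x by auto
  then show ?thesis
    using c[THEN const_closed] f[THEN monic_polys_closed]
    by (simp add: point_sum_def curve_triple_def quadratic_char_at_def pairing_def char_at_def leading_signs_def
        char algebra_simps)
qed

lemma quadratic_char_at_infinity:
  assumes "c \<in> nonzero" "d \<in> nonzero" "f \<in> monic_polys" "g \<in> monic_polys"
  shows "quadratic_char_at R (([c] \<otimes>\<^bsub>P\<^esub> f) \<otimes>\<^bsub>P\<^esub> ([d] \<otimes>\<^bsub>P\<^esub> g)) None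
    = (if even (monic_degree f + monic_degree g) then quad_char c * quad_char d else 0)"
proof -
  have f: "f \<in> carrier P" "f \<noteq> []" "lead_coeff f = \<one>" and g: "g \<in> carrier P" "g \<noteq> []" "lead_coeff g = \<one>"
    using assms by (simp_all add: monic_polys_def)
  note cf = UP.m_closed[OF const_closed[OF assms(1)] f(1)] const_mult_nonempty[OF assms(1) f(1,2)]
    and dg = UP.m_closed[OF const_closed[OF assms(2)] g(1)] const_mult_nonempty[OF assms(2) g(1,2)]
  have cd: "c \<in> carrier R" "d \<in> carrier R" using assms by auto
  have "lead_coeff (([c] \<otimes>\<^bsub>P\<^esub> f) \<otimes>\<^bsub>P\<^esub> ([d] \<otimes>\<^bsub>P\<^esub> g)) = c \<otimes> d"
    unfolding lead_coeff_mult[OF cf(1) dg(1) cf(2) dg(2)] lead_coeff_const_mult[OF assms(1) f(1,2)]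
      lead_coeff_const_mult[OF assms(2) g(1,2)] f(3) g(3) using cd by simp
  moreover have "degree (([c] \<otimes>\<^bsub>P\<^esub> f) \<otimes>\<^bsub>P\<^esub> ([d] \<otimes>\<^bsub>P\<^esub> g)) = monic_degree f + monic_degree g"
    unfolding degree_mult[OF cf(1) dg(1) cf(2) dg(2)] degree_const_mult[OF assms(1) f(1,2)]
      degree_const_mult[OF assms(2) g(1,2)] monic_degree_def ..
  ultimately show ?thesis unfolding quadratic_char_at_def option.case
    by (simp only: quad_char_mult[OF cd] if_not_P) simp
qed

lemma point_sum_None:
  assumes c: "\<alpha> \<in> nonzero" "\<beta> \<in> nonzero" and f: "\<And>i. f i \<in> monic_polys"
  shows "point_sum (curve_triple \<alpha> \<beta> f) None
    = (if even (monic_degree (f 1) + monic_degree (f 2)) then leading_signs \<alpha> \<beta> 1 * leading_signs \<alpha> \<beta> 2 else 0)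
    + (if even (monic_degree (f 1) + monic_degree (f 3)) then leading_signs \<alpha> \<beta> 1 * leading_signs \<alpha> \<beta> 3 else 0)
    + (if even (monic_degree (f 2) + monic_degree (f 3)) then leading_signs \<alpha> \<beta> 2 * leading_signs \<alpha> \<beta> 3 else 0)"
proof -
  have one: "\<one> \<in> nonzero" "quad_char \<one> = 1" using l_one[OF one_closed]
    by (force simp: quadratic_char_def)+
  have f1: "[\<one>] \<otimes>\<^bsub>P\<^esub> f 1 = f 1"
    using UP.l_one[OF monic_polys_closed[OF f]] by (simp only: univ_poly_one)
  show ?thesis
    unfolding point_sum_def curve_triple_def prod.case leading_signs_def vec3_simps
      quadratic_char_at_infinity[OF one(1) c(1) f f, of 1 2, unfolded f1 one(2)]
      quadratic_char_at_infinity[OF one(1) c(2) f f, of 1 3, unfolded f1 one(2)]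
      quadratic_char_at_infinity[OF c f f, of 2 3]
    by simp
qed

lemma
  assumes c: "\<alpha> \<in> nonzero" "\<beta> \<in> nonzero" and even: "even (n 1 + n 2)" "even (n 1 + n 3)"
  shows point_sum_infinity: "f \<in> M.sqfree_families n \<Longrightarrow>
      point_sum (curve_triple \<alpha> \<beta> f) None = pairing (leading_signs \<alpha> \<beta>)"
    and point_sum_infinity_lowered: "f \<in> M.sqfree_families (n(i := n i - 1)) \<Longrightarrow>
      point_sum (curve_triple \<alpha> \<beta> f) None = pairing ((leading_signs \<alpha> \<beta>)(i := 0))"
proof -
  have degree: "even (monic_degree (f i) + monic_degree (f j)) \<longleftrightarrow> even (m i + m j)"
    if "f \<in> M.sqfree_families m" for f m i j
  proof -
    have "int (monic_degree (f l)) = m l" for l using that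
      by (simp add: M.sqfree_families_def M.families_def)
    then show ?thesis by (metis even_of_nat of_nat_add)
  qed
  have even': "even (n 2 + n 3)" using even by presburger
  show "point_sum (curve_triple \<alpha> \<beta> f) None = pairing (leading_signs \<alpha> \<beta>)" if f: "f \<in> M.sqfree_families n"
    unfolding point_sum_None[OF c sqfree_families_monic[OF f]] degree[OF f] pairing_def
    using even even' by simp
  show "point_sum (curve_triple \<alpha> \<beta> f) None = pairing ((leading_signs \<alpha> \<beta>)(i := 0))"
    if f: "f \<in> M.sqfree_families (n(i := n i - 1))"
    unfolding point_sum_None[OF c sqfree_families_monic[OF f]] degree[OF f] pairing_def
    using exhaust_3[of i] even even' by auto
qed

section \<open>Averages over the family of curves\<close>

lemma sum_nonzero_quad_char:
  fixes H :: "real \<Rightarrow> real"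
  shows "(\<Sum>\<alpha>\<in>nonzero. H (of_int (quad_char \<alpha>))) = (real q - 1) / 2 * (H 1 + H (-1))"
proof -
  let ?A = "\<lambda>s. {a \<in> carrier R. quad_char a = s}"
  have card: "real (card (?A s)) = (real q - 1) / 2" if s: "s \<in> {1, -1}" for s
  proof -
    have "real (2 * card (?A s)) = real (q - 1)" using card_quad_char[OF s] by simp
    then show ?thesis using q_ge_3 by (simp add: of_nat_diff)
  qed
  have union: "nonzero = ?A 1 \<union> ?A (-1)" by (auto simp: quadratic_char_def)
  have "(\<Sum>\<alpha>\<in>nonzero. H (of_int (quad_char \<alpha>)))
      = (\<Sum>\<alpha>\<in>?A 1. H (of_int (quad_char \<alpha>))) + (\<Sum>\<alpha>\<in>?A (-1). H (of_int (quad_char \<alpha>)))"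
    unfolding union by (rule sum.union_disjoint) (use finite_carrier in auto)
  also have "\<dots> = real (card (?A 1)) * H 1 + real (card (?A (-1))) * H (-1)" by simp
  finally show ?thesis using card[of 1] card[of "-1"] by (simp add: distrib_left)
qed

text \<open>
  The first polynomial of a triple is monic, so its sign is always \<open>1\<close>; for even functions this
  makes no difference to the mean.
\<close>

lemma sum_leading_signs:
  fixes F :: "(3 \<Rightarrow> real) \<Rightarrow> real"
  assumes even: "\<And>\<sigma>. F (\<lambda>i. - \<sigma> i) = F \<sigma>"
  shows "(\<Sum>\<alpha>\<in>nonzero. \<Sum>\<beta>\<in>nonzero. F (leading_signs \<alpha> \<beta>)) = (real q - 1)\<^sup>2 * sign_mean F"
proof -
  have "(\<lambda>i. - vec3 1 (-b) (-c) i) = vec3 (-1) b c" for b c :: real by (simp add: vec3_def fun_eq_iff)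
  then have "F (vec3 (-1) b c) = F (vec3 1 (-b) (-c))" for b c
    using even[of "vec3 1 (-b) (-c)"] by simp
  then have mean: "sign_mean F = (\<Sum>b\<in>{1, -1}. \<Sum>c\<in>{1, -1}. F (vec3 1 b c)) / 4"
    by (simp add: sign_mean_3)
  have "(\<Sum>\<alpha>\<in>nonzero. \<Sum>\<beta>\<in>nonzero. F (leading_signs \<alpha> \<beta>))
      = (\<Sum>\<alpha>\<in>nonzero. (real q - 1) / 2 * (\<Sum>c\<in>{1, -1}. F (vec3 1 (of_int (quad_char \<alpha>)) c)))"
    unfolding leading_signs_def sum_nonzero_quad_char[of "\<lambda>c. F (vec3 1 (of_int (quad_char \<alpha>)) c)" for \<alpha>]
    by simp
  also have "\<dots> = (real q - 1) / 2 * ((real q - 1) / 2 * (\<Sum>b\<in>{1, -1}. \<Sum>c\<in>{1, -1}. F (vec3 1 b c)))"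
    unfolding sum_distrib_left[symmetric] sum_nonzero_quad_char[of "\<lambda>b. \<Sum>c\<in>{1, -1}. F (vec3 1 b c)"]
    by simp
  finally show ?thesis unfolding mean by (simp add: power2_eq_square)
qed

definition pairing_weight :: "('a option \<Rightarrow> real \<Rightarrow> real) \<Rightarrow> 'a option \<Rightarrow> (3 \<Rightarrow> real) \<Rightarrow> real" where
  "pairing_weight g z a = g z (pairing a)"

lemma projective_sum_uminus:
  "M.projective_sum S n (\<lambda>x. pairing_weight g (Some x)) (pairing_weight g None) (\<lambda>i. - \<sigma> i)
    = M.projective_sum S n (\<lambda>x. pairing_weight g (Some x)) (pairing_weight g None) \<sigma>"
proof -
  have uminus: "pairing_weight g z (\<lambda>i. - a i) = pairing_weight g z a" for z a
    by (simp add: pairing_weight_def pairing_def)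
  have "(\<lambda>i. - \<sigma> i)(j := 0) = (\<lambda>i. - (\<sigma>(j := 0)) i)" for j by auto
  moreover have "M.sign_twist (\<lambda>i. - \<sigma> i) (\<lambda>x. pairing_weight g (Some x))
      = M.sign_twist \<sigma> (\<lambda>x. pairing_weight g (Some x))"
    using uminus[of _ "\<lambda>i. \<sigma> i * _ i"] by (simp add: M.sign_twist_def fun_eq_iff)
  ultimately show ?thesis by (simp only: M.projective_sum_def uminus)
qed

lemma sum_point_weights_coprime_triples:
  fixes n :: "3 \<Rightarrow> int"
  assumes S: "S \<subseteq> carrier R"
    and infinity: "\<And>\<alpha> \<beta> f. \<lbrakk>\<alpha> \<in> nonzero; \<beta> \<in> nonzero; f \<in> M.sqfree_families n\<rbrakk>
      \<Longrightarrow> point_sum (curve_triple \<alpha> \<beta> f) None = pairing (\<rho> \<alpha> \<beta>)"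
  shows "(\<Sum>t\<in>coprime_triples R (n 1) (n 2) (n 3). \<Prod>z\<in>insert None (Some ` S). g z (point_sum t z))
    = (\<Sum>\<alpha>\<in>nonzero. \<Sum>\<beta>\<in>nonzero. pairing_weight g None (\<rho> \<alpha> \<beta>)
        * M.weighted_sum {} S n (M.sign_twist (leading_signs \<alpha> \<beta>) (\<lambda>x. pairing_weight g (Some x))))"
  unfolding sum_coprime_triples
proof (intro sum.cong refl)
  fix \<alpha> \<beta> assume c: "\<alpha> \<in> nonzero" "\<beta> \<in> nonzero"
  have "(\<Prod>z\<in>insert None (Some ` S). g z (point_sum (curve_triple \<alpha> \<beta> f) z)) = pairing_weight g None (\<rho> \<alpha> \<beta>)
      * M.weight S (M.sign_twist (leading_signs \<alpha> \<beta>) (\<lambda>x. pairing_weight g (Some x))) f"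
    if f: "f \<in> M.sqfree_families n" for f
  proof -
    have "finite S" using S finite_carrier finite_subset by blast
    then have "(\<Prod>z\<in>insert None (Some ` S). g z (point_sum (curve_triple \<alpha> \<beta> f) z))
        = pairing_weight g None (\<rho> \<alpha> \<beta>) * (\<Prod>x\<in>S. g (Some x) (point_sum (curve_triple \<alpha> \<beta> f) (Some x)))"
      by (simp add: prod.reindex infinity[OF c f] pairing_weight_def)
    also have "(\<Prod>x\<in>S. g (Some x) (point_sum (curve_triple \<alpha> \<beta> f) (Some x)))
        = M.weight S (M.sign_twist (leading_signs \<alpha> \<beta>) (\<lambda>x. pairing_weight g (Some x))) f"
      unfolding M.weight_def M.sign_twist_def pairing_weight_def
      using S by (intro prod.cong refl) (simp add: point_sum_Some[OF c sqfree_families_monic[OF f]] subset_iff)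
    finally show ?thesis .
  qed
  then show "(\<Sum>f\<in>M.sqfree_families n. \<Prod>z\<in>insert None (Some ` S). g z (point_sum (curve_triple \<alpha> \<beta> f) z))
      = pairing_weight g None (\<rho> \<alpha> \<beta>)
        * M.weighted_sum {} S n (M.sign_twist (leading_signs \<alpha> \<beta>) (\<lambda>x. pairing_weight g (Some x)))"
    by (simp add: M.weighted_sum_def M.nonvanishing_def sum_distrib_left)
qed

lemma sum_point_weights_biquadratic_family:
  fixes n :: "3 \<Rightarrow> int"
  assumes even: "even (n 1 + n 2)" "even (n 1 + n 3)" and S: "S \<subseteq> carrier R"
  shows "(\<Sum>t\<in>biquadratic_family R (n 1) (n 2) (n 3). \<Prod>z\<in>insert None (Some ` S). g z (point_sum t z))
    = (real q - 1)\<^sup>2 * sign_mean (M.projective_sum S n (\<lambda>x. pairing_weight g (Some x)) (pairing_weight g None))"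
proof -
  have "(\<Sum>t\<in>biquadratic_family R (n 1) (n 2) (n 3). \<Prod>z\<in>insert None (Some ` S). g z (point_sum t z))
      = (\<Sum>\<alpha>\<in>nonzero. \<Sum>\<beta>\<in>nonzero. M.projective_sum S n (\<lambda>x. pairing_weight g (Some x))
          (pairing_weight g None) (leading_signs \<alpha> \<beta>))"
  proof -
    have swap: "(\<Sum>i\<in>UNIV. \<Sum>\<alpha>\<in>nonzero. \<Sum>\<beta>\<in>nonzero. G i \<alpha> \<beta>)
        = (\<Sum>\<alpha>\<in>nonzero. \<Sum>\<beta>\<in>nonzero. \<Sum>i\<in>UNIV. G i \<alpha> \<beta>)" for G :: "3 \<Rightarrow> 'a \<Rightarrow> 'a \<Rightarrow> real"
      by (subst sum.swap) (rule sum.cong[OF refl], rule sum.swap)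
    show ?thesis
      unfolding sum_biquadratic_family M.projective_sum_def sum.distrib swap[symmetric]
      by (intro arg_cong2[where f = "(+)"] sum.cong refl sum_point_weights_coprime_triples[OF S]
          point_sum_infinity[OF _ _ even] point_sum_infinity_lowered[OF _ _ even])
  qed
  also have "\<dots> = (real q - 1)\<^sup>2
      * sign_mean (M.projective_sum S n (\<lambda>x. pairing_weight g (Some x)) (pairing_weight g None))"
    by (rule sum_leading_signs) (rule projective_sum_uminus)
  finally show ?thesis .
qed

lemma card_biquadratic_family:
  fixes n :: "3 \<Rightarrow> int"
  assumes "even (n 1 + n 2)" "even (n 1 + n 3)"
  shows "real (card (biquadratic_family R (n 1) (n 2) (n 3))) = (real q - 1)\<^sup>2 * M.projective_count n"
proof -
  have "pairing_weight (\<lambda>_ _. 1) = (\<lambda>_ _. 1)" by (simp add: pairing_weight_def fun_eq_iff)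
  then show ?thesis
    using sum_point_weights_biquadratic_family[OF assms, of "{}" "\<lambda>_ _. 1"]
    by (simp add: M.projective_sum_one sign_mean_const)
qed

lemma biquadratic_family_mean_estimate:
  fixes n :: "3 \<Rightarrow> int"
  assumes eps: "0 < \<epsilon>" "\<epsilon> < 1" and even: "even (n 1 + n 2)" "even (n 1 + n 3)" and m: "\<And>i. m \<le> n i"
    and S: "S \<subseteq> carrier R" and g: "\<And>z v. \<bar>v\<bar> \<le> 3 \<Longrightarrow> \<bar>g z v\<bar> \<le> 1"
  shows "\<bar>(\<Sum>t\<in>biquadratic_family R (n 1) (n 2) (n 3). \<Prod>z\<in>insert None (Some ` S). g z (point_sum t z))
        / real (card (biquadratic_family R (n 1) (n 2) (n 3)))
      - (\<Prod>z\<in>insert None (Some ` S). measure_pmf.expectation (point_pmf q) (g z))\<bar>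
    \<le> 4 * tail_sum 9 \<epsilon> * (4 ^ (card S + 1) * M.error_bound 9 \<epsilon> (m - int (card S)))"
proof -
  have q: "q > 0" "(real q - 1)\<^sup>2 \<noteq> 0" using q_ge_3 by auto
  have bounded: "bounded_weight (pairing_weight g z)" for z
    unfolding bounded_weight_def pairing_weight_def using abs_pairing_le g by blast
  have "finite S" using S finite_carrier finite_subset by blast
  then have "(\<Prod>z\<in>insert None (Some ` S). measure_pmf.expectation (point_pmf q) (g z))
      = (\<Prod>x\<in>S. local_mean q (pairing_weight g (Some x))) * local_mean q (pairing_weight g None)"
    unfolding pairing_weight_def local_mean_pairing[OF q(1)] by (simp add: prod.reindex)
  moreover have "CARD(3 \<times> 3) = 9" "1 + real CARD(3) = 4" by simp_all
  moreover note M.projective_mean_estimate[of \<epsilon> S "\<lambda>x. pairing_weight g (Some x)" "pairing_weight g None" m n,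
      OF eps S bounded bounded m]
  ultimately show ?thesis
    unfolding sum_point_weights_biquadratic_family[of n, OF even S] card_biquadratic_family[of n, OF even]
      mult_divide_mult_cancel_left[OF q(2)]
    by (simp only:)
qed

end

section \<open>Moments of sums of independent variables\<close>

definition tuple_count :: "nat \<Rightarrow> (nat \<Rightarrow> 'b) \<Rightarrow> 'b \<Rightarrow> nat" where
  "tuple_count k p z = card {i \<in> {..<k}. p i = z}"

lemma prod_tuple_count:
  fixes Y :: "'b \<Rightarrow> 'c::comm_monoid_mult"
  assumes "finite B" "p ` {..<k} \<subseteq> B"
  shows "(\<Prod>i<k. Y (p i)) = (\<Prod>z\<in>B. Y z ^ tuple_count k p z)"
proof -
  have "(\<Prod>i<k. Y (p i)) = (\<Prod>z\<in>B. \<Prod>i | i \<in> {..<k} \<and> p i = z. Y (p i))"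
    using prod.group[OF _ assms, of "\<lambda>i. Y (p i)"] by simp
  also have "\<dots> = (\<Prod>z\<in>B. Y z ^ tuple_count k p z)"
    by (intro prod.cong refl) (simp add: tuple_count_def)
  finally show ?thesis .
qed

lemma sum_power_eq_sum_PiE:
  fixes y :: "'b \<Rightarrow> 'c::comm_semiring_1"
  assumes "finite A"
  shows "(\<Sum>x\<in>A. y x) ^ k = (\<Sum>p\<in>{..<k} \<rightarrow>\<^sub>E A. \<Prod>i<k. y (p i))"
  using prod_sum_PiE[of "{..<k}" "\<lambda>_. A" "\<lambda>_. y"] assms by simp

lemma map_pmf_sum_Pi_pmf:
  fixes P :: "'b::comm_monoid_add pmf"
  assumes "finite A"
  shows "map_pmf (\<lambda>x. \<Sum>i\<in>A. x i) (Pi_pmf A d (\<lambda>_. P))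
    = ((\<lambda>Q. map_pmf (\<lambda>(y, s). y + s) (pair_pmf P Q)) ^^ card A) (return_pmf 0)"
  using assms
proof (induction A rule: finite_induct)
  case (insert a A)
  have "map_pmf (\<lambda>x. \<Sum>i\<in>insert a A. x i) (Pi_pmf (insert a A) d (\<lambda>_. P))
      = map_pmf (\<lambda>(y, x). y + (\<Sum>i\<in>A. x i)) (pair_pmf P (Pi_pmf A d (\<lambda>_. P)))"
    using insert.hyps
    by (auto simp: Pi_pmf_insert map_pmf_comp intro!: map_pmf_cong arg_cong2[where f = "(+)"] sum.cong)
  also have "\<dots> = map_pmf (\<lambda>(y, s). y + s) (pair_pmf P (map_pmf (\<lambda>x. \<Sum>i\<in>A. x i) (Pi_pmf A d (\<lambda>_. P))))"
    by (simp add: pair_map_pmf2 map_pmf_comp split_def)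
  finally show ?case using insert by simp
qed simp

lemma expectation_prod_Pi_pmf_integrable:
  fixes f :: "'i \<Rightarrow> 'b \<Rightarrow> real"
  assumes A: "finite A" and f: "\<And>x. x \<in> A \<Longrightarrow> integrable (measure_pmf (P x)) (f x)"
  shows "measure_pmf.expectation (Pi_pmf A d P) (\<lambda>y. \<Prod>x\<in>A. f x (y x))
    = (\<Prod>x\<in>A. measure_pmf.expectation (P x) (f x))"
proof -
  let ?M = "measure_pmf (Pi_pmf A d P)"
  have component: "P x = map_pmf (\<lambda>y. y x) (Pi_pmf A d P)" if "x \<in> A" for x
    using that A by (simp add: Pi_pmf_component)
  have "prob_space.indep_vars ?M (\<lambda>_. borel) (\<lambda>x y. f x (y x)) A"
    using prob_space.indep_vars_compose2[OF prob_space_measure_pmf indep_vars_Pi_pmf[OF A], of f "\<lambda>_. borel"]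
    by simp
  moreover have "integrable ?M (\<lambda>y. f x (y x))" if "x \<in> A" for x
    using f[OF that] unfolding component[OF that] by simp
  ultimately have "measure_pmf.expectation (Pi_pmf A d P) (\<lambda>y. \<Prod>x\<in>A. f x (y x))
      = (\<Prod>x\<in>A. measure_pmf.expectation (Pi_pmf A d P) (\<lambda>y. f x (y x)))"
    by (rule prob_space.indep_vars_lebesgue_integral[OF prob_space_measure_pmf A])
  also have "\<dots> = (\<Prod>x\<in>A. measure_pmf.expectation (P x) (f x))"
    by (intro prod.cong refl) (simp add: component)
  finally show ?thesis .
qed

lemma expectation_sum_power_Pi_pmf:
  fixes P :: "real pmf"
  assumes A: "finite A" and P: "finite (set_pmf P)"
  shows "measure_pmf.expectation (Pi_pmf A d (\<lambda>_. P)) (\<lambda>x. (\<Sum>i\<in>A. x i) ^ k)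
    = (\<Sum>p\<in>{..<k} \<rightarrow>\<^sub>E A. \<Prod>z\<in>A. measure_pmf.expectation P (\<lambda>v. v ^ tuple_count k p z))"
proof -
  let ?M = "Pi_pmf A d (\<lambda>_. P)"
  have "(\<Sum>i\<in>A. x i) ^ k = (\<Sum>p\<in>{..<k} \<rightarrow>\<^sub>E A. \<Prod>z\<in>A. x z ^ tuple_count k p z)" for x :: "'a \<Rightarrow> real"
    unfolding sum_power_eq_sum_PiE[OF A] by (intro sum.cong refl prod_tuple_count A) auto
  moreover have "finite (set_pmf ?M)"
    using A P by (auto simp: set_Pi_pmf intro!: finite_PiE_dflt)
  ultimately have "measure_pmf.expectation ?M (\<lambda>x. (\<Sum>i\<in>A. x i) ^ k)
      = (\<Sum>p\<in>{..<k} \<rightarrow>\<^sub>E A. measure_pmf.expectation ?M (\<lambda>x. \<Prod>z\<in>A. x z ^ tuple_count k p z))"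
    by (simp add: integrable_measure_pmf_finite)
  also have "\<dots> = (\<Sum>p\<in>{..<k} \<rightarrow>\<^sub>E A. \<Prod>z\<in>A. measure_pmf.expectation P (\<lambda>v. v ^ tuple_count k p z))"
    by (intro sum.cong refl expectation_prod_Pi_pmf_integrable A integrable_measure_pmf_finite P)
  finally show ?thesis .
qed

context finite_odd_field
begin

lemma finite_proj_line: "finite (proj_line R)" and card_proj_line: "card (proj_line R) = q + 1"
  using finite_carrier by (auto simp: proj_line_def card_image)

lemma expectation_sum_proj_line:
  fixes g :: "real \<Rightarrow> real"
  shows "measure_pmf.expectation (Pi_pmf {1..q + 1} d (\<lambda>_. D)) (\<lambda>x. g (\<Sum>i = 1..q + 1. x i))
    = measure_pmf.expectation (Pi_pmf (proj_line R) d (\<lambda>_. D)) (\<lambda>x. g (\<Sum>z\<in>proj_line R. x z))"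
proof -
  have "map_pmf (\<lambda>x. \<Sum>i = 1..q + 1. x i) (Pi_pmf {1..q + 1} d (\<lambda>_. D))
      = map_pmf (\<lambda>x. \<Sum>z\<in>proj_line R. x z) (Pi_pmf (proj_line R) d (\<lambda>_. D))"
    by (simp only: map_pmf_sum_Pi_pmf finite_proj_line card_proj_line finite_atLeastAtMost card_atLeastAtMost
        diff_Suc_1 add_Suc_right Suc_eq_plus1 add_diff_cancel_right')
  then show ?thesis
    using integral_map_pmf[of "\<lambda>x. \<Sum>i = 1..q + 1. x i" "Pi_pmf {1..q + 1} d (\<lambda>_. D)" g]
      integral_map_pmf[of "\<lambda>x. \<Sum>z\<in>proj_line R. x z" "Pi_pmf (proj_line R) d (\<lambda>_. D)" g] by simp
qed

lemma trace_moment_expand: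
  "trace_moment k R n n1 n2 = (- (1 / sqrt (1 + real q))) ^ k *
    (\<Sum>p\<in>{..<k} \<rightarrow>\<^sub>E proj_line R. (\<Sum>t\<in>biquadratic_family R n n1 n2. \<Prod>i<k. point_sum t (p i))
        / real (card (biquadratic_family R n n1 n2)))"
proof -
  let ?B = "biquadratic_family R n n1 n2" and ?c = "- (1 / sqrt (1 + real q))"
  have power: "(\<lambda>(f, f1, f2). (real_of_int (frob_trace R f f1 f2) / sqrt (1 + real q)) ^ k) t
      = ?c ^ k * (\<Sum>p\<in>{..<k} \<rightarrow>\<^sub>E proj_line R. \<Prod>i<k. point_sum t (p i))" for t
  proof -
    obtain f f1 f2 where t: "t = (f, f1, f2)" by (cases t)
    have "real_of_int (frob_trace R f f1 f2) / sqrt (1 + real q) = ?c * (\<Sum>x\<in>proj_line R. point_sum t x)"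
      by (simp add: t frob_trace_eq S_hat_def point_sum_def)
    then show ?thesis
      by (simp only: t prod.case power_mult_distrib sum_power_eq_sum_PiE[OF finite_proj_line])
  qed
  have "trace_moment k R n n1 n2
      = ?c ^ k * ((\<Sum>t\<in>?B. \<Sum>p\<in>{..<k} \<rightarrow>\<^sub>E proj_line R. \<Prod>i<k. point_sum t (p i)) / real (card ?B))"
    unfolding trace_moment_def power by (simp flip: sum_distrib_left)
  also have "(\<Sum>t\<in>?B. \<Sum>p\<in>{..<k} \<rightarrow>\<^sub>E proj_line R. \<Prod>i<k. point_sum t (p i))
      = (\<Sum>p\<in>{..<k} \<rightarrow>\<^sub>E proj_line R. \<Sum>t\<in>?B. \<Prod>i<k. point_sum t (p i))"
    by (rule sum.swap)
  finally show ?thesis by (simp only: sum_divide_distrib)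
qed

lemma tuple_range_subsetE:
  assumes p: "p \<in> {..<k} \<rightarrow>\<^sub>E proj_line R"
  obtains S where "S \<subseteq> carrier R" "card S \<le> k" "p ` {..<k} \<subseteq> insert None (Some ` S)"
proof
  let ?S = "{x \<in> carrier R. Some x \<in> p ` {..<k}}"
  show "?S \<subseteq> carrier R" by blast
  have "Some ` ?S \<subseteq> p ` {..<k}" by auto
  from surj_card_le[OF _ this] have "card (Some ` ?S) \<le> k" by simp
  then show "card ?S \<le> k" by (simp add: card_image)
  have range: "p ` {..<k} \<subseteq> proj_line R" using p by (simp add: PiE_iff image_subset_iff)
  show "p ` {..<k} \<subseteq> insert None (Some ` ?S)"
  proof
    fix z assume z: "z \<in> p ` {..<k}"
    then show "z \<in> insert None (Some ` ?S)"
      using subsetD[OF range z] by (cases z) (simp_all add: proj_line_def image_iff)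
  qed
qed

lemma tuple_mean_estimate:
  fixes n :: "3 \<Rightarrow> int"
  assumes eps: "0 < \<epsilon>" "\<epsilon> < 1" and even: "even (n 1 + n 2)" "even (n 1 + n 3)" and m: "\<And>i. m \<le> n i"
    and p: "p \<in> {..<k} \<rightarrow>\<^sub>E proj_line R"
  shows "\<bar>(\<Sum>t\<in>biquadratic_family R (n 1) (n 2) (n 3). \<Prod>i<k. point_sum t (p i))
        / real (card (biquadratic_family R (n 1) (n 2) (n 3)))
      - (\<Prod>z\<in>proj_line R. measure_pmf.expectation (point_pmf q) (\<lambda>v. v ^ tuple_count k p z))\<bar>
    \<le> 3 ^ k * (4 * tail_sum 9 \<epsilon> * (4 ^ (k + 1) * M.error_bound 9 \<epsilon> (m - int k)))"
    (is "\<bar>?avg - ?\<mu>\<bar> \<le> _")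
proof -
  obtain S where S: "S \<subseteq> carrier R" and card_S: "card S \<le> k" and range: "p ` {..<k} \<subseteq> insert None (Some ` S)"
    by (rule tuple_range_subsetE[OF p])
  define g where "g z v = (v / 3) ^ tuple_count k p z" for z and v :: real
  let ?Z = "insert None (Some ` S)"
  have Z: "?Z \<subseteq> proj_line R" using S by (auto simp: proj_line_def)
  have fin: "finite ?Z" by (rule finite_subset[OF Z finite_proj_line])
  have scale: "(\<Prod>z\<in>?Z. 3 ^ tuple_count k p z * F z) = 3 ^ k * (\<Prod>z\<in>?Z. F z)" for F :: "_ \<Rightarrow> real"
    using prod_tuple_count[OF fin range, of "\<lambda>_. 3 :: real"] by (simp add: prod.distrib)
  have g_scale: "3 ^ tuple_count k p z * g z v = v ^ tuple_count k p z" for z v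
    by (simp add: g_def power_divide)
  have "(\<Prod>i<k. point_sum t (p i)) = 3 ^ k * (\<Prod>z\<in>?Z. g z (point_sum t z))" for t
    unfolding scale[symmetric] g_scale by (rule prod_tuple_count[OF fin range])
  then have avg: "?avg = 3 ^ k * ((\<Sum>t\<in>biquadratic_family R (n 1) (n 2) (n 3). \<Prod>z\<in>?Z. g z (point_sum t z))
      / real (card (biquadratic_family R (n 1) (n 2) (n 3))))"
    by (simp flip: sum_distrib_left)
  have "?\<mu> = (\<Prod>z\<in>?Z. measure_pmf.expectation (point_pmf q) (\<lambda>v. v ^ tuple_count k p z))"
  proof (rule prod.mono_neutral_right[OF finite_proj_line Z], rule ballI)
    fix z assume "z \<in> proj_line R - ?Z"
    then have "tuple_count k p z = 0" using range by (auto simp: tuple_count_def)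
    then show "measure_pmf.expectation (point_pmf q) (\<lambda>v. v ^ tuple_count k p z) = 1" by simp
  qed
  also have "\<dots> = 3 ^ k * (\<Prod>z\<in>?Z. measure_pmf.expectation (point_pmf q) (g z))"
    unfolding scale[symmetric] integral_mult_right_zero[symmetric] g_scale ..
  finally have \<mu>: "?\<mu> = 3 ^ k * (\<Prod>z\<in>?Z. measure_pmf.expectation (point_pmf q) (g z))" .
  have g: "\<bar>g z v\<bar> \<le> 1" if "\<bar>v\<bar> \<le> 3" for z v
    using that by (simp add: g_def power_abs abs_divide power_le_one)
  let ?K = "tail_sum 9 \<epsilon>"
  have K: "?K \<ge> 1" by (rule tail_sum_ge_1[OF eps(1)])
  have "\<bar>?avg - ?\<mu>\<bar> \<le> 3 ^ k * (4 * ?K * (4 ^ (card S + 1) * M.error_bound 9 \<epsilon> (m - int (card S))))"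
    unfolding avg \<mu> right_diff_distrib[symmetric] abs_mult
    using biquadratic_family_mean_estimate[of \<epsilon> n m S g, OF eps even m S g] by simp
  also have "\<dots> \<le> 3 ^ k * (4 * ?K * (4 ^ (k + 1) * M.error_bound 9 \<epsilon> (m - int k)))"
    using card_S K M.error_bound_nonneg[OF eps(1)]
    by (intro mult_left_mono mult_mono M.error_bound_antimono[OF eps] power_increasing) auto
  finally show ?thesis .
qed

lemma sqrt_power_error_bound_le:
  assumes eps: "0 < \<epsilon>" "\<epsilon> < 1"
  shows "sqrt (1 + real q) ^ k * M.error_bound d \<epsilon> (m - int k)
    \<le> 2 ^ k * (2 * tail_sum d \<epsilon>) * real q powr (- ((1 - \<epsilon>) / 2) * real_of_int m + real k)"
proof -
  have K: "tail_sum d \<epsilon> \<ge> 1" by (rule tail_sum_ge_1[OF eps(1)])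
  have "sqrt (1 + real q) \<le> sqrt (4 * real q)" using q_ge_3 by (intro real_sqrt_le_mono) simp
  also have "\<dots> = 2 * real q powr (1 / 2)" by (simp add: real_sqrt_mult powr_half_sqrt)
  finally have "sqrt (1 + real q) ^ k \<le> (2 * real q powr (1 / 2)) ^ k" by (intro power_mono) auto
  also have "\<dots> = 2 ^ k * real q powr (real k / 2)"
    using q_ge_3 by (simp add: power_mult_distrib powr_powr flip: powr_realpow)
  finally have "sqrt (1 + real q) ^ k * M.error_bound d \<epsilon> (m - int k)
      \<le> 2 ^ k * real q powr (real k / 2) * M.error_bound d \<epsilon> (m - int k)"
    by (rule mult_right_mono) (rule M.error_bound_nonneg[OF eps(1)])
  also have "\<dots> = 2 ^ k * (2 * tail_sum d \<epsilon>)
      * real q powr (real k / 2 + - ((1 - \<epsilon>) / 2) * real_of_int (m - int k))"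
    unfolding M.error_bound_def powr_add by simp
  also have "\<dots> \<le> 2 ^ k * (2 * tail_sum d \<epsilon>) * real q powr (- ((1 - \<epsilon>) / 2) * real_of_int m + real k)"
  proof (intro mult_left_mono powr_mono)
    have "\<epsilon> * real k \<ge> 0" using eps by simp
    then show "real k / 2 + - ((1 - \<epsilon>) / 2) * real_of_int (m - int k) \<le> - ((1 - \<epsilon>) / 2) * real_of_int m + real k"
      by (simp add: field_simps)
  qed (use q_ge_3 K in auto)
  finally show ?thesis .
qed

lemma trace_moment_estimate:
  assumes eps: "0 < \<epsilon>" "\<epsilon> < 1" and even: "even (n + n1)" "even (n + n2)"
  shows "\<bar>trace_moment k R n n1 n2
     - measure_pmf.expectation (Pi_pmf {1..q + 1} 0 (\<lambda>_. point_pmf q))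
         (\<lambda>x. (- (1 / sqrt (1 + real q)) * (\<Sum>i = 1..q + 1. x i)) ^ k)\<bar>
    \<le> 32 * 24 ^ k * (tail_sum 9 \<epsilon>)\<^sup>2 * real q powr (- ((1 - \<epsilon>) / 2) * real (min n (min n1 n2)) + real k)"
    (is "\<bar>_ - ?E\<bar> \<le> _ * real q powr ?exponent")
proof -
  let ?r = "sqrt (1 + real q)" and ?K = "tail_sum 9 \<epsilon>" and ?m = "int (min n (min n1 n2))"
  let ?B = "biquadratic_family R n n1 n2" and ?A = "{..<k} \<rightarrow>\<^sub>E proj_line R"
  define avg where "avg p = (\<Sum>t\<in>?B. \<Prod>i<k. point_sum t (p i)) / real (card ?B)" for p
  define \<mu> where "\<mu> p = (\<Prod>z\<in>proj_line R. measure_pmf.expectation (point_pmf q) (\<lambda>v. v ^ tuple_count k p z))" for p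
  define b where "b = 3 ^ k * (4 * ?K * (4 ^ (k + 1) * M.error_bound 9 \<epsilon> (?m - int k)))"
  have term_le: "\<bar>avg p - \<mu> p\<bar> \<le> b" if p: "p \<in> ?A" for p
  proof -
    have "?m \<le> vec3 (int n) (int n1) (int n2) i" for i by (auto simp: vec3_def min_def)
    moreover have "even (int n + int n1)" "even (int n + int n2)" using even by presburger+
    ultimately show ?thesis
      using tuple_mean_estimate[of \<epsilon> "vec3 (int n) (int n1) (int n2)" ?m p k, OF eps _ _ _ p]
      by (simp add: avg_def \<mu>_def b_def)
  qed
  have "finite (set_pmf (point_pmf q))" by (rule finite_subset[OF set_point_pmf]) simp
  then have "?E = (- (1 / ?r)) ^ k * (\<Sum>p\<in>?A. \<mu> p)"
    unfolding power_mult_distrib integral_mult_right_zero \<mu>_def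
      expectation_sum_proj_line[where g = "\<lambda>s. s ^ k"]
    by (simp only: expectation_sum_power_Pi_pmf[OF finite_proj_line])
  then have "\<bar>trace_moment k R n n1 n2 - ?E\<bar> = \<bar>(- (1 / ?r)) ^ k * (\<Sum>p\<in>?A. avg p - \<mu> p)\<bar>"
    unfolding trace_moment_expand avg_def[symmetric] sum_subtractf right_diff_distrib by simp
  also have "\<dots> = (1 / ?r) ^ k * \<bar>\<Sum>p\<in>?A. avg p - \<mu> p\<bar>" by (simp add: abs_mult power_abs)
  also have "\<dots> \<le> (1 / ?r) ^ k * (\<Sum>p\<in>?A. b)"
    by (intro mult_left_mono order_trans[OF sum_abs] sum_mono term_le) auto
  also have "\<dots> = (1 / ?r * (1 + real q)) ^ k * b"
    by (simp add: card_PiE card_proj_line add.commute flip: power_mult_distrib)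
  also have "1 / ?r * (1 + real q) = ?r" by (simp add: real_div_sqrt)
  also have "?r ^ k * b = 3 ^ k * (4 * ?K * 4 ^ (k + 1)) * (?r ^ k * M.error_bound 9 \<epsilon> (?m - int k))"
    by (simp add: b_def)
  also have "\<dots> \<le> 3 ^ k * (4 * ?K * 4 ^ (k + 1)) * (2 ^ k * (2 * ?K) * real q powr ?exponent)"
    using sqrt_power_error_bound_le[OF eps, of k 9 ?m] tail_sum_ge_1[OF eps(1), of 9]
    by (intro mult_left_mono) auto
  also have "\<dots> = 32 * (3 * 4 * 2) ^ k * ?K\<^sup>2 * real q powr ?exponent"
    by (simp only: power_mult_distrib power_add power2_eq_square) simp
  finally show ?thesis by simp
qed

end

theorem theorem5p1:
  fixes k :: nat and \<epsilon> :: real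
  assumes "k \<ge> 1" and "0 < \<epsilon>" and "\<epsilon> < 1"
  shows "\<exists>C::real. \<forall>(R :: 'a ring) (q::nat) (n::nat) (n1::nat) (n2::nat).
    field R \<and> finite (carrier R) \<and> card (carrier R) = q \<and> odd q \<and>
    even (n + n1) \<and> even (n + n2) \<longrightarrow>
    \<bar>trace_moment k R n n1 n2
       - measure_pmf.expectation (Pi_pmf {1..q + 1} 0 (\<lambda>_. point_pmf q))
           (\<lambda>x. (- (1 / sqrt (1 + real q)) * (\<Sum>i = 1..q + 1. x i)) ^ k)\<bar>
    \<le> C * real q powr (- ((1 - \<epsilon>) / 2) * real (min n (min n1 n2)) + real k)"
proof (intro exI[of _ "32 * 24 ^ k * (tail_sum 9 \<epsilon>)\<^sup>2"] allI impI, elim conjE)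
  fix R :: "'a ring" and q n n1 n2 :: nat
  assume "field R" "finite (carrier R)" "card (carrier R) = q" "odd q" and even: "even (n + n1)" "even (n + n2)"
  then interpret finite_odd_field R by (simp add: finite_odd_field_def finite_odd_field_axioms_def)
  show "\<bar>trace_moment k R n n1 n2
       - measure_pmf.expectation (Pi_pmf {1..q + 1} 0 (\<lambda>_. point_pmf q))
           (\<lambda>x. (- (1 / sqrt (1 + real q)) * (\<Sum>i = 1..q + 1. x i)) ^ k)\<bar>
    \<le> 32 * 24 ^ k * (tail_sum 9 \<epsilon>)\<^sup>2 * real q powr (- ((1 - \<epsilon>) / 2) * real (min n (min n1 n2)) + real k)"
    using trace_moment_estimate[OF assms(2,3) even, of k] \<open>card (carrier R) = q\<close> by simp
qed

end
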